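(* (i) For every constant $C>0$ there exist constants $C'>0$ and $a>0$ depending only on $C$ such that for all $S\ge2$, $n\ge2$ with $\ln n\ge C\ln S$ and all $Q=(q_1,\dots,q_S)\in\mathcal{M}_S$ satisfying $$\sum_{j=1}^S q_j\wedge\sqrt{\frac{q_j}{n\ln n}}\ \ge\ C'\left(\sqrt{\frac{\ln n}{n}}+\frac{\sqrt S\ln n}{n}\right),$$ one has $$\inf_{\hat L}\sup_{P\in\mathcal{M}_S}\mathbb{E}_P\big|\hat L-\|P-Q\|_1\big|^2\ \ge\ a\left(\sum_{i=1}^S q_i\wedge\sqrt{\frac{q_i}{n\ln n}}\right)^2,$$ where the infimum is over all estimators $\hat L$ (which may depend on $Q$). (ii) For all constants $c,C>0$ there exists $a>0$ depending only on $c,C$ such that for all $S\ge2$, $n\ge2$ with $n\ge c\frac{S}{\ln S}$ and $\ln n\le C\ln S$, $$\sup_{Q\in\mathcal{M}_S}\inf_{\hat L}\sup_{P\in\mathcal{M}_S}\mathbb{E}_P\big|\hat L-\|P-Q\|_1\big|^2\ \ge\ a\,\frac{S}{n\ln n}.$$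
   Context: $\mathcal{M}_S$ is the set of probability vectors on $\{1,\dots,S\}$; $\|P-Q\|_1=\sum_i|p_i-q_i|$; $a\wedge b=\min\{a,b\}$; logarithms are natural. $Q$ is known and $P=(p_1,\dots,p_S)$ is unknown. Poisson sampling model: one observes mutually independent $X_i\sim\mathrm{Poi}(np_i)$, $1\le i\le S$; an estimator is a function of $(X_1,\dots,X_S)$. *)

theory Defs
  imports "HOL-Probability.Probability"
begin

(* Vectors indexed by {1..S} are functions on nat, fixed to 0 outside the index set. *)
definition prob_vectors :: "nat \<Rightarrow> (nat \<Rightarrow> real) set" where
  "prob_vectors S =
     {p. (\<forall>i\<in>{1..S}. 0 \<le> p i) \<and> (\<forall>i. i \<notin> {1..S} \<longrightarrow> p i = 0) \<and> (\<Sum>i=1..S. p i) = 1}"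

definition l1_dist :: "nat \<Rightarrow> (nat \<Rightarrow> real) \<Rightarrow> (nat \<Rightarrow> real) \<Rightarrow> real" where
  "l1_dist S P Q = (\<Sum>i=1..S. \<bar>P i - Q i\<bar>)"

(* poisson_pmf is specified only for positive rates; Poi(0) is the point mass at 0. *)
definition poisson_law :: "real \<Rightarrow> nat pmf" where
  "poisson_law r = (if r = 0 then return_pmf 0 else poisson_pmf r)"

definition poisson_model :: "nat \<Rightarrow> nat \<Rightarrow> (nat \<Rightarrow> real) \<Rightarrow> (nat \<Rightarrow> nat) pmf" where
  "poisson_model S n P = Pi_pmf {1..S} 0 (\<lambda>i. poisson_law (real n * P i))"

(* An estimator is an arbitrary real function of the counts: the sample space is discrete, so
   measurability is automatic, and counts outside {1..S} are constantly 0, so only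
   X 1, ..., X S carry information. Risks live in ennreal because the mean squared error may be
   infinite (the Bochner integral would then be 0). *)
definition l1_risk ::
  "nat \<Rightarrow> nat \<Rightarrow> (nat \<Rightarrow> real) \<Rightarrow> ((nat \<Rightarrow> nat) \<Rightarrow> real) \<Rightarrow> (nat \<Rightarrow> real) \<Rightarrow> ennreal" where
  "l1_risk S n Q L P =
     (\<integral>\<^sup>+ X. ennreal (\<bar>L X - l1_dist S P Q\<bar>\<^sup>2) \<partial>measure_pmf (poisson_model S n P))"

definition l1_minimax_risk :: "nat \<Rightarrow> nat \<Rightarrow> (nat \<Rightarrow> real) \<Rightarrow> ennreal" where
  "l1_minimax_risk S n Q = (INF L. SUP P\<in>prob_vectors S. l1_risk S n Q L P)"

end

theory Submission
  imports Defs "HOL-Real_Asymp.Real_Asymp"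
begin

text \<open>
  The lower bound is a comparison of two random parameters. Under each of two priors the coordinates
  \<open>p\<^sub>i\<close> are independent with mean \<open>q\<^sub>i\<close>, and the two laws of \<open>p\<^sub>i\<close> have the same moments up to an order
  \<open>D\<close> proportional to \<open>ln n\<close>. A mixture of Poisson laws whose rates lie close to a common centre is
  determined, up to an error exponentially small in \<open>D\<close>, by the first \<open>D\<close> moments of the rate
  (\<open>poisson_mixtures_close\<close>), so the data cannot tell the priors apart. The expected value of
  \<open>\<bar>p\<^sub>i - q\<^sub>i\<bar>\<close>, however, is not a polynomial in \<open>p\<^sub>i\<close>, and it can be made to differ between the two
  laws by about \<open>min q\<^sub>i (sqrt (q\<^sub>i / (n ln n)))\<close>, the error of approximating the absolute value by
  polynomials of degree \<open>D\<close> on the interval allowed for \<open>p\<^sub>i\<close> (\<open>coordinate_priors\<close>).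

  The moment matching laws are explicit. With the substitution \<open>t = 1 - cos x\<close>, polynomials in \<open>t\<close> are
  trigonometric polynomials in \<open>x\<close>, and the alternating sum of such a polynomial over an equispaced
  grid vanishes when the grid is finer than its degree. Multiplying the alternating signs by the square
  of a Fejer kernel concentrates the resulting signed measure at the kink of \<open>\<bar>t - y\<bar>\<close>, and taking
  a second difference there picks up the jump of the derivative at the kink, while the smooth part
  contributes only a term of second order in the grid width (\<open>alternating_kink_sum_le\<close>).

  Two repairs turn this into a statement about probability vectors. By Chebyshev, the total mass and the
  \<open>\<ell>\<^sub>1\<close> distance of the random vector are close to their means; the fluctuations are of the order of
  \<open>sqrt (ln n / n) + sqrt S * ln n / n\<close>, which the hypothesis of (i) makes negligible. It then remains
  to replace a random vector by its normalisation although the unnormalised vector governs the sample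
  size. For this one notes that a test working for a Poisson sample of mean \<open>n\<close> also works for some fixed
  sample size of at most \<open>2n\<close>, and that any larger sample can be thinned to exactly that size, whatever the
  total mass was (\<open>mixed_poisson_test_impossible\<close>).

  Part (ii) is part (i) for uniform \<open>Q\<close> as soon as \<open>S\<close> is large; for bounded \<open>S\<close> the sample size is
  bounded too, and already the event that nothing is observed gives a positive bound.
\<close>

section \<open>Trigonometric polynomials and the Fejer kernel on a grid\<close>

text \<open>
  Trigonometric polynomials of degree at most \<open>d\<close>, generated rather than given by coefficients so that
  closure under products and translations is a plain induction.
\<close>

inductive trig_poly :: "nat \<Rightarrow> (real \<Rightarrow> complex) \<Rightarrow> bool" for d where
  trig_poly_cis: "\<bar>l\<bar> \<le> int d \<Longrightarrow> trig_poly d (\<lambda>x. c * cis (of_int l * x))"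
| trig_poly_add: "trig_poly d f \<Longrightarrow> trig_poly d g \<Longrightarrow> trig_poly d (\<lambda>x. f x + g x)"

lemma trig_poly_mono: "trig_poly d f \<Longrightarrow> d \<le> d' \<Longrightarrow> trig_poly d' f"
  by (induction rule: trig_poly.induct) (auto intro: trig_poly.intros)

lemma trig_poly_const: "trig_poly d (\<lambda>x. c)"
  using trig_poly_cis[of 0 d c] by simp

lemma trig_poly_cmult: "trig_poly d f \<Longrightarrow> trig_poly d (\<lambda>x. a * f x)"
proof (induction rule: trig_poly.induct)
  case (trig_poly_cis l c)
  then show ?case using trig_poly.trig_poly_cis[of l d "a * c"] by (simp add: mult.assoc)
next
  case (trig_poly_add f g)
  then show ?case using trig_poly.trig_poly_add by (fastforce simp: distrib_left)
qed

lemma trig_poly_diff: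
  "trig_poly d f \<Longrightarrow> trig_poly d g \<Longrightarrow> trig_poly d (\<lambda>x. f x - g x)"
  using trig_poly_add[OF _ trig_poly_cmult[of d g "-1"], of f] by simp

lemma trig_poly_sum:
  "finite A \<Longrightarrow> (\<And>a. a \<in> A \<Longrightarrow> trig_poly d (f a)) \<Longrightarrow> trig_poly d (\<lambda>x. \<Sum>a\<in>A. f a x)"
  by (induction rule: finite_induct) (auto intro: trig_poly_const trig_poly_add)

lemma trig_poly_shift: "trig_poly d f \<Longrightarrow> trig_poly d (\<lambda>x. f (x + s))"
proof (induction rule: trig_poly.induct)
  case (trig_poly_cis l c)
  have "c * cis (of_int l * (x + s)) = (c * cis (of_int l * s)) * cis (of_int l * x)" for x
    by (simp only: mult.assoc cis_mult distrib_left add.commute)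
  then show ?case using trig_poly.trig_poly_cis[OF trig_poly_cis, of "c * cis (of_int l * s)"] by (simp only:)
qed (auto intro: trig_poly.intros)

lemma trig_poly_mult:
  assumes "trig_poly d f" "trig_poly e g"
  shows "trig_poly (d + e) (\<lambda>x. f x * g x)"
  using assms(1)
proof (induction rule: trig_poly.induct)
  case (trig_poly_cis l c)
  from assms(2) show ?case
  proof (induction rule: trig_poly.induct)
    case (trig_poly_cis l' c')
    have "c * cis (of_int l * x) * (c' * cis (of_int l' * x)) = (c * c') * cis (of_int (l + l') * x)" for x
      by (simp only: cis_mult[symmetric] distrib_right of_int_add mult.assoc mult.left_commute)
    moreover have "\<bar>l + l'\<bar> \<le> int (d + e)"
      using trig_poly_cis \<open>\<bar>l\<bar> \<le> int d\<close> by linarith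
    ultimately show ?case using trig_poly.trig_poly_cis[of "l + l'" "d + e" "c * c'"] by (simp only:)
  next
    case (trig_poly_add f g)
    then show ?case using trig_poly.trig_poly_add by (fastforce simp: distrib_left)
  qed
next
  case (trig_poly_add f g)
  then show ?case using trig_poly.trig_poly_add by (fastforce simp: distrib_right)
qed

text \<open>
  The summands run through the powers of a \<open>2N\<close>-th root of unity, which differs from \<open>1\<close> by the
  hypothesis on \<open>m\<close>.
\<close>

lemma sum_cis_grid_eq_0:
  fixes m :: int
  assumes N: "N > 0" and nd: "\<not> 2 * int N dvd m"
  shows "(\<Sum>k<2*N. cis (of_int m * (real k * (pi / real N)))) = 0"
proof -
  define w where "w = cis (of_int m * (pi / real N))"
  have pw: "w ^ k = cis (of_int m * (real k * (pi / real N)))" for k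
    unfolding w_def Complex.DeMoivre by (simp only: mult_ac)
  have "w ^ (2 * N) = cis (2 * pi * of_int m)"
    unfolding pw using N by (intro arg_cong[where f = cis]) (simp add: field_simps)
  also have "\<dots> = 1" by (rule cis_multiple_2pi) auto
  finally have 1: "w ^ (2 * N) = 1" .
  have 2: "w \<noteq> 1"
  proof
    assume "w = 1"
    hence "cos (of_int m * (pi / real N)) = 1"
      by (simp add: w_def complex_eq_iff)
    then obtain n :: int where "of_int m * (pi / real N) = of_int n * 2 * pi"
      by (auto simp: cos_one_2pi_int)
    hence "real_of_int m = real_of_int (2 * int N * n)" using N by (simp add: field_simps)
    hence "m = 2 * int N * n" by (simp only: of_int_eq_iff)
    thus False using nd by simp
  qed
  have "(\<Sum>k<2*N. w ^ k) = 0" using 1 2 by (simp add: geometric_sum)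
  thus ?thesis by (simp add: pw)
qed

text \<open>
  The sign \<open>(-1)^k\<close> is the value at the \<open>k\<close>-th node of the frequency \<open>N\<close>, so it shifts all frequencies
  of \<open>f\<close> into the range strictly between \<open>0\<close> and \<open>2N\<close>. This is the source of all matching moments
  below.
\<close>

lemma trig_poly_alternating_sum:
  assumes "trig_poly d f" "d < N"
  shows "(\<Sum>k<2*N. (-1) ^ k * f (real k * (pi / real N))) = 0"
  using assms(1)
proof (induction rule: trig_poly.induct)
  case (trig_poly_cis l c)
  have N: "N > 0" using assms by simp
  have s: "(-1) ^ k = cis (of_int (int N) * (real k * (pi / real N)))" for k :: nat
  proof -
    have "cis (of_int (int N) * (real k * (pi / real N))) = cis (real k * pi)" using N by simp
    also have "\<dots> = cis pi ^ k" by (rule Complex.DeMoivre[symmetric])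
    finally show ?thesis by simp
  qed
  have "(\<Sum>k<2*N. (-1) ^ k * (c * cis (of_int l * (real k * (pi / real N)))))
     = c * (\<Sum>k<2*N. cis (of_int (int N + l) * (real k * (pi / real N))))"
    unfolding sum_distrib_left
    by (intro sum.cong refl) (simp only: s mult.left_commute cis_mult, simp add: algebra_simps)
  also have "\<dots> = 0"
    using trig_poly_cis assms(2) zdvd_not_zless[of "int N + l" "2 * int N"]
    by (subst sum_cis_grid_eq_0[OF N]) auto
  finally show ?case .
next
  case (trig_poly_add f g)
  then show ?case by (simp add: distrib_left sum.distrib)
qed

definition fejer :: "nat \<Rightarrow> real \<Rightarrow> real" where
  "fejer M x = (cmod (\<Sum>a<M. cis (real a * x)) / real M)\<^sup>2"

lemma fejer_nonneg: "fejer M x \<ge> 0"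
  by (simp add: fejer_def)

lemma fejer_le_1: "fejer M x \<le> 1"
proof -
  have "cmod (\<Sum>a<M. cis (real a * x)) \<le> (\<Sum>a<M. 1)" by (rule sum_norm_le) simp
  hence "cmod (\<Sum>a<M. cis (real a * x)) / real M \<le> 1" by (cases "M = 0") (auto simp: divide_simps)
  thus ?thesis unfolding fejer_def by (intro power_le_one) auto
qed

lemma fejer_0: "M > 0 \<Longrightarrow> fejer M 0 = 1"
  by (simp add: fejer_def)

text \<open>
  The factor \<open>1 - cos x\<close> cancels the denominator of the closed form of the kernel. The estimate
  says that the squared kernel is concentrated on \<open>\<bar>x\<bar>\<close> of order \<open>1/M\<close>, in a form that can be summed
  over a grid without any pointwise decay estimate.
\<close>

lemma fejer_times_one_minus_cos:
  assumes "M > 0"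
  shows "fejer M x * (1 - cos x) \<le> 2 / (real M)\<^sup>2"
proof -
  let ?d = "\<Sum>a<M. cis (real a * x)"
  have d: "?d = (\<Sum>a<M. cis x ^ a)" by (simp only: Complex.DeMoivre)
  have "(1 - cis x) * ?d = 1 - cis x ^ M"
    unfolding d by (rule one_diff_power_eq[symmetric])
  hence "cmod (1 - cis x) * cmod ?d = cmod (1 - cis x ^ M)" by (metis norm_mult)
  also have "\<dots> \<le> 1 + 1"
    by (rule order.trans[OF norm_triangle_ineq4]) (simp add: norm_power)
  finally have "(cmod (1 - cis x) * cmod ?d)\<^sup>2 \<le> 2\<^sup>2" by (intro power_mono) auto
  moreover have "(cmod (1 - cis x))\<^sup>2 = 2 * (1 - cos x)"
    using sin_cos_squared_add[of x]
    by (simp only: cmod_power2) (simp add: power2_eq_square algebra_simps)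
  ultimately have "(cmod ?d)\<^sup>2 * (1 - cos x) \<le> 2" by (simp add: power_mult_distrib algebra_simps)
  hence "(cmod ?d)\<^sup>2 * (1 - cos x) / (real M)\<^sup>2 \<le> 2 / (real M)\<^sup>2" by (intro divide_right_mono) auto
  thus ?thesis by (simp add: fejer_def power_divide)
qed

lemma fejer_eq_double_sum:
  "complex_of_real (fejer M x) =
     (\<Sum>a<M. \<Sum>b<M. 1 / (of_nat M)\<^sup>2 * cis (of_int (int a - int b) * x))"
proof -
  let ?d = "\<Sum>a<M. cis (real a * x)"
  have "complex_of_real ((cmod ?d)\<^sup>2) = ?d * cnj ?d" by (rule complex_norm_square)
  also have "cnj ?d = (\<Sum>b<M. cis (- (real b * x)))" by (simp add: cis_cnj)
  also have "?d * \<dots> = (\<Sum>a<M. \<Sum>b<M. cis (of_int (int a - int b) * x))"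
    unfolding sum_product by (intro sum.cong refl) (simp add: cis_mult algebra_simps)
  finally have *: "complex_of_real ((cmod ?d)\<^sup>2) = \<dots>" .
  have "complex_of_real (fejer M x) = complex_of_real ((cmod ?d)\<^sup>2) / (of_nat M)\<^sup>2"
    by (simp add: fejer_def power_divide)
  also have "\<dots> = (\<Sum>a<M. \<Sum>b<M. 1 / (of_nat M)\<^sup>2 * cis (of_int (int a - int b) * x))"
    unfolding * by (simp add: sum_divide_distrib)
  finally show ?thesis .
qed

lemma trig_poly_fejer: "trig_poly M (\<lambda>x. complex_of_real (fejer M x))"
  unfolding fejer_eq_double_sum by (intro trig_poly_sum trig_poly_cis) auto

text \<open>
  The grid is finer than all nonzero frequencies of the kernel, so only its constant term survives.
\<close>

lemma sum_fejer_grid: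
  assumes "M > 0" "M \<le> N"
  shows "(\<Sum>k<2*N. fejer M (real k * (pi / real N))) = 2 * real N / real M"
proof -
  have N: "N > 0" using assms by simp
  have inner: "(\<Sum>k<2*N. cis (of_int (int a - int b) * (real k * (pi / real N)))) =
      (if a = b then of_nat (2*N) else 0)" if "a < M" "b < M" for a b
  proof (cases "a = b")
    case False
    have "\<not> 2 * int N dvd int a - int b"
    proof
      assume "2 * int N dvd int a - int b"
      with dvd_imp_le_int[OF _ this] False have "\<bar>2 * int N\<bar> \<le> \<bar>int a - int b\<bar>" by simp
      thus False using that assms by linarith
    qed
    thus ?thesis using False by (subst sum_cis_grid_eq_0[OF N]) simp_all
  qed simp
  have "complex_of_real (\<Sum>k<2*N. fejer M (real k * (pi / real N))) =
    (\<Sum>k<2*N. \<Sum>a<M. \<Sum>b<M. 1 / (of_nat M)\<^sup>2 * cis (of_int (int a - int b) * (real k * (pi / real N))))"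
    by (simp only: of_real_sum fejer_eq_double_sum)
  also have "\<dots> = (\<Sum>a<M. \<Sum>b<M. 1 / (of_nat M)\<^sup>2 * (\<Sum>k<2*N. cis (of_int (int a - int b) * (real k * (pi / real N)))))"
    unfolding sum_distrib_left
    by (rule trans[OF sum.swap]) (intro sum.cong refl sum.swap)
  also have "\<dots> = (\<Sum>a<M. \<Sum>b<M. 1 / (of_nat M)\<^sup>2 * (if a = b then of_nat (2*N) else 0))"
    by (intro sum.cong refl) (simp only: inner lessThan_iff)
  also have "\<dots> = (\<Sum>a<M. 1 / (of_nat M)\<^sup>2 * of_nat (2*N))"
    by (intro sum.cong refl) (subst sum_distrib_left[symmetric], subst sum.delta', auto)
  also have "\<dots> = complex_of_real (2 * real N / real M)"
    using assms by (simp add: power2_eq_square)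
  finally show ?thesis by (simp only: of_real_eq_iff)
qed

text \<open>
  Under \<open>s = t (1 - cos x)\<close> moments of a law on the line become sums of trigonometric polynomials of the
  same degree over the grid.
\<close>

lemma trig_poly_poly_cos:
  fixes p :: "real poly"
  assumes "degree p \<le> D"
  shows "trig_poly D (\<lambda>x. complex_of_real (poly p (t * (1 - cos x))))"
proof -
  have cos1: "trig_poly 1 (\<lambda>x. complex_of_real (t * (1 - cos x)))"
  proof -
    have "trig_poly 1 (\<lambda>x. of_real t - of_real t / 2 * cis (of_int 1 * x) - of_real t / 2 * cis (of_int (-1) * x))"
      by (intro trig_poly_diff trig_poly_const trig_poly_cis) auto
    moreover have "of_real t - of_real t / 2 * cis (of_int 1 * x) - of_real t / 2 * cis (of_int (-1) * x)
       = complex_of_real (t * (1 - cos x))" for x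
      by (simp add: complex_eq_iff algebra_simps)
    ultimately show ?thesis by simp
  qed
  have "trig_poly (degree p) (\<lambda>x. complex_of_real (poly p (t * (1 - cos x))))"
  proof (induction p)
    case 0 then show ?case by (simp add: trig_poly_const[of 0 0, simplified])
  next
    case (pCons a p)
    show ?case
    proof (cases "p = 0")
      case True then show ?thesis by (simp add: trig_poly_const)
    next
      case False
      have "trig_poly (1 + degree p) (\<lambda>x. of_real a + complex_of_real (t * (1 - cos x)) * complex_of_real (poly p (t * (1 - cos x))))"
        by (intro trig_poly_add trig_poly_const trig_poly_mult cos1 pCons)
      thus ?thesis using False by simp
    qed
  qed
  thus ?thesis using assms by (rule trig_poly_mono)
qed

section \<open>Second differences of a function with a kink\<close>

lemma one_minus_cos_le: "1 - cos x \<le> x\<^sup>2 / (2::real)"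
proof -
  have "1 - cos x = 2 * (sin (x/2))\<^sup>2" using cos_double_sin[of "x/2"] by simp
  moreover have "(sin (x/2))\<^sup>2 \<le> (x/2)\<^sup>2"
    by (metis abs_sin_x_le_abs_x abs_le_square_iff)
  ultimately show ?thesis by (simp add: power_divide)
qed

text \<open>
  A crude substitute for the chord bound \<open>sin x \<ge> 2 x / pi\<close>; only the linear growth matters here.
\<close>

lemma sin_ge_half:
  assumes "0 \<le> x" "x \<le> pi / 2"
  shows "x / 2 \<le> sin (x::real)"
proof (cases "cos x \<ge> 1/2")
  case True
  have "\<exists>z. 0 \<le> z \<and> z \<le> x \<and> sin x - sin 0 = (x - 0) * cos z" if "x > 0"
  proof -
    have "\<exists>z. z > 0 \<and> z < x \<and> sin x - sin 0 = (x - 0) * cos z"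
      using that by (intro MVT2) (auto intro!: derivative_eq_intros)
    thus ?thesis by (auto intro: less_imp_le)
  qed
  thus ?thesis
  proof (cases "x > 0")
    case gt: True
    then obtain z where z: "0 \<le> z" "z \<le> x" "sin x = x * cos z"
      using \<open>x > 0 \<Longrightarrow> _\<close> by auto
    have "cos x \<le> cos z" using z assms by (intro cos_monotone_0_pi_le) auto
    hence "x * (1/2) \<le> x * cos z" using True gt by (intro mult_left_mono) auto
    thus ?thesis using z by simp
  qed (use assms in auto)
next
  case False
  have "cos x \<ge> 0" using assms by (intro cos_ge_zero) auto
  hence "(cos x)\<^sup>2 \<le> (1/2)\<^sup>2" using False by (intro power_mono) auto
  hence "(sin x)\<^sup>2 \<ge> 3/4" unfolding sin_squared_eq by (simp add: power2_eq_square)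
  moreover have "sin x \<ge> 0" using assms by (intro sin_ge_zero) auto
  moreover have "(sin x)\<^sup>2 < 0.81 \<Longrightarrow> False" if "sin x \<ge> 0.9"
    using power_mono[OF that, of 2] by (simp add: power2_eq_square)
  ultimately have "sin x \<ge> 0.8"
    by (intro power2_le_imp_le[of "0.8"]) (auto simp: power2_eq_square)
  moreover have "pi < 3.2" using pi_approx by simp
  ultimately show ?thesis using assms by simp
qed

lemma one_minus_cos_ge:
  assumes "0 \<le> x" "x \<le> pi"
  shows "x\<^sup>2 / 8 \<le> 1 - cos (x::real)"
proof -
  have "(x/2/2)\<^sup>2 \<le> (sin (x/2))\<^sup>2" using assms sin_ge_half[of "x/2"] by (intro power_mono) auto
  moreover have "1 - cos x = 2 * (sin (x/2))\<^sup>2" using cos_double_sin[of "x/2"] by simp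
  ultimately show ?thesis by (simp add: power_divide)
qed

lemma one_minus_cos_add_le: "1 - cos (x + y) \<le> 2 * (1 - cos x) + 2 * (1 - cos (y::real))"
proof -
  have s: "1 - cos z = 2 * (sin (z/2))\<^sup>2" for z :: real using cos_double_sin[of "z/2"] by simp
  have "(sin ((x + y)/2))\<^sup>2 = (sin (x/2) * cos (y/2) + cos (x/2) * sin (y/2))\<^sup>2"
    by (simp add: add_divide_distrib sin_add)
  also have "\<dots> \<le> 2 * (sin (x/2) * cos (y/2))\<^sup>2 + 2 * (cos (x/2) * sin (y/2))\<^sup>2"
    using zero_le_power2[of "sin (x/2) * cos (y/2) - cos (x/2) * sin (y/2)"]
    by (simp add: power2_sum power2_diff)
  also have "\<dots> \<le> 2 * (sin (x/2))\<^sup>2 + 2 * (sin (y/2))\<^sup>2"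
    by (intro add_mono mult_left_mono)
       (simp_all add: power_mult_distrib mult_left_le mult_right_le_one_le abs_square_le_1 mult_left_le_one_le)
  finally show ?thesis unfolding s by simp
qed

text \<open>
  Half the negative second difference, with step \<open>h\<close>, of \<open>\<bar>cos \<phi> - cos x\<bar>\<close>.
\<close>

definition kink_diff :: "real \<Rightarrow> real \<Rightarrow> real \<Rightarrow> real" where
  "kink_diff \<phi> h x = \<bar>cos \<phi> - cos x\<bar> - (\<bar>cos \<phi> - cos (x + h)\<bar> + \<bar>cos \<phi> - cos (x - h)\<bar>) / 2"

text \<open>
  The level \<open>cos a\<close> is crossed on the circle exactly at \<open>a\<close> and \<open>2 pi - a\<close>.
\<close>

lemma cos_between:
  assumes "0 \<le> a" "a \<le> pi"
  shows "a \<le> x \<Longrightarrow> x \<le> 2 * pi - a \<Longrightarrow> cos x \<le> cos a"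
    and "2 * pi - a \<le> x \<Longrightarrow> x \<le> 2 * pi + a \<Longrightarrow> cos a \<le> cos x"
proof -
  assume x: "a \<le> x" "x \<le> 2 * pi - a"
  show "cos x \<le> cos a"
  proof (cases "x \<le> pi")
    case True then show ?thesis using assms x by (intro cos_monotone_0_pi_le) auto
  next
    case False
    have "cos (2 * pi - x) \<le> cos a" using assms x False by (intro cos_monotone_0_pi_le) auto
    thus ?thesis by (simp add: cos_diff)
  qed
next
  assume x: "2 * pi - a \<le> x" "x \<le> 2 * pi + a"
  have "cos a \<le> cos \<bar>x - 2 * pi\<bar>" using assms x by (intro cos_monotone_0_pi_le) auto
  also have "\<dots> = cos x" by (simp add: cos_diff)
  finally show "cos a \<le> cos x" .
qed

lemma kink_diff_at_kink:
  assumes "0 \<le> h" "h \<le> a" "a + h \<le> pi"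
  shows "kink_diff a h a = - (sin a * sin h)"
proof -
  have "cos (a + h) \<le> cos a" "cos a \<le> cos (a - h)" using assms by (intro cos_monotone_0_pi_le; simp)+
  thus ?thesis by (simp add: kink_diff_def cos_add cos_diff)
qed

lemma kink_diff_reflect: "kink_diff a h (2 * pi - x) = kink_diff a h x"
proof -
  have c: "cos (2 * pi - y) = cos y" for y by (simp add: cos_diff)
  have "cos (2 * pi - x + h) = cos (x - h)" "cos (2 * pi - x - h) = cos (x + h)"
    using c[of "x - h"] c[of "x + h"] by (simp_all add: diff_diff_eq algebra_simps)
  thus ?thesis by (simp add: kink_diff_def cos_diff)
qed

text \<open>
  Away from the kinks the function is \<open>\<plusminus>(cos \<phi> - cos x)\<close>, whose second difference is of second order
  in \<open>h\<close>, whereas at a kink it is of first order.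
\<close>

lemma kink_diff_smooth:
  assumes "0 \<le> a" "a \<le> pi"
    and "a \<le> x - h \<and> x + h \<le> 2 * pi - a \<or> 2 * pi - a \<le> x - h \<and> x + h \<le> 2 * pi + a" "0 \<le> h"
  shows "\<bar>kink_diff a h x\<bar> \<le> 1 - cos h"
proof -
  have eq: "(cos a - cos (x + h) + (cos a - cos (x - h))) / 2 = cos a - cos h * cos x"
    by (simp add: cos_add cos_diff field_simps)
  have "\<bar>kink_diff a h x\<bar> = \<bar>(1 - cos h) * cos x\<bar>"
    using assms(3)
  proof
    assume "a \<le> x - h \<and> x + h \<le> 2 * pi - a"
    hence "cos (x - h) \<le> cos a" "cos (x + h) \<le> cos a" "cos x \<le> cos a"
      using assms by (intro cos_between(1); simp)+
    hence "kink_diff a h x = cos a - cos x - (cos a - cos (x + h) + (cos a - cos (x - h))) / 2"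
      by (simp add: kink_diff_def)
    thus ?thesis unfolding eq by (simp add: algebra_simps)
  next
    assume "2 * pi - a \<le> x - h \<and> x + h \<le> 2 * pi + a"
    hence "cos a \<le> cos (x - h)" "cos a \<le> cos (x + h)" "cos a \<le> cos x"
      using assms by (intro cos_between(2); simp)+
    hence "kink_diff a h x = - (cos a - cos x) + (cos a - cos (x + h) + (cos a - cos (x - h))) / 2"
      by (simp add: kink_diff_def field_simps)
    thus ?thesis unfolding eq by (simp add: algebra_simps)
  qed
  also have "\<dots> = (1 - cos h) * \<bar>cos x\<bar>" by (simp add: abs_mult)
  also have "\<dots> \<le> (1 - cos h) * 1" by (intro mult_left_mono) auto
  finally show ?thesis by simp
qed

text \<open>
  Both kinks, at \<open>\<phi>\<close> and at \<open>2 pi - \<phi>\<close>, lie on the grid and are an even number \<open>2N - 2j\<close> of nodes apart.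
  Hence their contributions carry the same sign and the second one can be dropped.
\<close>

lemma alternating_kink_sum_le:
  fixes N j :: nat and w :: "nat \<Rightarrow> real"
  assumes j: "0 < j" "2 * j \<le> N" and w: "\<And>k. 0 \<le> w k" "w 0 = 1"
  defines "h \<equiv> pi / real N" and "\<phi> \<equiv> real j * (pi / real N)"
  shows "(\<Sum>k<2*N. (-1) ^ k * w k * kink_diff \<phi> h (\<phi> + real k * h))
           \<le> (1 - cos h) * (\<Sum>k<2*N. w k) - sin \<phi> * sin h"
proof -
  have N: "N > 0" using j by simp
  have h0: "h > 0" using N by (simp add: h_def)
  have Nh: "real N * h = pi" using N by (simp add: h_def)
  have ph: "\<phi> = real j * h" by (simp add: \<phi>_def h_def)
  have hphi: "h \<le> \<phi>" using j h0 by (simp add: ph)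
  have "real (j + 1) * h \<le> real N * h" using j h0 by (intro mult_right_mono) auto
  hence phi1: "\<phi> + h \<le> pi" unfolding Nh by (simp add: ph algebra_simps)
  have phi0: "0 \<le> \<phi>" "\<phi> \<le> pi" using hphi h0 phi1 by auto
  have s0: "0 \<le> sin \<phi> * sin h" using phi0 h0 phi1 hphi by (intro mult_nonneg_nonneg sin_ge_zero) auto
  have c0: "0 \<le> 1 - cos h" by simp
  have A0: "kink_diff \<phi> h \<phi> = - (sin \<phi> * sin h)"
    using h0 hphi phi1 by (intro kink_diff_at_kink) auto
  have bound: "(-1) ^ k * w k * kink_diff \<phi> h (\<phi> + real k * h)
      \<le> (1 - cos h) * w k - (if k = 0 then sin \<phi> * sin h else 0)" if k: "k < 2 * N" for k
  proof -
    consider "k = 0" | "k = 2 * N - 2 * j" | "0 < k" "k < 2 * N - 2 * j" | "2 * N - 2 * j < k"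
      by linarith
    thus ?thesis
    proof cases
      case 1 thus ?thesis using A0 w c0 by simp
    next
      case 2
      have "real k * h = 2 * (real N * h) - 2 * (real j * h)"
        using 2 j by (simp add: of_nat_diff algebra_simps)
      hence "\<phi> + real k * h = 2 * pi - \<phi>" unfolding Nh ph by simp
      hence "kink_diff \<phi> h (\<phi> + real k * h) = - (sin \<phi> * sin h)" by (simp only: A0 kink_diff_reflect)
      moreover have "even k" "k \<noteq> 0" using 2 j by auto
      moreover have "0 \<le> w k * (sin \<phi> * sin h)" "0 \<le> (1 - cos h) * w k"
        using w(1)[of k] s0 c0 by (simp_all only: mult_nonneg_nonneg)
      ultimately show ?thesis by simp
    next
      case 3
      have "real (k + 1) * h \<le> real (2 * N - 2 * j) * h" using 3 h0 by (intro mult_right_mono) auto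
      also have "\<dots> = 2 * (real N * h) - 2 * (real j * h)" using j by (simp add: of_nat_diff algebra_simps)
      finally have u: "real k * h + h \<le> 2 * pi - 2 * \<phi>" unfolding Nh ph by (simp add: algebra_simps)
      have "h \<le> real k * h" using 3 h0 by simp
      hence "\<bar>kink_diff \<phi> h (\<phi> + real k * h)\<bar> \<le> 1 - cos h"
        using u phi0 h0 by (intro kink_diff_smooth) auto
      hence "\<bar>(-1) ^ k * w k * kink_diff \<phi> h (\<phi> + real k * h)\<bar> \<le> w k * (1 - cos h)"
        using w(1)[of k] by (simp add: abs_mult mult_left_mono)
      thus ?thesis using 3 by (simp add: mult.commute)
    next
      case 4
      have "real (2 * N - 2 * j + 1) * h \<le> real k * h" using 4 h0 by (intro mult_right_mono) auto
      moreover have "real (2 * N - 2 * j + 1) * h = 2 * (real N * h) - 2 * (real j * h) + h"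
        using j by (simp add: of_nat_diff algebra_simps)
      ultimately have l: "2 * pi - 2 * \<phi> + h \<le> real k * h" unfolding Nh ph by simp
      have "real (k + 1) * h \<le> real (2 * N) * h" using k h0 by (intro mult_right_mono) auto
      hence "real k * h + h \<le> 2 * pi" using Nh by (simp add: algebra_simps)
      hence "\<bar>kink_diff \<phi> h (\<phi> + real k * h)\<bar> \<le> 1 - cos h"
        using l phi0 h0 by (intro kink_diff_smooth) auto
      hence "\<bar>(-1) ^ k * w k * kink_diff \<phi> h (\<phi> + real k * h)\<bar> \<le> w k * (1 - cos h)"
        using w(1)[of k] by (simp add: abs_mult mult_left_mono)
      thus ?thesis using 4 j by (simp add: mult.commute)
    qed
  qed
  have "(\<Sum>k<2*N. (-1) ^ k * w k * kink_diff \<phi> h (\<phi> + real k * h))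
      \<le> (\<Sum>k<2*N. (1 - cos h) * w k - (if k = 0 then sin \<phi> * sin h else 0))"
    by (intro sum_mono bound) auto
  also have "\<dots> = (1 - cos h) * (\<Sum>k<2*N. w k) - sin \<phi> * sin h"
    using N by (simp add: sum_subtractf sum_distrib_left sum.delta)
  finally show ?thesis .
qed

section \<open>Moment matching laws that separate the absolute deviation\<close>

lemma finite_pmf_exists:
  fixes w :: "'a \<Rightarrow> real"
  assumes I: "finite I" "\<And>i. i \<in> I \<Longrightarrow> 0 \<le> w i" "sum w I = 1"
  shows "\<exists>p. set_pmf p \<subseteq> I \<and>
    (\<forall>F :: 'a \<Rightarrow> real. measure_pmf.expectation p F = (\<Sum>i\<in>I. w i * F i))"
proof -
  let ?w = "\<lambda>i. if i \<in> I then w i else 0"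
  define p where "p = embed_pmf ?w"
  have "(\<integral>\<^sup>+ x. ennreal (?w x) \<partial>count_space UNIV) = (\<Sum>x\<in>I. ennreal (?w x))"
    using I by (intro nn_integral_count_space') auto
  also have "\<dots> = 1" using I by (simp add: sum_ennreal)
  finally have pmf: "pmf p x = ?w x" for x
    unfolding p_def using I by (intro pmf_embed_pmf) auto
  have sub: "set_pmf p \<subseteq> I" by (auto simp: set_pmf_eq pmf split: if_splits)
  moreover have "measure_pmf.expectation p F = (\<Sum>i\<in>I. w i * F i)" for F :: "'a \<Rightarrow> real"
    using I sub by (subst integral_measure_pmf[of I]) (auto simp: pmf)
  ultimately show ?thesis by blast
qed

text \<open>
  A node \<open>k\<close> is drawn with probability proportional to the squared Fejer kernel centred at the kink \<open>\<phi>\<close>.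
  One law keeps the even nodes and moves the odd ones to a random neighbour, the other law does the
  opposite. The difference of the two expectations of \<open>F\<close> is then the alternating sum of the kernel times
  the second difference of \<open>F\<close>: it vanishes on polynomials of degree at most \<open>D\<close>, since the grid has
  \<open>8D\<close> nodes and the degrees add up to \<open>3D\<close>, and on the deviation from the kink it is dominated by the
  kink itself. The lower bound on \<open>j\<close> keeps the kink away from the end of the interval by enough nodes for
  the first order term to win, and makes the spread of the kernel small compared with \<open>1 - cos \<phi>\<close>, so
  that the mean is of the order of the location of the kink.
\<close>

lemma fejer_priors:
  fixes D j :: nat and \<tau> :: real
  assumes D: "16 \<le> D" and j: "32 \<le> j" "j \<le> 2 * D" and \<tau>: "0 \<le> \<tau>" "\<tau> \<le> 1"
  defines "h \<equiv> pi / real (4 * D)" and "\<phi> \<equiv> real j * (pi / real (4 * D))"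
  obtains \<mu>0 \<mu>1 :: "real pmf" where
    "finite (set_pmf \<mu>0)" "finite (set_pmf \<mu>1)" "set_pmf \<mu>0 \<subseteq> {0..2}" "set_pmf \<mu>1 \<subseteq> {0..2}"
    "\<And>p. degree p \<le> D \<Longrightarrow> measure_pmf.expectation \<mu>0 (poly p) = measure_pmf.expectation \<mu>1 (poly p)"
    "measure_pmf.expectation \<mu>0 (\<lambda>t. t) \<le> 3 * (\<tau> * (1 - cos \<phi>))"
    "measure_pmf.expectation \<mu>0 (\<lambda>t. \<bar>t - \<tau> * (1 - cos \<phi>)\<bar>) + \<tau> * (sin \<phi> * sin h) / 16
       \<le> measure_pmf.expectation \<mu>1 (\<lambda>t. \<bar>t - \<tau> * (1 - cos \<phi>)\<bar>)"
proof -
  define N where "N = 4 * D"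
  have N: "N > 0" "2 * j \<le> N" using D j by (auto simp: N_def)
  have h_eq: "h = pi / real N" and ph: "\<phi> = real j * h" by (simp_all add: h_def \<phi>_def N_def)
  have h0: "h > 0" using N by (simp add: h_eq)
  have phi_le: "\<phi> \<le> pi / 2"
  proof -
    have "real (2 * j) * h \<le> real N * h" using N h0 by (intro mult_right_mono) auto
    also have "\<dots> = pi" using N by (simp add: h_eq)
    finally show ?thesis by (simp add: ph)
  qed
  have "real 32 * h \<le> real j * h" using j h0 by (intro mult_right_mono) auto
  hence phi_ge: "32 * h \<le> \<phi>" by (simp add: ph)
  define g where "g = (\<lambda>x. (fejer D x)\<^sup>2)"
  define Z where "Z = (\<Sum>k<2*N. g (real k * h))"
  have g0: "g x \<ge> 0" for x by (simp add: g_def)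
  have g_le: "g x \<le> fejer D x" for x
    using fejer_le_1[of D x] fejer_nonneg[of D x] by (simp add: g_def power2_eq_square mult_left_le)
  have sumF: "(\<Sum>k<2*N. fejer D (real k * h)) = 8"
    using sum_fejer_grid[of D N] D unfolding h_eq by (simp add: N_def)
  have Z8: "Z \<le> 8"
    unfolding Z_def sumF[symmetric] by (intro sum_mono g_le)
  have Z1: "Z \<ge> 1"
  proof -
    have "g (real 0 * h) \<le> Z"
      unfolding Z_def by (rule member_le_sum) (use N g0 in auto)
    thus ?thesis using D by (simp add: g_def fejer_0)
  qed
  have Znz: "Z \<noteq> 0" using Z1 by simp
  define T where "T = (\<lambda>x. \<tau> * (1 - cos x))"
  \<comment> \<open>the Boolean \<open>a\<close> selects the parity of the nodes that stay in place; \<open>b\<close> selects the neighbour\<close>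
  define pts where "pts = (\<lambda>a (k, b). let x = \<phi> + real k * h in
      if even k = a then x else if b then x + h else x - h)"
  let ?I = "{..<2*N} \<times> (UNIV :: bool set)"
  let ?w = "\<lambda>(k, b :: bool). g (real k * h) / (2 * Z)"
  have "sum ?w ?I = (\<Sum>k<2*N. g (real k * h) / Z)"
    by (simp add: sum.cartesian_product[symmetric] UNIV_bool)
  also have "\<dots> = 1" using Z1 by (simp add: sum_divide_distrib[symmetric] Z_def[symmetric])
  finally have w1: "sum ?w ?I = 1" .
  have w0: "0 \<le> ?w i" for i using Z1 g0 by (cases i) simp
  have "finite ?I" by simp
  from finite_pmf_exists[OF this w0 w1] obtain W where W: "set_pmf W \<subseteq> ?I"
    "\<And>F :: _ \<Rightarrow> real. measure_pmf.expectation W F = (\<Sum>i\<in>?I. ?w i * F i)"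
    by blast
  define \<mu> where "\<mu> = (\<lambda>a. map_pmf (\<lambda>i. T (pts a i)) W)"
  have finW: "finite (set_pmf W)" by (rule finite_subset[OF W(1)]) simp
  have fin: "finite (set_pmf (\<mu> a))" for a by (simp add: \<mu>_def finW)
  have T02: "T x \<in> {0..2}" for x
  proof -
    have "\<tau> * (1 - cos x) \<le> 1 * 2" using \<tau> cos_ge_minus_one[of x] by (intro mult_mono) auto
    thus ?thesis using \<tau> by (simp add: T_def)
  qed
  have supp: "set_pmf (\<mu> a) \<subseteq> {0..2}" for a using T02 by (auto simp: \<mu>_def)
  \<comment> \<open>conditional expectation of \<open>F\<close> given the drawn node \<open>k\<close>\<close>
  define v where "v = (\<lambda>a F k. let x = \<phi> + real k * h in
      if even k = a then F (T x) else (F (T (x + h)) + F (T (x - h))) / (2::real))"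
  have E: "measure_pmf.expectation (\<mu> a) F = (\<Sum>k<2*N. g (real k * h) * v a F k) / Z" for a F
  proof -
    have "measure_pmf.expectation (\<mu> a) F = (\<Sum>(k,b)\<in>?I. g (real k * h) / (2 * Z) * F (T (pts a (k, b))))"
      unfolding \<mu>_def integral_map_pmf W(2) by (intro sum.cong) auto
    also have "\<dots> = (\<Sum>k<2*N. g (real k * h) * v a F k / Z)"
      unfolding sum.cartesian_product[symmetric]
      by (intro sum.cong refl) (use Znz in \<open>simp add: UNIV_bool pts_def v_def Let_def field_simps\<close>)
    finally show ?thesis by (simp add: sum_divide_distrib)
  qed
  have diff: "measure_pmf.expectation (\<mu> True) F - measure_pmf.expectation (\<mu> False) F =
      (\<Sum>k<2*N. (-1) ^ k * g (real k * h) *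
         (F (T (\<phi> + real k * h)) - (F (T (\<phi> + real k * h + h)) + F (T (\<phi> + real k * h - h))) / 2)) / Z" for F
    unfolding E diff_divide_distrib[symmetric] sum_subtractf[symmetric]
    by (rule arg_cong2[where f = "(/)", OF sum.cong[OF refl] refl]) (auto simp: v_def Let_def field_simps)

  have moments: "measure_pmf.expectation (\<mu> True) (poly p) = measure_pmf.expectation (\<mu> False) (poly p)"
    if p: "degree p \<le> D" for p
  proof -
    let ?P = "\<lambda>x. complex_of_real (poly p (T x))"
    have P: "trig_poly D ?P" unfolding T_def by (rule trig_poly_poly_cos[OF p])
    have G: "trig_poly (D + D) (\<lambda>x. complex_of_real (g x))"
      using trig_poly_mult[OF trig_poly_fejer[of D] trig_poly_fejer[of D]] by (simp add: g_def power2_eq_square)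
    let ?R = "\<lambda>x. complex_of_real (g x) * (?P (x + \<phi>) - 1/2 * (?P (x + (\<phi> + h)) + ?P (x + (\<phi> - h))))"
    have "trig_poly (D + D + D) ?R"
      by (rule trig_poly_mult[OF G trig_poly_diff[OF trig_poly_shift[OF P]
            trig_poly_cmult[OF trig_poly_add[OF trig_poly_shift[OF P] trig_poly_shift[OF P]]]]])
    hence "(\<Sum>k<2*N. (-1) ^ k * ?R (real k * (pi / real N))) = 0"
      by (rule trig_poly_alternating_sum) (use D in \<open>simp add: N_def\<close>)
    moreover have "(\<Sum>k<2*N. (-1) ^ k * ?R (real k * (pi / real N))) = complex_of_real
      (\<Sum>k<2*N. (-1) ^ k * g (real k * h) * (poly p (T (\<phi> + real k * h)) -
         (poly p (T (\<phi> + real k * h + h)) + poly p (T (\<phi> + real k * h - h))) / 2))"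
      unfolding of_real_sum h_eq[symmetric] by (intro sum.cong refl) (simp add: algebra_simps)
    ultimately show ?thesis using diff[of "poly p"] by (simp only: of_real_eq_0_iff)
  qed

  have mean: "measure_pmf.expectation (\<mu> True) (\<lambda>t. t) \<le> 3 * (\<tau> * (1 - cos \<phi>))"
  proof -
    have v: "g (real k * h) * v True (\<lambda>t. t) k
        \<le> \<tau> * ((2 * (1 - cos \<phi>) + (1 - cos h)) * g (real k * h) + 4 / (real D)\<^sup>2 * fejer D (real k * h))" for k
    proof -
      let ?u = "real k * h" and ?x = "\<phi> + real k * h"
      have "(cos (?x + h) + cos (?x - h)) / 2 = cos h * cos ?x" by (simp add: cos_add cos_diff)
      moreover have "0 \<le> (1 - cos ?x) * (1 - cos h)" by (intro mult_nonneg_nonneg) auto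
      ultimately have "1 - (cos (?x + h) + cos (?x - h)) / 2 \<le> (1 - cos ?x) + (1 - cos h)"
        by (simp add: algebra_simps)
      hence "\<tau> * (1 - (cos (?x + h) + cos (?x - h)) / 2) \<le> \<tau> * ((1 - cos ?x) + (1 - cos h))"
        using \<tau> by (intro mult_left_mono)
      moreover have "\<tau> * (1 - cos ?x) \<le> \<tau> * ((1 - cos ?x) + (1 - cos h))"
        using \<tau> by (intro mult_left_mono) auto
      ultimately have "v True (\<lambda>t. t) k \<le> \<tau> * ((1 - cos ?x) + (1 - cos h))"
        by (simp add: v_def T_def Let_def field_simps)
      also have "\<dots> \<le> \<tau> * ((2 * (1 - cos \<phi>) + (1 - cos h)) + 2 * (1 - cos ?u))"
        using \<tau> one_minus_cos_add_le[of \<phi> ?u] by (intro mult_left_mono) auto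
      finally have "g ?u * v True (\<lambda>t. t) k \<le> g ?u * (\<tau> * ((2 * (1 - cos \<phi>) + (1 - cos h)) + 2 * (1 - cos ?u)))"
        using g0 by (intro mult_left_mono)
      also have "\<dots> = \<tau> * ((2 * (1 - cos \<phi>) + (1 - cos h)) * g ?u + 2 * (fejer D ?u * (fejer D ?u * (1 - cos ?u))))"
        by (simp add: g_def power2_eq_square algebra_simps)
      also have "\<dots> \<le> \<tau> * ((2 * (1 - cos \<phi>) + (1 - cos h)) * g ?u + 2 * (fejer D ?u * (2 / (real D)\<^sup>2)))"
        using \<tau> D by (intro mult_left_mono add_left_mono fejer_times_one_minus_cos fejer_nonneg) auto
      finally show ?thesis by (simp add: algebra_simps)
    qed
    have "measure_pmf.expectation (\<mu> True) (\<lambda>t. t) \<le>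
      (\<Sum>k<2*N. \<tau> * ((2 * (1 - cos \<phi>) + (1 - cos h)) * g (real k * h) + 4 / (real D)\<^sup>2 * fejer D (real k * h))) / Z"
      unfolding E using Z1 by (intro divide_right_mono sum_mono v) auto
    also have "\<dots> = \<tau> * ((2 * (1 - cos \<phi>) + (1 - cos h)) * Z + 32 / (real D)\<^sup>2) / Z"
      by (simp only: sum_distrib_left[symmetric] sum.distrib Z_def[symmetric] sumF) simp
    also have "\<dots> = \<tau> * (2 * (1 - cos \<phi>) + (1 - cos h) + 32 / (real D)\<^sup>2 / Z)"
      using Z1 by (simp add: field_simps)
    also have "\<dots> \<le> \<tau> * (3 * (1 - cos \<phi>))"
    proof (rule mult_left_mono[OF _ \<tau>(1)])
      have "32 / (real D)\<^sup>2 / Z \<le> 32 / (real D)\<^sup>2"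
        using Z1 divide_left_mono[of 1 Z "32 / (real D)\<^sup>2"] by simp
      also have "\<dots> \<le> 64 * h\<^sup>2"
      proof -
        have "64 * h\<^sup>2 = 4 * pi\<^sup>2 / (real D)\<^sup>2" by (simp add: h_def power_divide power_mult_distrib)
        moreover have "3\<^sup>2 \<le> pi\<^sup>2" using pi_gt3 by (intro power_mono) auto
        ultimately show ?thesis by (simp add: divide_right_mono)
      qed
      finally have 1: "32 / (real D)\<^sup>2 / Z \<le> 64 * h\<^sup>2" .
      have "(32 * h)\<^sup>2 \<le> \<phi>\<^sup>2" using phi_ge h0 by (intro power_mono) auto
      hence "128 * h\<^sup>2 \<le> 1 - cos \<phi>"
        using one_minus_cos_ge[of \<phi>] phi_ge phi_le h0 by (simp add: power_mult_distrib)
      moreover have "1 - cos h \<le> h\<^sup>2 / 2" by (rule one_minus_cos_le)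
      moreover have "2 * a + b + e \<le> 3 * a" if "128 * s \<le> a" "b \<le> s / 2" "e \<le> 64 * s" "0 \<le> s"
        for a b e s :: real using that by linarith
      ultimately show "2 * (1 - cos \<phi>) + (1 - cos h) + 32 / (real D)\<^sup>2 / Z \<le> 3 * (1 - cos \<phi>)"
        using 1 zero_le_power2[of h] by blast
    qed
    finally show ?thesis by (simp add: algebra_simps)
  qed

  let ?f = "\<lambda>t. \<bar>t - \<tau> * (1 - cos \<phi>)\<bar>"
  have sep: "measure_pmf.expectation (\<mu> True) ?f + \<tau> * (sin \<phi> * sin h) / 16 \<le> measure_pmf.expectation (\<mu> False) ?f"
  proof -
    have s1: "16 * h \<le> sin \<phi>" using sin_ge_half[of \<phi>] phi_ge phi_le h0 by auto
    have s2: "h / 2 \<le> sin h" using h0 phi_ge phi_le by (intro sin_ge_half) auto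
    have "16 * h * (h / 2) \<le> sin \<phi> * sin h" using s1 s2 h0 by (intro mult_mono) auto
    hence ss: "8 * h\<^sup>2 \<le> sin \<phi> * sin h" by (simp add: power2_eq_square)
    have "(1 - cos h) * Z \<le> h\<^sup>2 / 2 * 8" using one_minus_cos_le[of h] Z8 Z1 by (intro mult_mono) auto
    \<comment> \<open>the smooth part costs at most half of the kink; this is where \<open>32 \<le> j\<close> enters\<close>
    hence err: "(1 - cos h) * Z \<le> sin \<phi> * sin h / 2" using ss by simp
    have f: "?f (T x) = \<tau> * \<bar>cos \<phi> - cos x\<bar>" for x
    proof -
      have "T x - \<tau> * (1 - cos \<phi>) = \<tau> * (cos \<phi> - cos x)" by (simp add: T_def algebra_simps)
      thus ?thesis using \<tau> by (simp add: abs_mult)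
    qed
    have "measure_pmf.expectation (\<mu> True) ?f - measure_pmf.expectation (\<mu> False) ?f =
        \<tau> * (\<Sum>k<2*N. (-1) ^ k * g (real k * h) * kink_diff \<phi> h (\<phi> + real k * h)) / Z"
      unfolding diff f sum_distrib_left
      by (rule arg_cong2[where f = "(/)", OF sum.cong[OF refl] refl])
         (simp add: kink_diff_def field_simps)
    also have "\<dots> \<le> \<tau> * ((1 - cos h) * Z - sin \<phi> * sin h) / Z"
      using alternating_kink_sum_le[of j N "\<lambda>k. g (real k * h)"] j N g0 \<tau> Z1 D
      unfolding Z_def h_eq ph by (intro divide_right_mono mult_left_mono) (auto simp: g_def fejer_0)
    also have "\<dots> \<le> \<tau> * (- (sin \<phi> * sin h / 2)) / Z"
      using err \<tau> Z1 by (intro divide_right_mono mult_left_mono) auto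
    also have "\<dots> = - (\<tau> * (sin \<phi> * sin h) / (2 * Z))" by (simp add: field_simps)
    also have "\<dots> \<le> - (\<tau> * (sin \<phi> * sin h) / 16)"
    proof -
      have "0 \<le> \<tau> * (sin \<phi> * sin h)" using \<tau> ss zero_le_power2[of h] by (intro mult_nonneg_nonneg[OF \<tau>(1)]) linarith
      hence "\<tau> * (sin \<phi> * sin h) / 16 \<le> \<tau> * (sin \<phi> * sin h) / (2 * Z)"
        using Z8 Z1 by (intro divide_left_mono) auto
      thus ?thesis by simp
    qed
    finally show ?thesis by simp
  qed
  show ?thesis by (rule that[OF fin[of True] fin[of False] supp supp moments mean sep])
qed

text \<open>
  The kink has to be a node of the grid, so an arbitrary location \<open>y\<close> is reached by a small rescaling
  \<open>\<tau>\<close> of the interval. If \<open>y\<close> is so small that even the smallest admissible kink lies to its right,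
  the rescaling becomes substantial, and the separation is proportional to \<open>y\<close> rather than to
  \<open>sqrt y / D\<close>.
\<close>

lemma unit_interval_priors:
  fixes D :: nat and y :: real
  assumes D: "16 \<le> D" and y: "0 < y" "y \<le> 1"
  obtains \<mu>0 \<mu>1 :: "real pmf" where
    "finite (set_pmf \<mu>0)" "finite (set_pmf \<mu>1)" "set_pmf \<mu>0 \<subseteq> {0..2}" "set_pmf \<mu>1 \<subseteq> {0..2}"
    "\<And>p. degree p \<le> D \<Longrightarrow> measure_pmf.expectation \<mu>0 (poly p) = measure_pmf.expectation \<mu>1 (poly p)"
    "measure_pmf.expectation \<mu>0 (\<lambda>t. t) \<le> 3 * y"
    "measure_pmf.expectation \<mu>0 (\<lambda>t. \<bar>t - y\<bar>) + min y (sqrt y / real D) / 1024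
       \<le> measure_pmf.expectation \<mu>1 (\<lambda>t. \<bar>t - y\<bar>)"
proof -
  define h where "h = pi / real (4 * D)"
  have h0: "h > 0" using D by (simp add: h_def)
  let ?P = "\<lambda>j::nat. 32 \<le> j \<and> y \<le> 1 - cos (real j * h)"
  \<comment> \<open>the first admissible node to the right of \<open>y\<close>; minimality bounds \<open>j\<close> by a multiple of \<open>D * sqrt y\<close>\<close>
  define j where "j = (LEAST j. ?P j)"
  have "real (2 * D) * h = pi / 2" using D by (simp add: h_def)
  hence "cos (real (2 * D) * h) = 0" by (simp only: cos_pi_half)
  hence P: "?P (2 * D)" using D y by linarith
  have Pj: "?P j" unfolding j_def by (rule LeastI[of ?P, OF P])
  have j2D: "j \<le> 2 * D" unfolding j_def by (rule Least_le[of ?P, OF P])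
  define \<phi> where "\<phi> = real j * h"
  have "real j * h \<le> real (2 * D) * h" using j2D h0 by (intro mult_right_mono) auto
  hence phi: "\<phi> \<le> pi / 2" using D by (simp add: \<phi>_def h_def)
  have "1 * h \<le> real j * h" using Pj h0 by (intro mult_right_mono) auto
  hence hphi: "h \<le> \<phi>" by (simp add: \<phi>_def)
  have c: "y \<le> 1 - cos \<phi>" using Pj by (simp add: \<phi>_def)
  define \<tau> where "\<tau> = y / (1 - cos \<phi>)"
  have tau: "0 \<le> \<tau>" "\<tau> \<le> 1" "\<tau> * (1 - cos \<phi>) = y" using y c by (auto simp: \<tau>_def)
  have sep: "min y (sqrt y / real D) / 1024 \<le> \<tau> * (sin \<phi> * sin h) / 16"
  proof -
    have "\<phi> / 2 * (h / 2) \<le> sin \<phi> * sin h"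
      using sin_ge_half[of \<phi>] sin_ge_half[of h] h0 hphi phi by (intro mult_mono) auto
    moreover have "y / (\<phi>\<^sup>2 / 2) \<le> \<tau>"
      unfolding \<tau>_def using y c one_minus_cos_le[of \<phi>] by (intro divide_left_mono mult_pos_pos) auto
    ultimately have "y / (\<phi>\<^sup>2 / 2) * (\<phi> / 2 * (h / 2)) \<le> \<tau> * (sin \<phi> * sin h)"
      using y h0 hphi tau(1) by (intro mult_mono[of _ \<tau>]) auto
    moreover have "y / (\<phi>\<^sup>2 / 2) * (\<phi> / 2 * (h / 2)) = y / (2 * real j)"
      using h0 hphi Pj by (simp add: \<phi>_def power2_eq_square field_simps)
    ultimately have 1: "y / (32 * real j) \<le> \<tau> * (sin \<phi> * sin h) / 16" by simp
    show ?thesis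
    proof (cases "j = 32")
      case True
      have "min y (sqrt y / real D) / 1024 \<le> y / 1024" by simp
      thus ?thesis using 1 True by simp
    next
      case False
      moreover from Pj have "32 \<le> j" by simp
      ultimately have j1: "32 \<le> j - 1" by linarith
      have "\<not> ?P (j - 1)" unfolding j_def by (rule not_less_Least) (use Pj in \<open>simp add: j_def[symmetric]\<close>)
      hence "1 - cos (real (j - 1) * h) < y" using j1 by auto
      moreover have "0 \<le> real (j - 1) * h" "real (j - 1) * h \<le> pi"
      proof -
        have "real (j - 1) * h \<le> real j * h" using h0 by (intro mult_right_mono) auto
        thus "real (j - 1) * h \<le> pi" using phi pi_gt_zero unfolding \<phi>_def by linarith
      qed (use h0 in auto)
      ultimately have "(real (j - 1) * h)\<^sup>2 / 8 \<le> y" using one_minus_cos_ge[of "real (j - 1) * h"] by linarith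
      moreover have "(real j / 2 * h)\<^sup>2 \<le> (real (j - 1) * h)\<^sup>2"
        using j1 h0 by (intro power_mono mult_right_mono) (auto simp: of_nat_diff)
      moreover have "3/4 / real D \<le> h" using pi_gt3 D by (simp add: h_def field_simps)
      hence "(real j / 2 * (3/4 / real D))\<^sup>2 \<le> (real j / 2 * h)\<^sup>2"
        by (intro power_mono mult_left_mono) auto
      moreover have "(real j / 2 * (3/4 / real D))\<^sup>2 / 8 = 9/8 * (real j / (8 * real D))\<^sup>2"
        by (simp add: power2_eq_square)
      hence "(real j / (8 * real D))\<^sup>2 \<le> (real j / 2 * (3/4 / real D))\<^sup>2 / 8"
        using zero_le_power2[of "real j / (8 * real D)"] by linarith
      ultimately have "(real j / (8 * real D))\<^sup>2 \<le> y" by linarith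
      hence "real j / (8 * real D) \<le> sqrt y" by (intro real_le_rsqrt)
      hence "sqrt y * (real j / (8 * real D)) \<le> sqrt y * sqrt y" using y by (intro mult_left_mono) auto
      hence a: "sqrt y * (real j / (8 * real D)) / (32 * real j) \<le> y / (32 * real j)"
        using y by (intro divide_right_mono) auto
      have b: "sqrt y * (real j / (8 * real D)) / (32 * real j) = sqrt y / real D / 256"
        using Pj by simp
      have "min y (sqrt y / real D) / 1024 \<le> sqrt y / real D / 256"
      proof -
        have "0 \<le> sqrt y / real D" using y by simp
        moreover have "a / 1024 \<le> b / 256" if "a \<le> b" "0 \<le> b" for a b :: real using that by linarith
        ultimately show ?thesis using min.cobounded2[of y "sqrt y / real D"] by blast
      qed
      also note b[symmetric]
      also note a
      also note 1
      finally show ?thesis .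
    qed
  qed
  from Pj have j32: "32 \<le> j" by simp
  show ?thesis
  proof (rule fejer_priors[OF D j32 j2D tau(1,2)])
    fix \<mu>0 \<mu>1 :: "real pmf"
    assume "finite (set_pmf \<mu>0)" "finite (set_pmf \<mu>1)" "set_pmf \<mu>0 \<subseteq> {0..2}" "set_pmf \<mu>1 \<subseteq> {0..2}"
      "\<And>p. degree p \<le> D \<Longrightarrow> measure_pmf.expectation \<mu>0 (poly p) = measure_pmf.expectation \<mu>1 (poly p)"
      and m: "measure_pmf.expectation \<mu>0 (\<lambda>t. t) \<le> 3 * (\<tau> * (1 - cos (real j * (pi / real (4 * D)))))"
      and s: "measure_pmf.expectation \<mu>0 (\<lambda>t. \<bar>t - \<tau> * (1 - cos (real j * (pi / real (4 * D))))\<bar>) +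
         \<tau> * (sin (real j * (pi / real (4 * D))) * sin (pi / real (4 * D))) / 16
       \<le> measure_pmf.expectation \<mu>1 (\<lambda>t. \<bar>t - \<tau> * (1 - cos (real j * (pi / real (4 * D))))\<bar>)"
    moreover from m have "measure_pmf.expectation \<mu>0 (\<lambda>t. t) \<le> 3 * y"
      by (simp only: h_def[symmetric] \<phi>_def[symmetric] tau(3))
    moreover from s have "measure_pmf.expectation \<mu>0 (\<lambda>t. \<bar>t - y\<bar>) + min y (sqrt y / real D) / 1024
       \<le> measure_pmf.expectation \<mu>1 (\<lambda>t. \<bar>t - y\<bar>)"
      unfolding h_def[symmetric] \<phi>_def[symmetric] tau(3) by (rule order.trans[OF add_left_mono[OF sep]])
    ultimately show ?thesis by (intro that[of \<mu>0 \<mu>1])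
  qed
qed

text \<open>
  With probability \<open>\<eta>\<close> a fair choice between a draw from \<open>\<mu>\<close> and the value \<open>z\<close>, otherwise \<open>0\<close>.
  For suitable \<open>\<eta>\<close> this lowers the mean of the fair choice to any prescribed nonnegative value.
\<close>

definition recentre_pmf :: "real \<Rightarrow> real \<Rightarrow> real pmf \<Rightarrow> real pmf" where
  "recentre_pmf \<eta> z \<mu> = bind_pmf (bernoulli_pmf \<eta>) (\<lambda>b. if b
     then bind_pmf (bernoulli_pmf (1/2)) (\<lambda>b'. if b' then \<mu> else return_pmf z) else return_pmf 0)"

lemma set_recentre_pmf: "set_pmf (recentre_pmf \<eta> z \<mu>) \<subseteq> insert 0 (insert z (set_pmf \<mu>))"
  by (auto simp: recentre_pmf_def split: if_splits)

lemma expectation_recentre_pmf: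
  fixes F :: "real \<Rightarrow> real"
  assumes "finite (set_pmf \<mu>)" "0 \<le> \<eta>" "\<eta> \<le> 1"
  shows "measure_pmf.expectation (recentre_pmf \<eta> z \<mu>) F =
     \<eta> * (measure_pmf.expectation \<mu> F / 2 + F z / 2) + (1 - \<eta>) * F 0"
proof -
  let ?m = "bind_pmf (bernoulli_pmf (1/2)) (\<lambda>b'. if b' then \<mu> else return_pmf z)"
  have fin: "finite (set_pmf ?m)" using assms by (auto split: if_splits)
  have "measure_pmf.expectation ?m F = measure_pmf.expectation \<mu> F / 2 + F z / 2"
    using assms by (subst pmf_expectation_bind[where A = UNIV]) (auto simp: UNIV_bool)
  moreover have "measure_pmf.expectation (recentre_pmf \<eta> z \<mu>) F =
      \<eta> * measure_pmf.expectation ?m F + (1 - \<eta>) * F 0"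
    unfolding recentre_pmf_def using assms fin
    by (subst pmf_expectation_bind[where A = UNIV]) (auto simp: UNIV_bool)
  ultimately show ?thesis by simp
qed

text \<open>
  With the atom at \<open>2 y\<close> the fair choice has mean at least \<open>y\<close>, and mixing with an atom at \<open>0\<close> lowers it
  to \<open>y\<close>. Since the original mean is at most \<open>3 y\<close>, this costs only a constant factor of the
  separation. The exact mean is what makes the random vectors below have expected total mass one.
\<close>

lemma centred_unit_interval_priors:
  fixes D :: nat and y :: real
  assumes D: "16 \<le> D" and y: "0 < y" "y \<le> 1"
  obtains \<mu>0 \<mu>1 :: "real pmf" where
    "finite (set_pmf \<mu>0)" "finite (set_pmf \<mu>1)" "set_pmf \<mu>0 \<subseteq> {0..2}" "set_pmf \<mu>1 \<subseteq> {0..2}"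
    "\<And>p. degree p \<le> D \<Longrightarrow> measure_pmf.expectation \<mu>0 (poly p) = measure_pmf.expectation \<mu>1 (poly p)"
    "measure_pmf.expectation \<mu>0 (\<lambda>t. t) = y"
    "measure_pmf.expectation \<mu>0 (\<lambda>t. \<bar>t - y\<bar>) + min y (sqrt y / real D) / 5120
       \<le> measure_pmf.expectation \<mu>1 (\<lambda>t. \<bar>t - y\<bar>)"
proof -
  from unit_interval_priors[OF D y] obtain \<mu>0 \<mu>1 where
    fin: "finite (set_pmf \<mu>0)" "finite (set_pmf \<mu>1)" and sub: "set_pmf \<mu>0 \<subseteq> {0..2}" "set_pmf \<mu>1 \<subseteq> {0..2}"
    and mom: "\<And>p. degree p \<le> D \<Longrightarrow> measure_pmf.expectation \<mu>0 (poly p) = measure_pmf.expectation \<mu>1 (poly p)"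
    and mean: "measure_pmf.expectation \<mu>0 (\<lambda>t. t) \<le> 3 * y"
    and sep: "measure_pmf.expectation \<mu>0 (\<lambda>t. \<bar>t - y\<bar>) + min y (sqrt y / real D) / 1024
       \<le> measure_pmf.expectation \<mu>1 (\<lambda>t. \<bar>t - y\<bar>)" by blast
  define m where "m = measure_pmf.expectation \<mu>0 (\<lambda>t. t)"
  have m0: "0 \<le> m" unfolding m_def using sub by (intro integral_nonneg_AE) (auto simp: AE_measure_pmf_iff)
  define \<eta> where "\<eta> = 2 * y / (m + 2 * y)"
  have eta: "0 \<le> \<eta>" "\<eta> \<le> 1" "2/5 \<le> \<eta>"
    using m0 y mean by (auto simp: \<eta>_def m_def[symmetric] field_simps)
  note E = expectation_recentre_pmf[OF _ eta(1,2), where z = "2 * y"]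
  let ?f = "\<lambda>t. \<bar>t - y\<bar>"
  have "min y (sqrt y / real D) / 5120 = 2/5 * (min y (sqrt y / real D) / 1024) / 2" by simp
  also have "\<dots> \<le> \<eta> * (measure_pmf.expectation \<mu>1 ?f - measure_pmf.expectation \<mu>0 ?f) / 2"
    using eta sep y by (intro divide_right_mono mult_mono) auto
  finally have s: "min y (sqrt y / real D) / 5120 \<le> \<dots>" .
  show ?thesis
  proof (rule that[of "recentre_pmf \<eta> (2*y) \<mu>0" "recentre_pmf \<eta> (2*y) \<mu>1"])
    show "finite (set_pmf (recentre_pmf \<eta> (2*y) \<mu>0))" "finite (set_pmf (recentre_pmf \<eta> (2*y) \<mu>1))"
      using finite_subset[OF set_recentre_pmf] fin by auto
    show "set_pmf (recentre_pmf \<eta> (2*y) \<mu>0) \<subseteq> {0..2}" "set_pmf (recentre_pmf \<eta> (2*y) \<mu>1) \<subseteq> {0..2}"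
      using y sub by (auto dest!: subsetD[OF set_recentre_pmf])
    show "measure_pmf.expectation (recentre_pmf \<eta> (2*y) \<mu>0) (poly p) =
          measure_pmf.expectation (recentre_pmf \<eta> (2*y) \<mu>1) (poly p)" if "degree p \<le> D" for p
      by (simp only: E[OF fin(1)] E[OF fin(2)] mom[OF that])
    have "measure_pmf.expectation (recentre_pmf \<eta> (2*y) \<mu>0) (\<lambda>t. t) = \<eta> * (m + 2 * y) / 2"
      unfolding E[OF fin(1)] m_def[symmetric] by (simp add: field_simps)
    also have "\<dots> = y" using y m0 by (simp add: \<eta>_def)
    finally show "measure_pmf.expectation (recentre_pmf \<eta> (2*y) \<mu>0) (\<lambda>t. t) = y" .
    show "measure_pmf.expectation (recentre_pmf \<eta> (2*y) \<mu>0) ?f + min y (sqrt y / real D) / 5120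
      \<le> measure_pmf.expectation (recentre_pmf \<eta> (2*y) \<mu>1) ?f"
      unfolding E[OF fin(1)] E[OF fin(2)] using s by (simp add: algebra_simps diff_divide_distrib)
  qed
qed

text \<open>
  For \<open>q \<ge> \<beta>\<close> the law lives on an interval around \<open>q\<close> of half width \<open>sqrt (q \<beta>)\<close>, which for \<open>\<beta>\<close>
  proportional to \<open>D / n\<close> is the range of rates that \<open>poisson_mixtures_close\<close> allows. For smaller \<open>q\<close> that interval would
  reach below zero, and it is replaced by \<open>[0, 2 \<beta>]\<close> with \<open>q\<close> near its left end; polynomials
  resolve finer scales near an end of an interval, and this reproduces the separation
  \<open>sqrt (q \<beta>) / D\<close>.
\<close>

lemma coordinate_priors:
  fixes D :: nat and q \<beta> :: real
  assumes D: "16 \<le> D" and q: "0 \<le> q" and \<beta>: "0 < \<beta>"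
  defines "c \<equiv> max q \<beta>" and "w \<equiv> sqrt (max q \<beta> * \<beta>)"
  obtains \<nu>0 \<nu>1 :: "real pmf" where
    "finite (set_pmf \<nu>0)" "finite (set_pmf \<nu>1)" "set_pmf \<nu>0 \<subseteq> {c - w..c + w}" "set_pmf \<nu>1 \<subseteq> {c - w..c + w}"
    "\<And>p. degree p \<le> D \<Longrightarrow> measure_pmf.expectation \<nu>0 (poly p) = measure_pmf.expectation \<nu>1 (poly p)"
    "measure_pmf.expectation \<nu>0 (\<lambda>t. t) = q"
    "measure_pmf.expectation \<nu>0 (\<lambda>t. \<bar>t - q\<bar>) + min q (sqrt (q * \<beta>) / real D) / 5120
       \<le> measure_pmf.expectation \<nu>1 (\<lambda>t. \<bar>t - q\<bar>)"
proof (cases "q = 0")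
  case True
  thus ?thesis using \<beta> by (intro that[of "return_pmf 0" "return_pmf 0"]) (auto simp: c_def w_def)
next
  case False
  hence q: "0 < q" using q by simp
  define y where "y = min 1 (q / \<beta>)"
  have y: "0 < y" "y \<le> 1" using q \<beta> by (auto simp: y_def)
  from centred_unit_interval_priors[OF D y] obtain \<mu>0 \<mu>1 where
    fin: "finite (set_pmf \<mu>0)" "finite (set_pmf \<mu>1)" and sub: "set_pmf \<mu>0 \<subseteq> {0..2}" "set_pmf \<mu>1 \<subseteq> {0..2}"
    and mom: "\<And>p. degree p \<le> D \<Longrightarrow> measure_pmf.expectation \<mu>0 (poly p) = measure_pmf.expectation \<mu>1 (poly p)"
    and mean: "measure_pmf.expectation \<mu>0 (\<lambda>t. t) = y"
    and sep: "measure_pmf.expectation \<mu>0 (\<lambda>t. \<bar>t - y\<bar>) + min y (sqrt y / real D) / 5120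
       \<le> measure_pmf.expectation \<mu>1 (\<lambda>t. \<bar>t - y\<bar>)" by blast
  have w0: "0 < w" using q \<beta> by (simp add: w_def)
  have qy: "q = c + w * (y - 1)" and gap: "min q (sqrt (q * \<beta>) / real D) \<le> w * min y (sqrt y / real D)"
  proof -
    have "q = c + w * (y - 1) \<and> min q (sqrt (q * \<beta>) / real D) \<le> w * min y (sqrt y / real D)"
    proof (cases "\<beta> \<le> q")
      case True
      hence "y = 1" "c = q" "w = sqrt (q * \<beta>)" using \<beta> by (auto simp: y_def c_def w_def max_def)
      moreover have "min 1 (1 / real D) = 1 / real D" using D by (simp add: min_def)
      ultimately show ?thesis by simp
    next
      case False
      hence "y = q / \<beta>" "c = \<beta>" "w = \<beta>" using \<beta> by (auto simp: y_def c_def w_def max_def)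
      moreover have "\<beta> * sqrt (q / \<beta>) = sqrt (q * \<beta>)"
        using q \<beta> by (simp add: real_sqrt_divide real_sqrt_mult field_simps)
      ultimately show ?thesis using \<beta> by (simp add: min_mult_distrib_left algebra_simps)
    qed
    thus "q = c + w * (y - 1)" "min q (sqrt (q * \<beta>) / real D) \<le> w * min y (sqrt y / real D)" by auto
  qed
  let ?g = "\<lambda>t. c + w * (t - 1)"
  have g: "?g t \<in> {c - w..c + w}" if "t \<in> {0..2}" for t
  proof -
    have "w * (t - 1) \<le> w * 1" "w * (-1) \<le> w * (t - 1)"
      using that w0 by (intro mult_left_mono; simp)+
    thus ?thesis by simp
  qed
  have int: "integrable (measure_pmf \<mu>0) F" for F :: "real \<Rightarrow> real"
    by (rule integrable_measure_pmf_finite[OF fin(1)])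
  have dev: "\<bar>?g t - q\<bar> = w * \<bar>t - y\<bar>" for t
  proof -
    have "?g t - q = w * (t - y)" unfolding qy by (simp add: algebra_simps)
    thus ?thesis using w0 by (simp add: abs_mult)
  qed
  show ?thesis
  proof (rule that[of "map_pmf ?g \<mu>0" "map_pmf ?g \<mu>1"])
    show "set_pmf (map_pmf ?g \<mu>0) \<subseteq> {c - w..c + w}" "set_pmf (map_pmf ?g \<mu>1) \<subseteq> {c - w..c + w}"
      unfolding set_map_pmf using g sub by blast+
    show "measure_pmf.expectation (map_pmf ?g \<mu>0) (poly p) = measure_pmf.expectation (map_pmf ?g \<mu>1) (poly p)"
      if "degree p \<le> D" for p
    proof -
      have "degree (pcompose p [:c - w, w:]) \<le> D" using that w0 by (simp add: degree_pcompose)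
      moreover have "poly p (?g t) = poly (pcompose p [:c - w, w:]) t" for t
        by (simp add: poly_pcompose algebra_simps)
      ultimately show ?thesis unfolding integral_map_pmf using mom by presburger
    qed
    show "measure_pmf.expectation (map_pmf ?g \<mu>0) (\<lambda>t. t) = q"
      using int[of "\<lambda>t. t"] mean qy by (simp add: algebra_simps)
    have "min q (sqrt (q * \<beta>) / real D) / 5120 \<le> w * (min y (sqrt y / real D) / 5120)" using gap by simp
    also have "\<dots> \<le> w * (measure_pmf.expectation \<mu>1 (\<lambda>t. \<bar>t - y\<bar>) - measure_pmf.expectation \<mu>0 (\<lambda>t. \<bar>t - y\<bar>))"
      using sep w0 by (intro mult_left_mono) auto
    finally show "measure_pmf.expectation (map_pmf ?g \<mu>0) (\<lambda>t. \<bar>t - q\<bar>) + min q (sqrt (q * \<beta>) / real D) / 5120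
       \<le> measure_pmf.expectation (map_pmf ?g \<mu>1) (\<lambda>t. \<bar>t - q\<bar>)"
      unfolding integral_map_pmf dev by (simp add: algebra_simps)
  qed (use fin in auto)
qed

section \<open>Expectations of test functions and Poisson moments\<close>

lemma pmf_poisson_law: "0 \<le> r \<Longrightarrow> pmf (poisson_law r) k = r ^ k / fact k * exp (- r)"
  by (auto simp: poisson_law_def indicator_def power_0_left)

lemma integrable_pmf_bounded:
  fixes f :: "'a \<Rightarrow> real"
  assumes "\<And>x. \<bar>f x\<bar> \<le> B"
  shows "integrable (measure_pmf M) f"
  using assms by (intro measure_pmf.integrable_const_bound[where B = B]) auto

lemma expectation_in_unit:
  fixes f :: "'a \<Rightarrow> real"
  assumes "\<And>x. f x \<in> {0..1}"
  shows "measure_pmf.expectation M f \<in> {0..1}"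
proof -
  have "measure_pmf.expectation M f \<le> measure_pmf.expectation M (\<lambda>_. 1)"
    using assms by (intro integral_mono integrable_pmf_bounded[where B = 1]) auto
  thus ?thesis using assms by (auto intro: integral_nonneg)
qed

lemma expectation_bind_unit:
  fixes f :: "'b \<Rightarrow> real"
  assumes "\<And>x. f x \<in> {0..1}"
  shows "measure_pmf.expectation (bind_pmf M N) f = measure_pmf.expectation M (\<lambda>x. measure_pmf.expectation (N x) f)"
proof -
  have i: "ennreal (measure_pmf.expectation K g) = (\<integral>\<^sup>+x. ennreal (g x) \<partial>measure_pmf K)"
    if "\<And>x. g x \<in> {0..1}" for K :: "'c pmf" and g :: "'c \<Rightarrow> real"
    using that by (intro nn_integral_eq_integral[symmetric] integrable_pmf_bounded[where B = 1]) auto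
  have i': "ennreal (measure_pmf.expectation K f) = (\<integral>\<^sup>+x. ennreal (f x) \<partial>measure_pmf K)" for K
    using assms by (intro nn_integral_eq_integral[symmetric] integrable_pmf_bounded[where B = 1]) auto
  have "ennreal (measure_pmf.expectation (bind_pmf M N) f) =
      (\<integral>\<^sup>+x. ennreal (measure_pmf.expectation (N x) f) \<partial>measure_pmf M)"
    unfolding i' by simp
  also have "\<dots> = ennreal (measure_pmf.expectation M (\<lambda>x. measure_pmf.expectation (N x) f))"
    using expectation_in_unit[of f, OF assms]
    by (intro nn_integral_eq_integral integrable_pmf_bounded[where B = 1]) auto
  finally show ?thesis
    using expectation_in_unit[of f, OF assms] expectation_in_unit[of "\<lambda>x. measure_pmf.expectation (N x) f"]
    by (subst (asm) ennreal_inj) auto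
qed

lemma nn_integral_poisson_power:
  assumes "0 < r" "0 \<le> z"
  shows "(\<integral>\<^sup>+ k. ennreal (z ^ k) \<partial>measure_pmf (poisson_pmf r)) = ennreal (exp (r * (z - 1)))"
proof -
  have s: "(\<lambda>k. exp (- r) * ((r * z) ^ k /\<^sub>R fact k)) sums (exp (- r) * exp (r * z))"
    by (intro sums_mult exp_converges)
  have "(\<integral>\<^sup>+ k. ennreal (z ^ k) \<partial>measure_pmf (poisson_pmf r)) =
      (\<Sum>k. ennreal (pmf (poisson_pmf r) k) * ennreal (z ^ k))"
    unfolding nn_integral_measure_pmf by (rule nn_integral_count_space_nat)
  also have "\<dots> = (\<Sum>k. ennreal (exp (- r) * ((r * z) ^ k /\<^sub>R fact k)))"
    using assms by (intro suminf_cong) (simp add: ennreal_mult' power_mult_distrib field_simps flip: ennreal_mult)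
  also have "\<dots> = ennreal (exp (- r) * exp (r * z))"
    using s assms by (intro suminf_ennreal_eq) auto
  also have "exp (- r) * exp (r * z) = exp (r * (z - 1))"
    by (simp add: exp_add[symmetric] algebra_simps)
  finally show ?thesis .
qed

lemma poisson_power:
  assumes "0 < r" "0 \<le> z"
  shows integrable_poisson_power: "integrable (measure_pmf (poisson_pmf r)) (\<lambda>k. z ^ k)"
    and expectation_poisson_power: "measure_pmf.expectation (poisson_pmf r) (\<lambda>k. z ^ k) = exp (r * (z - 1))"
proof -
  show i: "integrable (measure_pmf (poisson_pmf r)) (\<lambda>k. z ^ k)"
    using assms nn_integral_poisson_power[OF assms] by (intro integrableI_nn_integral_finite) auto
  have "ennreal (measure_pmf.expectation (poisson_pmf r) (\<lambda>k. z ^ k)) = ennreal (exp (r * (z - 1)))"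
    using nn_integral_poisson_power[OF assms] nn_integral_eq_integral[OF i] assms by simp
  thus "measure_pmf.expectation (poisson_pmf r) (\<lambda>k. z ^ k) = exp (r * (z - 1))"
    by (subst (asm) ennreal_inj) (use assms in \<open>auto intro: integral_nonneg\<close>)
qed

text \<open>
  Exponential Markov bound with base \<open>1/2\<close>; \<open>poisson_upper_tail\<close> uses base \<open>2\<close>.
\<close>

lemma poisson_lower_tail:
  assumes "4 * real n \<le> r" "0 < n"
  shows "measure_pmf.prob (poisson_pmf r) {k. k < 2 * n} \<le> exp (- real n / 2)"
proof -
  have r: "r > 0" using assms by simp
  have "measure_pmf.prob (poisson_pmf r) {k. k < 2 * n} = measure_pmf.expectation (poisson_pmf r) (indicator {k. k < 2 * n})"
    by simp
  also have "\<dots> \<le> measure_pmf.expectation (poisson_pmf r) (\<lambda>k. 4 ^ n * (1/2) ^ k)"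
  proof (intro integral_mono integrable_mult_right integrable_poisson_power r)
    fix k
    show "indicator {k. k < 2 * n} k \<le> (4 ^ n * (1/2) ^ k :: real)"
    proof (cases "k < 2 * n")
      case True
      have "(2::real) ^ k \<le> 2 ^ (2 * n)" using True by (intro power_increasing) auto
      also have "\<dots> = 4 ^ n" by (simp add: power_mult)
      finally show ?thesis using True by (simp add: power_one_over field_simps)
    qed simp
  qed (auto intro: measure_pmf.integrable_const_bound[where B = 1])
  also have "\<dots> = 4 ^ n * exp (r * (1/2 - 1))"
    using expectation_poisson_power[OF r, of "1/2"] by simp
  also have "\<dots> \<le> exp (real n * (3/2)) * exp (- 2 * real n)"
  proof (intro mult_mono)
    have "(4::real) \<le> exp (3/2)"
    proof -
      have "(2::real) \<le> exp (3/4)"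
        using exp_lower_Taylor_quadratic[of "3/4::real"] by (simp add: power2_eq_square)
      hence "(2::real)\<^sup>2 \<le> (exp (3/4))\<^sup>2" by (intro power_mono) auto
      thus ?thesis by (simp add: exp_double[symmetric])
    qed
    hence "4 ^ n \<le> exp (3/2 :: real) ^ n" by (intro power_mono) auto
    thus "4 ^ n \<le> exp (real n * (3/2) :: real)" by (simp add: exp_of_nat_mult[symmetric])
  qed (use assms in auto)
  also have "\<dots> = exp (- real n / 2)" by (simp add: exp_add[symmetric])
  finally show ?thesis .
qed

lemma poisson_upper_tail:
  assumes "0 < n"
  shows "1/4 \<le> measure_pmf.prob (poisson_pmf (real n)) {k. k \<le> 2 * n}"
proof -
  have "measure_pmf.prob (poisson_pmf (real n)) (- {k. k \<le> 2 * n}) =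
      measure_pmf.expectation (poisson_pmf (real n)) (indicator (- {k. k \<le> 2 * n}))" by simp
  also have "\<dots> \<le> measure_pmf.expectation (poisson_pmf (real n)) (\<lambda>k. (1/4) ^ n * 2 ^ k)"
  proof (intro integral_mono integrable_mult_right integrable_poisson_power)
    fix k
    show "indicator (- {k. k \<le> 2 * n}) k \<le> ((1/4) ^ n * 2 ^ k :: real)"
    proof (cases "k \<le> 2 * n")
      case False
      have "(4::real) ^ n = 2 ^ (2 * n)" by (simp add: power_mult)
      also have "\<dots> \<le> 2 ^ k" using False by (intro power_increasing) auto
      finally show ?thesis using False by (simp add: power_one_over field_simps)
    qed simp
  qed (use assms in \<open>auto intro: measure_pmf.integrable_const_bound[where B = 1]\<close>)
  also have "\<dots> = (exp 1 / 4) ^ n"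
    using expectation_poisson_power[of "real n" 2] assms
    by (simp add: power_divide exp_of_nat_mult[symmetric])
  also have "\<dots> \<le> (3/4) ^ 1"
    using exp_le assms by (intro order.trans[OF power_mono[of _ "3/4"] power_decreasing]) auto
  finally show ?thesis
    using measure_pmf.prob_compl[of "{k. k \<le> 2 * n}" "poisson_pmf (real n)"] by (simp add: Compl_eq_Diff_UNIV)
qed

section \<open>Poisson mixtures with matching moments\<close>

lemma expectation_change_of_pmf:
  fixes f r :: "'a \<Rightarrow> real"
  assumes "\<And>x. pmf M' x = pmf M x * r x"
  shows "measure_pmf.expectation M' f = measure_pmf.expectation M (\<lambda>x. f x * r x)"
proof -
  have E: "measure_pmf.expectation K g = (\<integral>x. pmf K x * g x \<partial>count_space UNIV)" for K and g :: "'a \<Rightarrow> real"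
    unfolding measure_pmf_eq_density by (subst integral_density) auto
  show ?thesis unfolding E assms by (simp add: mult_ac)
qed

lemma expectation_finite_pmf:
  fixes f :: "'a \<Rightarrow> real"
  assumes "finite A" "set_pmf M \<subseteq> A"
  shows "measure_pmf.expectation M f = (\<Sum>x\<in>A. pmf M x * f x)"
  using assms by (subst integral_measure_pmf[of A]) auto

lemma sum_pmf_eq_1:
  assumes "finite A" "set_pmf M \<subseteq> A"
  shows "(\<Sum>x\<in>A. pmf M x) = 1"
  using expectation_finite_pmf[OF assms, of "\<lambda>_. 1"] by simp

lemma abs_expectation_le_sqrt:
  fixes f :: "'a \<Rightarrow> real"
  assumes "integrable (measure_pmf M) f" "integrable (measure_pmf M) (\<lambda>x. (f x)\<^sup>2)"
  shows "\<bar>measure_pmf.expectation M f\<bar> \<le> sqrt (measure_pmf.expectation M (\<lambda>x. (f x)\<^sup>2))"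
proof -
  have "0 \<le> measure_pmf.variance M f" by simp
  hence "(measure_pmf.expectation M f)\<^sup>2 \<le> measure_pmf.expectation M (\<lambda>x. (f x)\<^sup>2)"
    using measure_pmf.variance_eq[OF assms] by simp
  thus ?thesis by (metis real_sqrt_abs real_sqrt_le_iff)
qed

text \<open>
  The kernel \<open>exp (\<theta> a a')\<close> is the generating function of products of moments. In its power series only
  the squares of the moment differences of order above \<open>D\<close> remain, and these are bounded by the
  width of the support.
\<close>

lemma poisson_kernel_sum_le:
  fixes \<nu>0 \<nu>1 :: "real pmf" and c w \<theta> :: real and D :: nat
  assumes c: "0 < c" and w: "0 \<le> w" and \<theta>: "0 \<le> \<theta>"
    and A: "finite A" "set_pmf \<nu>0 \<subseteq> A" "set_pmf \<nu>1 \<subseteq> A" "A \<subseteq> {c - w..c + w}"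
    and moments: "\<And>p. degree p \<le> D \<Longrightarrow> measure_pmf.expectation \<nu>0 (poly p) = measure_pmf.expectation \<nu>1 (poly p)"
  defines "\<nu> \<equiv> \<lambda>p. pmf \<nu>1 p - pmf \<nu>0 p"
  shows "(\<Sum>p\<in>A. \<Sum>p'\<in>A. \<nu> p * \<nu> p' * exp (\<theta> * (p / c - 1) * (p' / c - 1)))
           \<le> 4 / 8 ^ D * exp (8 * (\<theta> * (w / c)\<^sup>2))"
proof -
  define S where "S = (\<lambda>m. \<Sum>p\<in>A. \<nu> p * (p / c - 1) ^ m)"
  define B where "B = \<theta> * (w / c)\<^sup>2"
  have B0: "0 \<le> B" using \<theta> by (simp add: B_def)
  have "(\<lambda>m. \<Sum>p\<in>A. \<Sum>p'\<in>A. \<nu> p * \<nu> p' * ((\<theta> * (p / c - 1) * (p' / c - 1)) ^ m /\<^sub>R fact m)) sums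
        (\<Sum>p\<in>A. \<Sum>p'\<in>A. \<nu> p * \<nu> p' * exp (\<theta> * (p / c - 1) * (p' / c - 1)))"
    by (intro sums_sum sums_mult exp_converges)
  moreover have "(\<Sum>p\<in>A. \<Sum>p'\<in>A. \<nu> p * \<nu> p' * ((\<theta> * (p / c - 1) * (p' / c - 1)) ^ m /\<^sub>R fact m))
      = \<theta> ^ m / fact m * (S m)\<^sup>2" for m
  proof -
    define a where "a = (\<lambda>p. p / c - 1)"
    have "\<theta> ^ m / fact m * (S m)\<^sup>2
        = \<theta> ^ m / fact m * (\<Sum>p\<in>A. \<Sum>p'\<in>A. (\<nu> p * a p ^ m) * (\<nu> p' * a p' ^ m))"
      unfolding S_def power2_eq_square sum_product a_def ..
    also have "\<dots> = (\<Sum>p\<in>A. \<Sum>p'\<in>A. \<nu> p * \<nu> p' * ((\<theta> * a p * a p') ^ m /\<^sub>R fact m))"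
      unfolding sum_distrib_left by (intro sum.cong refl) (simp add: power_mult_distrib field_simps)
    finally show ?thesis unfolding a_def ..
  qed
  ultimately have s1: "(\<lambda>m. \<theta> ^ m / fact m * (S m)\<^sup>2) sums
        (\<Sum>p\<in>A. \<Sum>p'\<in>A. \<nu> p * \<nu> p' * exp (\<theta> * (p / c - 1) * (p' / c - 1)))" by simp
  have s2: "(\<lambda>m. 4 / 8 ^ D * ((8 * B) ^ m /\<^sub>R fact m)) sums (4 / 8 ^ D * exp (8 * B))"
    by (intro sums_mult exp_converges)
  have "\<theta> ^ m / fact m * (S m)\<^sup>2 \<le> 4 / 8 ^ D * ((8 * B) ^ m /\<^sub>R fact m)" for m
  proof (cases "m \<le> D")
    case True
    let ?p = "[:- 1, 1 / c:] ^ m"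
    have "degree ?p \<le> D" using degree_power_le[of "[:- 1, 1 / c:]" m] True c by simp
    from moments[OF this] have "S m = 0"
      unfolding S_def \<nu>_def
      by (simp add: expectation_finite_pmf[OF A(1) A(2)] expectation_finite_pmf[OF A(1) A(3)]
            left_diff_distrib sum_subtractf poly_power)
    thus ?thesis using B0 by simp
  next
    case False
    have "\<bar>S m\<bar> \<le> (\<Sum>p\<in>A. \<bar>\<nu> p * (p / c - 1) ^ m\<bar>)" unfolding S_def by (rule sum_abs)
    also have "\<dots> \<le> (\<Sum>p\<in>A. (pmf \<nu>1 p + pmf \<nu>0 p) * (w / c) ^ m)"
    proof (rule sum_mono)
      fix p assume "p \<in> A"
      hence "\<bar>p - c\<bar> \<le> w" using A(4) by (force simp: abs_le_iff)
      moreover have "p / c - 1 = (p - c) / c" using c by (simp add: diff_divide_distrib)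
      ultimately have "\<bar>p / c - 1\<bar> \<le> w / c" using c by (simp add: abs_divide divide_right_mono)
      hence "\<bar>p / c - 1\<bar> ^ m \<le> (w / c) ^ m" by (intro power_mono) auto
      moreover have "\<bar>\<nu> p\<bar> \<le> pmf \<nu>1 p + pmf \<nu>0 p"
        using pmf_nonneg[of \<nu>1 p] pmf_nonneg[of \<nu>0 p] unfolding \<nu>_def by linarith
      ultimately show "\<bar>\<nu> p * (p / c - 1) ^ m\<bar> \<le> (pmf \<nu>1 p + pmf \<nu>0 p) * (w / c) ^ m"
        unfolding abs_mult power_abs by (intro mult_mono) auto
    qed
    also have "\<dots> = 2 * (w / c) ^ m"
      by (simp add: sum_distrib_right[symmetric] sum.distrib sum_pmf_eq_1[OF A(1,2)] sum_pmf_eq_1[OF A(1,3)])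
    finally have "(S m)\<^sup>2 \<le> (2 * (w / c) ^ m)\<^sup>2" by (rule power2_le_iff_abs_le[THEN iffD2, rotated]) (use w c in simp)
    hence "\<theta> ^ m / fact m * (S m)\<^sup>2 \<le> \<theta> ^ m / fact m * (2 * (w / c) ^ m)\<^sup>2"
      using \<theta> by (intro mult_left_mono) auto
    also have "\<dots> = 4 * (B ^ m / fact m)"
      by (simp add: B_def power_mult_distrib power_mult[symmetric] mult.commute field_simps)
    \<comment> \<open>inserting \<open>8 ^ (m - D) \<ge> 1\<close> turns the tail of the series into a full exponential series\<close>
    also have "\<dots> \<le> 4 * (B ^ m / fact m) * (8 ^ m / 8 ^ D)"
    proof -
      have "(8::real) ^ D \<le> 8 ^ m" using False by (intro power_increasing) auto
      hence "1 \<le> (8 ^ m / 8 ^ D :: real)" by simp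
      moreover have "0 \<le> 4 * (B ^ m / fact m)" using B0 by simp
      ultimately show ?thesis by (metis mult.right_neutral mult_left_mono)
    qed
    also have "\<dots> = 4 / 8 ^ D * ((8 * B) ^ m /\<^sub>R fact m)"
      by (simp add: power_mult_distrib field_simps)
    finally show ?thesis .
  qed
  thus ?thesis using sums_le[OF _ s1 s2] unfolding B_def by blast
qed

text \<open>
  A chi-square bound relative to the Poisson law at the centre \<open>c\<close> of the interval. The density of the law
  with rate \<open>N p\<close> relative to that law is an exponential in the count, so the second moment of the
  difference of the two mixtures is a double sum of \<open>exp (\<theta> a a')\<close> with \<open>a = p / c - 1\<close>.
\<close>

lemma poisson_mixtures_close:
  fixes \<nu>0 \<nu>1 :: "real pmf" and N c w :: real and D :: nat and \<phi> :: "nat \<Rightarrow> real"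
  assumes N: "0 < N" and c: "0 < c" and w: "0 \<le> w" "w \<le> c" "N * w\<^sup>2 \<le> c * (real D / 16)"
    and fin: "finite (set_pmf \<nu>0)" "finite (set_pmf \<nu>1)"
    and sub: "set_pmf \<nu>0 \<subseteq> {c - w..c + w}" "set_pmf \<nu>1 \<subseteq> {c - w..c + w}"
    and moments: "\<And>p. degree p \<le> D \<Longrightarrow> measure_pmf.expectation \<nu>0 (poly p) = measure_pmf.expectation \<nu>1 (poly p)"
    and \<phi>: "\<And>k. \<phi> k \<in> {0..1}"
  shows "measure_pmf.expectation (bind_pmf \<nu>1 (\<lambda>p. poisson_law (N * p))) \<phi>
       - measure_pmf.expectation (bind_pmf \<nu>0 (\<lambda>p. poisson_law (N * p))) \<phi> \<le> 2 * exp (- real D / 2)"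
proof -
  define A where "A = set_pmf \<nu>0 \<union> set_pmf \<nu>1"
  have A: "finite A" "set_pmf \<nu>0 \<subseteq> A" "set_pmf \<nu>1 \<subseteq> A" "A \<subseteq> {c - w..c + w}"
    using fin sub by (auto simp: A_def)
  define \<theta> where "\<theta> = N * c"
  have \<theta>: "\<theta> > 0" using N c by (simp add: \<theta>_def)
  define \<nu> where "\<nu> = (\<lambda>p. pmf \<nu>1 p - pmf \<nu>0 p)"
  define r where "r = (\<lambda>p (k::nat). exp (\<theta> - N * p) * (p / c) ^ k)"
  let ?M = "measure_pmf (poisson_pmf \<theta>)"
  have p0: "0 \<le> p" if "p \<in> A" for p using that A w by force
  have intr: "integrable ?M (r p)" if "p \<in> A" for p
    unfolding r_def using p0[OF that] c \<theta> by (intro integrable_mult_right integrable_poisson_power) auto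
  have rr: "r p k * r p' k = exp (2 * \<theta> - N * p - N * p') * (p * p' / c\<^sup>2) ^ k" for p p' k
    by (simp add: r_def exp_add[symmetric] exp_diff power2_eq_square power_mult_distrib power_divide field_simps)
  have intrr: "integrable ?M (\<lambda>k. r p k * r p' k)" if "p \<in> A" "p' \<in> A" for p p'
    unfolding rr using p0 that c \<theta> by (intro integrable_mult_right integrable_poisson_power) auto
  have Err: "measure_pmf.expectation (poisson_pmf \<theta>) (\<lambda>k. r p k * r p' k) = exp (\<theta> * (p / c - 1) * (p' / c - 1))"
    if "p \<in> A" "p' \<in> A" for p p'
  proof -
    have "measure_pmf.expectation (poisson_pmf \<theta>) (\<lambda>k. r p k * r p' k) =
        exp (2 * \<theta> - N * p - N * p') * exp (\<theta> * (p * p' / c\<^sup>2 - 1))"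
      unfolding rr using p0 that c \<theta> by (subst integral_mult_right_zero, subst expectation_poisson_power) auto
    also have "\<dots> = exp (\<theta> * (p / c - 1) * (p' / c - 1))"
      unfolding exp_add[symmetric] using c
      by (intro arg_cong[where f = exp]) (simp add: \<theta>_def power2_eq_square field_simps)
    finally show ?thesis .
  qed
  \<comment> \<open>the density of the difference of the mixtures relative to the Poisson law at the centre\<close>
  define R where "R = (\<lambda>k. \<Sum>p\<in>A. \<nu> p * r p k)"
  have intR: "integrable ?M R" unfolding R_def using intr by (intro Bochner_Integration.integrable_sum) auto
  have R2: "(R k)\<^sup>2 = (\<Sum>p\<in>A. \<Sum>p'\<in>A. \<nu> p * \<nu> p' * (r p k * r p' k))" for k
    unfolding R_def power2_eq_square sum_product by (intro sum.cong refl) (simp add: mult_ac)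
  have intR2: "integrable ?M (\<lambda>k. (R k)\<^sup>2)"
    unfolding R2 using intrr by (intro Bochner_Integration.integrable_sum integrable_mult_right) auto
  have "measure_pmf.expectation (poisson_pmf \<theta>) (\<lambda>k. (R k)\<^sup>2)
      = (\<Sum>p\<in>A. \<Sum>p'\<in>A. \<nu> p * \<nu> p' * exp (\<theta> * (p / c - 1) * (p' / c - 1)))"
    unfolding R2 using intrr by (simp add: Bochner_Integration.integral_sum Err)
  also have "\<dots> \<le> 4 / 8 ^ D * exp (8 * (\<theta> * (w / c)\<^sup>2))"
    unfolding \<nu>_def by (rule poisson_kernel_sum_le[OF c w(1) _ A moments]) (use \<theta> in auto)
  also have "\<dots> \<le> 4 * exp (- 2 * real D) * exp (real D / 2)"
  proof (intro mult_mono)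
    have "exp 1 * exp 1 \<le> (2.8::real) * 2.8" using e_less_272 by (intro mult_mono) auto
    hence "exp 2 \<le> (8::real)" by (simp add: exp_add[symmetric])
    hence "exp 2 ^ D \<le> (8::real) ^ D" by (intro power_mono) auto
    hence "4 / 8 ^ D \<le> 4 / (exp 2 ^ D :: real)" by (intro divide_left_mono) auto
    thus "4 / 8 ^ D \<le> 4 * exp (- 2 * real D)"
      by (simp add: exp_of_nat_mult[symmetric] exp_minus field_simps)
    have "\<theta> * (w / c)\<^sup>2 = N * w\<^sup>2 / c" using c by (simp add: \<theta>_def power2_eq_square)
    also have "\<dots> \<le> real D / 16" using w(3) c by (simp add: divide_le_eq mult.commute)
    finally show "exp (8 * (\<theta> * (w / c)\<^sup>2)) \<le> exp (real D / 2)" by simp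
  qed auto
  also have "\<dots> = (2 * exp (- (3/4) * real D))\<^sup>2"
    by (simp add: power_mult_distrib exp_double[symmetric] exp_add[symmetric])
  finally have "sqrt (measure_pmf.expectation (poisson_pmf \<theta>) (\<lambda>k. (R k)\<^sup>2)) \<le> 2 * exp (- (3/4) * real D)"
    by (intro real_le_lsqrt) auto
  also have "\<dots> \<le> 2 * exp (- real D / 2)" by simp
  finally have chi: "sqrt (measure_pmf.expectation (poisson_pmf \<theta>) (\<lambda>k. (R k)\<^sup>2)) \<le> 2 * exp (- real D / 2)" .

  have mix: "measure_pmf.expectation (bind_pmf \<nu>' (\<lambda>p. poisson_law (N * p))) \<phi>
      = (\<Sum>p\<in>A. pmf \<nu>' p * measure_pmf.expectation (poisson_pmf \<theta>) (\<lambda>k. \<phi> k * r p k))"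
    if "set_pmf \<nu>' \<subseteq> A" for \<nu>'
  proof -
    have "measure_pmf.expectation (poisson_law (N * p)) \<phi> = measure_pmf.expectation (poisson_pmf \<theta>) (\<lambda>k. \<phi> k * r p k)"
      if "p \<in> A" for p
    proof (rule expectation_change_of_pmf)
      fix k
      show "pmf (poisson_law (N * p)) k = pmf (poisson_pmf \<theta>) k * r p k"
        using p0[OF that] N c \<theta>
        by (subst pmf_poisson_law) (auto simp: r_def \<theta>_def power_mult_distrib power_divide exp_diff exp_minus field_simps)
    qed
    thus ?thesis using expectation_finite_pmf[OF A(1) that] \<phi> by (simp add: expectation_bind_unit)
  qed
  have int\<phi>: "integrable ?M (\<lambda>k. \<phi> k * r p k)" if "p \<in> A" for p
    by (rule Bochner_Integration.integrable_bound[OF intr[OF that]])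
       (use \<phi> in \<open>auto simp: abs_mult intro!: mult_left_le_one_le\<close>)
  have "measure_pmf.expectation (bind_pmf \<nu>1 (\<lambda>p. poisson_law (N * p))) \<phi>
       - measure_pmf.expectation (bind_pmf \<nu>0 (\<lambda>p. poisson_law (N * p))) \<phi>
      = (\<Sum>p\<in>A. \<nu> p * measure_pmf.expectation (poisson_pmf \<theta>) (\<lambda>k. \<phi> k * r p k))"
    unfolding mix[OF A(2)] mix[OF A(3)] by (simp add: \<nu>_def left_diff_distrib sum_subtractf)
  also have "\<dots> = measure_pmf.expectation (poisson_pmf \<theta>) (\<lambda>k. \<Sum>p\<in>A. \<nu> p * (\<phi> k * r p k))"
    using int\<phi> by (simp add: Bochner_Integration.integral_sum)
  also have "\<dots> = measure_pmf.expectation (poisson_pmf \<theta>) (\<lambda>k. \<phi> k * R k)"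
    by (simp add: R_def sum_distrib_left mult_ac)
  also have "\<dots> \<le> measure_pmf.expectation (poisson_pmf \<theta>) (\<lambda>k. \<bar>R k\<bar>)"
  proof (intro integral_mono)
    show "integrable ?M (\<lambda>k. \<phi> k * R k)"
      by (rule Bochner_Integration.integrable_bound[OF intR])
         (use \<phi> in \<open>auto simp: abs_mult intro!: mult_left_le_one_le\<close>)
    show "\<phi> k * R k \<le> \<bar>R k\<bar>" for k
    proof -
      have "\<phi> k * R k \<le> \<phi> k * \<bar>R k\<bar>" using \<phi>[of k] by (intro mult_left_mono) auto
      also have "\<dots> \<le> \<bar>R k\<bar>" using \<phi>[of k] by (intro mult_left_le_one_le) auto
      finally show ?thesis .
    qed
  qed (use intR in auto)
  also have "\<dots> \<le> sqrt (measure_pmf.expectation (poisson_pmf \<theta>) (\<lambda>k. (R k)\<^sup>2))"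
    using abs_expectation_le_sqrt[of "poisson_pmf \<theta>" "\<lambda>k. \<bar>R k\<bar>"] intR intR2 by simp
  also note chi
  finally show ?thesis .
qed

section \<open>Product laws\<close>

text \<open>
  Total variation distances of the factors add up, phrased through test functions; one coordinate is
  exchanged at a time.
\<close>

lemma Pi_pmf_test_difference_le:
  fixes \<phi> :: "('a \<Rightarrow> 'b) \<Rightarrow> real"
  assumes "finite A"
    and "\<And>i \<psi>. i \<in> A \<Longrightarrow> (\<And>x. \<psi> x \<in> {0..1}) \<Longrightarrow>
           measure_pmf.expectation (p i) \<psi> - measure_pmf.expectation (q i) \<psi> \<le> (t i :: real)"
    and "\<And>x. \<phi> x \<in> {0..1}"
  shows "measure_pmf.expectation (Pi_pmf A d p) \<phi> - measure_pmf.expectation (Pi_pmf A d q) \<phi> \<le> (\<Sum>i\<in>A. t i)"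
  using assms
proof (induction A arbitrary: \<phi> rule: finite_induct)
  case empty
  then show ?case by simp
next
  case (insert x A)
  define U where "U = (\<lambda>r y. measure_pmf.expectation (Pi_pmf A d r) (\<lambda>f. \<phi> (f(x := y))))"
  have U: "U r y \<in> {0..1}" for r y
    unfolding U_def by (rule expectation_in_unit) (use insert.prems in blast)
  have E: "measure_pmf.expectation (Pi_pmf (insert x A) d r) \<phi> = measure_pmf.expectation (r x) (U r)" for r
    unfolding Pi_pmf_insert'[OF insert.hyps(1,2)] using insert.prems(2)
    by (simp add: expectation_bind_unit U_def)
  have int: "integrable (measure_pmf M) (U r)" for M r
    by (rule integrable_pmf_bounded[where B = 1]) (use U in auto)
  have "U p y \<le> U q y + (\<Sum>i\<in>A. t i)" for y
    using insert.IH[of "\<lambda>f. \<phi> (f(x := y))"] insert.prems unfolding U_def by fastforce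
  hence "measure_pmf.expectation (p x) (U p) \<le> measure_pmf.expectation (p x) (\<lambda>y. U q y + (\<Sum>i\<in>A. t i))"
    by (intro integral_mono int Bochner_Integration.integrable_add) auto
  also have "\<dots> = measure_pmf.expectation (p x) (U q) + (\<Sum>i\<in>A. t i)"
    using int by simp
  also have "measure_pmf.expectation (p x) (U q) \<le> measure_pmf.expectation (q x) (U q) + t x"
    using insert.prems(1)[of x "U q"] U by force
  finally show ?case unfolding E using insert.hyps by simp
qed

lemma expectation_bind_finite:
  fixes f :: "'b \<Rightarrow> real"
  assumes "finite (set_pmf M)" "\<And>x. x \<in> set_pmf M \<Longrightarrow> finite (set_pmf (N x))"
  shows "measure_pmf.expectation (bind_pmf M N) f = measure_pmf.expectation M (\<lambda>x. measure_pmf.expectation (N x) f)"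
  using assms by (simp add: pmf_expectation_bind[OF assms(1)] expectation_finite_pmf[OF assms(1)])

lemma finite_set_Pi_pmf:
  assumes "finite A" "\<And>i. i \<in> A \<Longrightarrow> finite (set_pmf (\<mu> i))"
  shows "finite (set_pmf (Pi_pmf A d \<mu>))"
  unfolding set_Pi_pmf[OF assms(1)] using assms by (intro finite_PiE_dflt) auto

lemma Pi_pmf_sum_second_moment:
  fixes f :: "'a \<Rightarrow> 'b \<Rightarrow> real"
  assumes "finite A" "\<And>i. i \<in> A \<Longrightarrow> finite (set_pmf (\<mu> i))"
    "\<And>i. i \<in> A \<Longrightarrow> measure_pmf.expectation (\<mu> i) (f i) = 0"
  shows "measure_pmf.expectation (Pi_pmf A d \<mu>) (\<lambda>x. (\<Sum>i\<in>A. f i (x i))\<^sup>2)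
       = (\<Sum>i\<in>A. measure_pmf.expectation (\<mu> i) (\<lambda>x. (f i x)\<^sup>2))"
  using assms
proof (induction A rule: finite_induct)
  case empty
  then show ?case by simp
next
  case (insert a A)
  let ?P = "Pi_pmf A d \<mu>"
  have fP: "finite (set_pmf ?P)" using insert.prems insert.hyps by (intro finite_set_Pi_pmf) auto
  have fa: "finite (set_pmf (\<mu> a))" using insert.prems by auto
  have i: "integrable (measure_pmf ?P) g" "integrable (measure_pmf (\<mu> a)) g'" for g :: "_ \<Rightarrow> real" and g' :: "_ \<Rightarrow> real"
    using fP fa by (auto intro: integrable_measure_pmf_finite)
  let ?s = "\<lambda>x. \<Sum>i\<in>A. f i (x i)"
  have s: "(\<Sum>i\<in>insert a A. f i ((x(a := y)) i)) = f a y + ?s x" for x y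
    using insert.hyps by (auto intro!: sum.cong)
  have "measure_pmf.expectation (Pi_pmf (insert a A) d \<mu>) (\<lambda>x. (\<Sum>i\<in>insert a A. f i (x i))\<^sup>2)
      = measure_pmf.expectation (\<mu> a) (\<lambda>y. measure_pmf.expectation ?P (\<lambda>x. (f a y + ?s x)\<^sup>2))"
    unfolding Pi_pmf_insert'[OF insert.hyps(1,2)] using fP fa
    by (simp add: expectation_bind_finite s del: fun_upd_apply)
  also have "\<dots> = measure_pmf.expectation (\<mu> a) (\<lambda>y. (f a y)\<^sup>2 + 2 * f a y * measure_pmf.expectation ?P ?s
       + measure_pmf.expectation ?P (\<lambda>x. (?s x)\<^sup>2))"
    using i by (simp add: power2_sum)
  also have "\<dots> = measure_pmf.expectation (\<mu> a) (\<lambda>y. (f a y)\<^sup>2) + measure_pmf.expectation ?P (\<lambda>x. (?s x)\<^sup>2)"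
    using i insert.prems(2)[of a] by simp
  finally show ?case using insert by simp
qed

lemma prob_abs_ge_le_second_moment:
  fixes f :: "'a \<Rightarrow> real"
  assumes "finite (set_pmf M)" "0 < e"
  shows "measure_pmf.prob M {x. e \<le> \<bar>f x\<bar>} \<le> measure_pmf.expectation M (\<lambda>x. (f x)\<^sup>2) / e\<^sup>2"
proof -
  have "measure_pmf.prob M {x. e \<le> \<bar>f x\<bar>} = measure_pmf.expectation M (indicator {x. e \<le> \<bar>f x\<bar>})" by simp
  also have "\<dots> \<le> measure_pmf.expectation M (\<lambda>x. (f x)\<^sup>2 / e\<^sup>2)"
  proof (intro integral_mono integrable_measure_pmf_finite assms)
    fix x
    show "indicator {x. e \<le> \<bar>f x\<bar>} x \<le> (f x)\<^sup>2 / e\<^sup>2"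
    proof (cases "e \<le> \<bar>f x\<bar>")
      case True
      hence "e\<^sup>2 \<le> (f x)\<^sup>2" using assms(2) by (simp add: abs_le_square_iff[symmetric])
      thus ?thesis using True assms(2) by simp
    qed simp
  qed
  finally show ?thesis by simp
qed

section \<open>Multinomial laws and thinning\<close>

definition count_vectors :: "'a set \<Rightarrow> nat \<Rightarrow> ('a \<Rightarrow> nat) set" where
  "count_vectors A k = {x. (\<forall>i. i \<notin> A \<longrightarrow> x i = 0) \<and> (\<Sum>i\<in>A. x i) = k}"

text \<open>
  Probability of the counts \<open>x\<close> in a sample of size \<open>k\<close>, provided they sum to \<open>k\<close>.
\<close>

definition multinomial_prob :: "'a set \<Rightarrow> ('a \<Rightarrow> real) \<Rightarrow> nat \<Rightarrow> ('a \<Rightarrow> nat) \<Rightarrow> real" where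
  "multinomial_prob A P k x = fact k * (\<Prod>i\<in>A. P i ^ x i / fact (x i))"

text \<open>
  Average of \<open>g\<close> over the counts that remain when one uniformly chosen observation is discarded.
\<close>

definition thin :: "'a set \<Rightarrow> (('a \<Rightarrow> nat) \<Rightarrow> real) \<Rightarrow> ('a \<Rightarrow> nat) \<Rightarrow> real" where
  "thin A g x = (\<Sum>i\<in>A. real (x i) / real (\<Sum>i\<in>A. x i) * g (x(i := x i - 1)))"

lemma finite_count_vectors:
  assumes "finite A"
  shows "finite (count_vectors A k)"
proof (rule finite_subset)
  show "count_vectors A k \<subseteq> PiE_dflt A 0 (\<lambda>_. {..k})"
    using assms by (auto simp: count_vectors_def PiE_dflt_def intro: member_le_sum)
  show "finite (PiE_dflt A 0 (\<lambda>_. {..k}))" using assms by (intro finite_PiE_dflt) auto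
qed

lemma multinomial_prob_Suc:
  assumes "finite A" "i \<in> A"
  shows "multinomial_prob A P (Suc k) (y(i := Suc (y i))) * (real (Suc (y i)) / real (Suc k)) = P i * multinomial_prob A P k y"
proof -
  have "(\<Prod>j\<in>A - {i}. P j ^ (y(i := Suc (y i))) j / fact ((y(i := Suc (y i))) j)) = (\<Prod>j\<in>A - {i}. P j ^ y j / fact (y j))"
    by (intro prod.cong) auto
  thus ?thesis
    unfolding multinomial_prob_def by (simp add: prod.remove[OF assms] field_simps del: of_nat_Suc)
qed

text \<open>
  Discarding a random observation from a sample of size \<open>k + 1\<close> leaves a sample of size \<open>k\<close>, for every
  cell distribution \<open>P\<close>. The sum is rearranged by the cell of the discarded observation.
\<close>

lemma sum_multinomial_prob_thin:
  assumes A: "finite A" and P: "(\<Sum>i\<in>A. P i) = 1"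
  shows "(\<Sum>x\<in>count_vectors A (Suc k). multinomial_prob A P (Suc k) x * thin A g x)
       = (\<Sum>y\<in>count_vectors A k. multinomial_prob A P k y * g y)"
proof -
  let ?C = "count_vectors A (Suc k)"
  let ?F = "\<lambda>i x. multinomial_prob A P (Suc k) x * (real (x i) / real (Suc k) * g (x(i := x i - 1)))"
  have "(\<Sum>x\<in>?C. multinomial_prob A P (Suc k) x * thin A g x) = (\<Sum>x\<in>?C. \<Sum>i\<in>A. ?F i x)"
    by (intro sum.cong refl) (simp add: thin_def count_vectors_def sum_distrib_left)
  also have "\<dots> = (\<Sum>i\<in>A. \<Sum>x\<in>?C. ?F i x)" by (rule sum.swap)
  also have "\<dots> = (\<Sum>i\<in>A. P i * (\<Sum>y\<in>count_vectors A k. multinomial_prob A P k y * g y))"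
  proof (intro sum.cong refl)
    fix i assume i: "i \<in> A"
    have "(\<Sum>x\<in>?C. ?F i x) = (\<Sum>x\<in>{x\<in>?C. x i \<noteq> 0}. ?F i x)"
      by (intro sum.mono_neutral_right finite_count_vectors A) auto
    also have "\<dots> = (\<Sum>y\<in>count_vectors A k. P i * (multinomial_prob A P k y * g y))"
    proof (rule sum.reindex_bij_witness[where i = "\<lambda>y. y(i := Suc (y i))" and j = "\<lambda>x. x(i := x i - 1)"])
      fix x assume x: "x \<in> {x\<in>?C. x i \<noteq> 0}"
      let ?y = "x(i := x i - 1)"
      have xy: "x = ?y(i := Suc (?y i))" using x by (auto simp: fun_eq_iff)
      thus "?y(i := Suc (?y i)) = x" by simp
      have "(\<Sum>j\<in>A. ?y j) = (x i - 1) + (\<Sum>j\<in>A - {i}. x j)"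
        using A i by (simp add: sum.remove)
      moreover have "(\<Sum>j\<in>A. x j) = x i + (\<Sum>j\<in>A - {i}. x j)" using A i by (simp add: sum.remove)
      ultimately show "?y \<in> count_vectors A k" using x i by (auto simp: count_vectors_def)
      have "?F i x = multinomial_prob A P (Suc k) (?y(i := Suc (?y i))) * (real (Suc (?y i)) / real (Suc k)) * g ?y"
        using xy by (metis fun_upd_same mult.assoc)
      also have "\<dots> = P i * (multinomial_prob A P k ?y * g ?y)"
        unfolding multinomial_prob_Suc[OF A i] by simp
      finally show "P i * (multinomial_prob A P k ?y * g ?y) = ?F i x" ..
    next
      fix y assume y: "y \<in> count_vectors A k"
      show "(y(i := Suc (y i)))(i := (y(i := Suc (y i))) i - 1) = y" by auto
      have "(\<Sum>j\<in>A. (y(i := Suc (y i))) j) = Suc (y i) + (\<Sum>j\<in>A - {i}. y j)"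
        using A i by (simp add: sum.remove)
      moreover have "(\<Sum>j\<in>A. y j) = y i + (\<Sum>j\<in>A - {i}. y j)" using A i by (simp add: sum.remove)
      ultimately show "y(i := Suc (y i)) \<in> {x\<in>?C. x i \<noteq> 0}" using y i by (auto simp: count_vectors_def)
    qed
    finally show "(\<Sum>x\<in>?C. ?F i x) = P i * (\<Sum>y\<in>count_vectors A k. multinomial_prob A P k y * g y)"
      by (simp add: sum_distrib_left)
  qed
  also have "\<dots> = (\<Sum>y\<in>count_vectors A k. multinomial_prob A P k y * g y)"
    by (simp add: sum_distrib_right[symmetric] P)
  finally show ?thesis .
qed

text \<open>
  Thinning a constant function reduces the total probability for \<open>k + 1\<close> to that for \<open>k\<close>.
\<close>

lemma sum_multinomial_prob:
  assumes A: "finite A" and P: "(\<Sum>i\<in>A. P i) = 1"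
  shows "(\<Sum>x\<in>count_vectors A k. multinomial_prob A P k x) = 1"
proof (induction k)
  case 0
  have "count_vectors A 0 = {\<lambda>_. 0}" using A by (fastforce simp: count_vectors_def)
  then show ?case by (simp add: multinomial_prob_def)
next
  case (Suc k)
  have "thin A (\<lambda>_. 1) x = 1" if "x \<in> count_vectors A (Suc k)" for x
    using that by (simp add: thin_def count_vectors_def sum_divide_distrib[symmetric] flip: of_nat_sum)
  hence "(\<Sum>x\<in>count_vectors A (Suc k). multinomial_prob A P (Suc k) x)
     = (\<Sum>x\<in>count_vectors A (Suc k). multinomial_prob A P (Suc k) x * thin A (\<lambda>_. 1) x)"
    by simp
  thus ?case using sum_multinomial_prob_thin[OF A P, of k "\<lambda>_. 1"] Suc by simp
qed

definition multinomial_pmf :: "'a set \<Rightarrow> ('a \<Rightarrow> real) \<Rightarrow> nat \<Rightarrow> ('a \<Rightarrow> nat) pmf" where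
  "multinomial_pmf A P k = embed_pmf (\<lambda>x. if x \<in> count_vectors A k then multinomial_prob A P k x else 0)"

context
  fixes A :: "'a set" and P :: "'a \<Rightarrow> real"
  assumes A: "finite A" and P0: "\<And>i. i \<in> A \<Longrightarrow> 0 \<le> P i" and P1: "(\<Sum>i\<in>A. P i) = 1"
begin

lemma pmf_multinomial_pmf:
  "pmf (multinomial_pmf A P k) x = (if x \<in> count_vectors A k then multinomial_prob A P k x else 0)"
proof -
  have nn: "0 \<le> multinomial_prob A P k x" for x
    unfolding multinomial_prob_def using P0 by (intro mult_nonneg_nonneg prod_nonneg) auto
  have "(\<integral>\<^sup>+ x. ennreal (if x \<in> count_vectors A k then multinomial_prob A P k x else 0) \<partial>count_space UNIV)
      = (\<Sum>x\<in>count_vectors A k. ennreal (multinomial_prob A P k x))"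
    using finite_count_vectors[OF A] by (subst nn_integral_count_space'[of "count_vectors A k"]) auto
  also have "\<dots> = 1" using sum_multinomial_prob[OF A P1, of k] nn by (simp add: sum_ennreal)
  finally show ?thesis unfolding multinomial_pmf_def using nn by (subst pmf_embed_pmf) auto
qed

lemma expectation_multinomial_pmf:
  fixes g :: "_ \<Rightarrow> real"
  shows "measure_pmf.expectation (multinomial_pmf A P k) g = (\<Sum>x\<in>count_vectors A k. multinomial_prob A P k x * g x)"
  by (subst integral_measure_pmf[of "count_vectors A k"])
     (auto simp: finite_count_vectors[OF A] set_pmf_eq pmf_multinomial_pmf split: if_splits)

lemma expectation_multinomial_thin:
  "measure_pmf.expectation (multinomial_pmf A P (j + k)) ((thin A ^^ j) g) = measure_pmf.expectation (multinomial_pmf A P k) g"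
  by (induction j) (simp_all add: expectation_multinomial_pmf sum_multinomial_prob_thin[OF A P1])

text \<open>
  Independent Poisson counts are a multinomial sample of Poisson size.
\<close>

lemma Pi_pmf_poisson_eq_bind_multinomial:
  assumes r: "0 < r"
  shows "Pi_pmf A 0 (\<lambda>i. poisson_law (r * P i)) = bind_pmf (poisson_pmf r) (multinomial_pmf A P)"
proof (rule pmf_eqI)
  fix x :: "'a \<Rightarrow> nat"
  define k where "k = (\<Sum>i\<in>A. x i)"
  have "pmf (bind_pmf (poisson_pmf r) (multinomial_pmf A P)) x = pmf (poisson_pmf r) k * pmf (multinomial_pmf A P k) x"
    unfolding pmf_bind by (subst integral_measure_pmf[of "{k}"]) (auto simp: pmf_multinomial_pmf count_vectors_def k_def split: if_splits)
  also have "\<dots> = pmf (Pi_pmf A 0 (\<lambda>i. poisson_law (r * P i))) x"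
  proof (cases "\<forall>i. i \<notin> A \<longrightarrow> x i = 0")
    case True
    hence "x \<in> count_vectors A k" by (simp add: count_vectors_def k_def)
    hence "pmf (poisson_pmf r) k * pmf (multinomial_pmf A P k) x = exp (- r) * r ^ k * (\<Prod>i\<in>A. P i ^ x i / fact (x i))"
      using r by (simp add: pmf_multinomial_pmf multinomial_prob_def)
    also have "exp (- r) = exp (\<Sum>i\<in>A. - (r * P i))" using P1 by (simp add: sum_negf sum_distrib_left[symmetric])
    also have "\<dots> = (\<Prod>i\<in>A. exp (- (r * P i)))" using A by (rule exp_sum)
    also have "r ^ k = (\<Prod>i\<in>A. r ^ x i)" unfolding k_def by (rule power_sum)
    also have "(\<Prod>i\<in>A. exp (- (r * P i))) * (\<Prod>i\<in>A. r ^ x i) * (\<Prod>i\<in>A. P i ^ x i / fact (x i))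
        = (\<Prod>i\<in>A. pmf (poisson_law (r * P i)) (x i))"
      unfolding prod.distrib[symmetric] using r P0
      by (intro prod.cong refl) (simp add: pmf_poisson_law power_mult_distrib)
    also have "\<dots> = pmf (Pi_pmf A 0 (\<lambda>i. poisson_law (r * P i))) x"
      using True A by (simp add: pmf_Pi)
    finally show ?thesis .
  next
    case False
    thus ?thesis using A by (auto simp: pmf_multinomial_pmf count_vectors_def pmf_Pi)
  qed
  finally show "pmf (Pi_pmf A 0 (\<lambda>i. poisson_law (r * P i))) x = pmf (bind_pmf (poisson_pmf r) (multinomial_pmf A P)) x" ..
qed

end

lemma thin_in_unit:
  assumes "\<And>x. g x \<in> {0..1}"
  shows "thin A g x \<in> {0..1}"
proof -
  have "thin A g x \<le> (\<Sum>i\<in>A. real (x i) / real (\<Sum>i\<in>A. x i) * 1)"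
    unfolding thin_def using assms by (intro sum_mono mult_left_mono divide_nonneg_nonneg) (auto simp: sum_nonneg)
  also have "\<dots> \<le> 1" by (simp add: sum_divide_distrib[symmetric] flip: of_nat_sum)
  finally have "thin A g x \<le> 1" .
  moreover have "0 \<le> thin A g x" unfolding thin_def using assms by (intro sum_nonneg mult_nonneg_nonneg divide_nonneg_nonneg) (auto simp: sum_nonneg)
  ultimately show ?thesis by simp
qed

lemma funpow_thin_in_unit: "(\<And>x. g x \<in> {0..1}) \<Longrightarrow> (thin A ^^ j) g x \<in> {0..1}"
proof (induction j arbitrary: x)
  case (Suc j)
  show ?case using thin_in_unit[OF Suc.IH[OF Suc.prems]] by simp
qed simp

section \<open>Impossibility of testing between normalised priors\<close>

lemma expectation_ge_prob_times:
  fixes H :: "'a \<Rightarrow> real"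
  assumes "\<And>k. 0 \<le> H k" "\<And>k. H k \<le> B" "\<And>k. k \<in> K \<Longrightarrow> c \<le> H k" "0 \<le> c"
  shows "c * measure_pmf.prob M K \<le> measure_pmf.expectation M H"
proof -
  have "c * measure_pmf.prob M K = measure_pmf.expectation M (\<lambda>k. c * indicator K k)" by simp
  also have "\<dots> \<le> measure_pmf.expectation M H"
    using assms by (intro integral_mono integrable_pmf_bounded[where B = c] integrable_pmf_bounded[where B = B])
       (auto simp: indicator_def)
  finally show ?thesis .
qed

text \<open>
  A test \<open>\<psi>\<close> that, on the typical sets \<open>G\<close>, decides between the two priors from a Poisson sample of
  mean \<open>n\<close> from the normalised vector would give a test for the mixtures with unnormalised rates
  \<open>8 n p\<^sub>i\<close>. Averaging over the sample size yields one size \<open>k0 \<le> 2n\<close> at which \<open>\<psi>\<close> has a small error.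
  Under the unnormalised rates the sample has size at least \<open>2n\<close> with good probability, and thinned to
  size \<open>k0\<close> it is a multinomial sample from the normalised vector whatever its total mass. No such test
  exists if the mixtures are close.
\<close>

lemma mixed_poisson_test_impossible:
  fixes \<pi> :: "bool \<Rightarrow> (nat \<Rightarrow> real) pmf" and G :: "bool \<Rightarrow> (nat \<Rightarrow> real) set" and \<psi> :: "(nat \<Rightarrow> nat) \<Rightarrow> real" and S n :: nat
  defines "tot \<equiv> \<lambda>p. \<Sum>i=1..S. p i"
  assumes n: "2 \<le> n"
    and fin: "\<And>b. finite (set_pmf (\<pi> b))"
    and nonneg: "\<And>b p i. p \<in> set_pmf (\<pi> b) \<Longrightarrow> i \<in> {1..S} \<Longrightarrow> 0 \<le> p i"
    and mass: "\<And>b p. p \<in> G b \<Longrightarrow> 3/4 \<le> tot p"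
    and typical: "\<And>b. measure_pmf.prob (\<pi> b) (- G b) \<le> 1/8"
    and \<psi>: "\<And>x. \<psi> x \<in> {0..1}"
    and err0: "\<And>p. p \<in> set_pmf (\<pi> False) \<Longrightarrow> p \<in> G False \<Longrightarrow>
        measure_pmf.expectation (poisson_model S n (\<lambda>i. p i / tot p)) \<psi> \<le> 1/256"
    and err1: "\<And>p. p \<in> set_pmf (\<pi> True) \<Longrightarrow> p \<in> G True \<Longrightarrow>
        measure_pmf.expectation (poisson_model S n (\<lambda>i. p i / tot p)) (\<lambda>x. 1 - \<psi> x) \<le> 1/256"
    and close: "\<And>\<phi> :: (nat \<Rightarrow> nat) \<Rightarrow> real. (\<And>x. \<phi> x \<in> {0..1}) \<Longrightarrow>
        measure_pmf.expectation (bind_pmf (\<pi> True) (poisson_model S (8 * n))) \<phi>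
      - measure_pmf.expectation (bind_pmf (\<pi> False) (poisson_model S (8 * n))) \<phi> \<le> 1/8"
  shows False
proof -
  let ?A = "{1..S}"
  define test where "test = (\<lambda>b x. if b then 1 - \<psi> x else \<psi> x)"
  have test: "test b x \<in> {0..1}" for b x using \<psi>[of x] by (auto simp: test_def)
  define dir where "dir = (\<lambda>p i. p i / tot p :: real)"
  have dir: "finite ?A" "\<And>i. i \<in> ?A \<Longrightarrow> 0 \<le> dir p i" "(\<Sum>i\<in>?A. dir p i) = 1" "0 < tot p"
    if "p \<in> set_pmf (\<pi> b)" "p \<in> G b" for p b
  proof -
    show tot: "0 < tot p" using mass[OF that(2)] by simp
    show "\<And>i. i \<in> ?A \<Longrightarrow> 0 \<le> dir p i" using nonneg[OF that(1)] tot by (simp add: dir_def)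
    show "(\<Sum>i\<in>?A. dir p i) = 1"
      using tot unfolding dir_def sum_divide_distrib[symmetric] by (simp add: tot_def)
  qed simp
  have model: "poisson_model S m (\<lambda>i. c * dir p i) =
      bind_pmf (poisson_pmf (real m * c)) (multinomial_pmf ?A (dir p))"
    if "p \<in> set_pmf (\<pi> b)" "p \<in> G b" "0 < m" "0 < c" for p b m c
    unfolding poisson_model_def
    using Pi_pmf_poisson_eq_bind_multinomial[OF dir(1,2,3)[OF that(1,2)], of "real m * c"] that
    by (simp add: mult.assoc)

  \<comment> \<open>\<open>h\<close> is the error of the test at a fixed sample size for a fixed parameter, \<open>H\<close> its part of the Bayes error\<close>
  define h where "h = (\<lambda>b k p. measure_pmf.expectation (multinomial_pmf ?A (dir p) k) (test b))"
  have h: "h b k p \<in> {0..1}" for b k p unfolding h_def by (rule expectation_in_unit) (rule test)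
  define H where "H = (\<lambda>b k. \<Sum>p\<in>set_pmf (\<pi> b) \<inter> G b. pmf (\<pi> b) p * h b k p)"
  have H0: "0 \<le> H b k" for b k
    unfolding H_def using h by (intro sum_nonneg mult_nonneg_nonneg) auto
  have sub1: "(\<Sum>p\<in>set_pmf (\<pi> b) \<inter> G b. pmf (\<pi> b) p) \<le> 1" for b
    using sum_mono2[OF fin[of b], of "set_pmf (\<pi> b) \<inter> G b" "pmf (\<pi> b)"] sum_pmf_eq_1[OF fin[of b] order.refl]
    by simp
  have H1: "H b k \<le> 1" for b k
  proof -
    have "H b k \<le> (\<Sum>p\<in>set_pmf (\<pi> b) \<inter> G b. pmf (\<pi> b) p * 1)"
      unfolding H_def using h by (intro sum_mono mult_left_mono) auto
    thus ?thesis using sub1[of b] by simp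
  qed
  have avg: "measure_pmf.expectation (poisson_pmf (real n)) (H b) \<le> 1/256" for b
  proof -
    have "measure_pmf.expectation (poisson_pmf (real n)) (H b) =
        (\<Sum>p\<in>set_pmf (\<pi> b) \<inter> G b. pmf (\<pi> b) p * measure_pmf.expectation (poisson_pmf (real n)) (\<lambda>k. h b k p))"
      unfolding H_def using h
      by (subst Bochner_Integration.integral_sum) (auto intro!: integrable_mult_right integrable_pmf_bounded[where B = 1])
    also have "\<dots> \<le> (\<Sum>p\<in>set_pmf (\<pi> b) \<inter> G b. pmf (\<pi> b) p * (1/256))"
    proof (intro sum_mono mult_left_mono pmf_nonneg)
      fix p assume p: "p \<in> set_pmf (\<pi> b) \<inter> G b"
      have "measure_pmf.expectation (poisson_pmf (real n)) (\<lambda>k. h b k p) =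
          measure_pmf.expectation (poisson_model S n (dir p)) (test b)"
        using model[of p b n 1] p n test by (simp add: expectation_bind_unit h_def)
      also have "\<dots> \<le> 1/256"
        using p err0[of p] err1[of p] by (cases b) (simp_all add: test_def dir_def)
      finally show "measure_pmf.expectation (poisson_pmf (real n)) (\<lambda>k. h b k p) \<le> 1/256" .
    qed
    also have "\<dots> \<le> 1/256" using sub1[of b] unfolding sum_distrib_right[symmetric] by simp
    finally show ?thesis .
  qed
  \<comment> \<open>a Poisson variable of mean \<open>n\<close> is at most \<open>2n\<close> with probability at least a quarter, so the error at the best such size is at most four times the averaged error\<close>
  have "\<exists>k0\<le>2 * n. H False k0 + H True k0 \<le> 1/16"
  proof (rule ccontr)
    assume "\<not> ?thesis"
    hence low: "1/16 \<le> H False k + H True k" if "k \<in> {k. k \<le> 2 * n}" for k using that by fastforce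
    have "1/16 * measure_pmf.prob (poisson_pmf (real n)) {k. k \<le> 2 * n}
        \<le> measure_pmf.expectation (poisson_pmf (real n)) (\<lambda>k. H False k + H True k)"
    proof (rule expectation_ge_prob_times[where B = 2])
      show "H False k + H True k \<le> 2" for k using H1[of False k] H1[of True k] by linarith
    qed (use H0 low in auto)
    also have "\<dots> = measure_pmf.expectation (poisson_pmf (real n)) (H False) + measure_pmf.expectation (poisson_pmf (real n)) (H True)"
      using H0 H1 by (intro Bochner_Integration.integral_add integrable_pmf_bounded[where B = 1]) auto
    also have "\<dots> \<le> 1/256 + 1/256" by (intro add_mono avg)
    finally show False using poisson_upper_tail[of n] n by simp
  qed
  then obtain k0 where k0: "k0 \<le> 2 * n" "H False k0 + H True k0 \<le> 1/16" by blast

  \<comment> \<open>samples that are too small are attributed to the prior \<open>False\<close>\<close>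
  define \<phi> where "\<phi> = (\<lambda>x. let k = (\<Sum>i\<in>?A. x i) in if k < k0 then 0 else (thin ?A ^^ (k - k0)) \<psi> x)"
  have \<phi>: "\<phi> x \<in> {0..1}" for x
    using funpow_thin_in_unit[OF \<psi>, where A = ?A and j = "(\<Sum>i\<in>?A. x i) - k0" and x = x] by (simp add: \<phi>_def Let_def)
  define tail where "tail = (\<lambda>b x. if b then 1 - \<phi> x else \<phi> x)"
  have tail: "tail b x \<in> {0..1}" for b x using \<phi>[of x] by (auto simp: tail_def)
  have Etail: "measure_pmf.expectation M (tail b) \<in> {0..1}" for M b
    by (rule expectation_in_unit) (rule tail)
  have good: "measure_pmf.expectation (poisson_model S (8 * n) p) (tail b) \<le> h b k0 p + (if b then 1/2 else 0)"
    if p: "p \<in> set_pmf (\<pi> b)" "p \<in> G b" for p b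
  proof -
    have p_eq: "p = (\<lambda>i. tot p * dir p i)" using dir(4)[OF p] by (simp add: dir_def)
    have inner: "measure_pmf.expectation (multinomial_pmf ?A (dir p) k) (tail b) \<le>
        h b k0 p + (if b then indicator {k. k < 2 * n} k else 0)" for k
    proof (cases "k < k0")
      case True
      have "measure_pmf.expectation (multinomial_pmf ?A (dir p) k) (tail b) \<le> (if b then 1 else 0)"
      proof (cases b)
        case True
        thus ?thesis using Etail by simp
      next
        case False
        have "measure_pmf.expectation (multinomial_pmf ?A (dir p) k) \<phi>
            = (\<Sum>x\<in>count_vectors ?A k. multinomial_prob ?A (dir p) k x * \<phi> x)"
          by (rule expectation_multinomial_pmf[OF dir(1,2,3)[OF p]])
        also have "\<dots> = 0" using \<open>k < k0\<close> by (intro sum.neutral) (simp add: \<phi>_def count_vectors_def)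
        finally show ?thesis using False by (simp add: tail_def)
      qed
      thus ?thesis using True k0(1) h[of b k0 p] by (cases b) auto
    next
      case False
      have "measure_pmf.expectation (multinomial_pmf ?A (dir p) k) \<phi>
          = (\<Sum>x\<in>count_vectors ?A k. multinomial_prob ?A (dir p) k x * \<phi> x)"
        by (rule expectation_multinomial_pmf[OF dir(1,2,3)[OF p]])
      also have "\<dots> = (\<Sum>x\<in>count_vectors ?A k. multinomial_prob ?A (dir p) k x * (thin ?A ^^ (k - k0)) \<psi> x)"
        using False by (intro sum.cong refl) (simp add: \<phi>_def count_vectors_def)
      also have "\<dots> = measure_pmf.expectation (multinomial_pmf ?A (dir p) k) ((thin ?A ^^ (k - k0)) \<psi>)"
        by (rule expectation_multinomial_pmf[OF dir(1,2,3)[OF p], symmetric])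
      also have "\<dots> = measure_pmf.expectation (multinomial_pmf ?A (dir p) k0) \<psi>"
        using expectation_multinomial_thin[OF dir(1,2,3)[OF p], of "k - k0" k0 \<psi>] False by simp
      finally have "measure_pmf.expectation (multinomial_pmf ?A (dir p) k) \<phi> = \<dots>" .
      moreover have "integrable (measure_pmf M) \<phi>" "integrable (measure_pmf M) \<psi>" for M
        using \<phi> \<psi> by (auto intro!: integrable_pmf_bounded[where B = 1])
      ultimately have "measure_pmf.expectation (multinomial_pmf ?A (dir p) k) (tail b) = h b k0 p"
        by (cases b) (simp_all add: tail_def h_def test_def)
      thus ?thesis by simp
    qed
    have "measure_pmf.expectation (poisson_model S (8 * n) p) (tail b) =
        measure_pmf.expectation (poisson_pmf (real (8 * n) * tot p))
          (\<lambda>k. measure_pmf.expectation (multinomial_pmf ?A (dir p) k) (tail b))"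
      using model[OF p, of "8 * n" "tot p"] dir(4)[OF p] n tail
      by (subst p_eq) (simp add: expectation_bind_unit)
    also have "\<dots> \<le> measure_pmf.expectation (poisson_pmf (real (8 * n) * tot p))
          (\<lambda>k. h b k0 p + (if b then indicator {k. k < 2 * n} k else 0))"
    proof (intro integral_mono inner)
      show "integrable (measure_pmf (poisson_pmf (real (8 * n) * tot p)))
          (\<lambda>k. measure_pmf.expectation (multinomial_pmf ?A (dir p) k) (tail b))"
        using Etail by (intro integrable_pmf_bounded[where B = 1]) auto
      show "integrable (measure_pmf (poisson_pmf (real (8 * n) * tot p)))
          (\<lambda>k. h b k0 p + (if b then indicator {k. k < 2 * n} k else 0))"
        using h[of b k0 p] by (intro integrable_pmf_bounded[where B = 2]) (auto simp: indicator_def)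
    qed
    also have "\<dots> = h b k0 p + (if b then measure_pmf.prob (poisson_pmf (real (8 * n) * tot p)) {k. k < 2 * n} else 0)"
    proof (cases b)
      case True
      have "integrable (measure_pmf M) (indicator {k. k < 2 * n} :: nat \<Rightarrow> real)" for M
        by (intro integrable_pmf_bounded[where B = 1]) (auto simp: indicator_def)
      thus ?thesis using True by simp
    qed simp
    also have "measure_pmf.prob (poisson_pmf (real (8 * n) * tot p)) {k. k < 2 * n} \<le> exp (- real n / 2)"
      using mass[OF p(2)] n mult_left_mono[OF mass[OF p(2)], of "8 * real n"] by (intro poisson_lower_tail) auto
    also have "exp (- real n / 2) \<le> (1/2 :: real)"
    proof -
      have "exp (- real n / 2) \<le> exp (- 1 :: real)" using n by simp
      also have "\<dots> \<le> 1/2" using exp_ge_add_one_self[of "1::real"] by (simp add: exp_minus field_simps)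
      finally show ?thesis .
    qed
    finally show ?thesis by (simp split: if_splits)
  qed
  have total_err: "measure_pmf.expectation (bind_pmf (\<pi> b) (poisson_model S (8 * n))) (tail b)
      \<le> H b k0 + 1/8 + (if b then 1/2 else 0)" for b
  proof -
    let ?E = "\<lambda>p. measure_pmf.expectation (poisson_model S (8 * n) p) (tail b)"
    have E: "?E p \<in> {0..1}" for p by (rule expectation_in_unit) (rule tail)
    have "measure_pmf.expectation (bind_pmf (\<pi> b) (poisson_model S (8 * n))) (tail b) = measure_pmf.expectation (\<pi> b) ?E"
      using tail by (rule expectation_bind_unit)
    also have "\<dots> \<le> measure_pmf.expectation (\<pi> b)
       (\<lambda>p. (indicator (G b) p * h b k0 p + (if b then 1/2 else 0)) + indicator (- G b) p)"
    proof (rule integral_mono_AE)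
      show "AE p in measure_pmf (\<pi> b). ?E p \<le> (indicator (G b) p * h b k0 p + (if b then 1/2 else 0)) + indicator (- G b) p"
      proof (rule AE_pmfI)
        fix p assume "p \<in> set_pmf (\<pi> b)"
        thus "?E p \<le> (indicator (G b) p * h b k0 p + (if b then 1/2 else 0)) + indicator (- G b) p"
          using good[of p b] E[of p] by (cases "p \<in> G b") auto
      qed
    qed (auto intro!: integrable_measure_pmf_finite fin)
    also have "\<dots> = measure_pmf.expectation (\<pi> b) (\<lambda>p. indicator (G b) p * h b k0 p) + (if b then 1/2 else 0)
        + measure_pmf.prob (\<pi> b) (- G b)"
      by (simp add: integrable_measure_pmf_finite fin)
    also have "measure_pmf.expectation (\<pi> b) (\<lambda>p. indicator (G b) p * h b k0 p) = H b k0"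
    proof -
      have "measure_pmf.expectation (\<pi> b) (\<lambda>p. indicator (G b) p * h b k0 p)
         = (\<Sum>p\<in>set_pmf (\<pi> b). pmf (\<pi> b) p * (indicator (G b) p * h b k0 p))"
        by (rule expectation_finite_pmf[OF fin]) simp
      also have "\<dots> = H b k0" unfolding H_def
        using fin by (intro sum.mono_neutral_cong_right) auto
      finally show ?thesis .
    qed
    finally show ?thesis using typical[of b] by simp
  qed
  let ?E = "\<lambda>b f. measure_pmf.expectation (bind_pmf (\<pi> b) (poisson_model S (8 * n))) f"
  have int\<phi>: "integrable (measure_pmf M) \<phi>" for M using \<phi> by (intro integrable_pmf_bounded[where B = 1]) auto
  have "?E True (tail True) = 1 - ?E True \<phi>" "?E False (tail False) = ?E False \<phi>"
    using int\<phi> by (simp_all add: tail_def)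
  moreover have "?E True \<phi> - ?E False \<phi> \<le> 1/8" by (rule close) (rule \<phi>)
  ultimately show False using total_err[of True] total_err[of False] k0(2) by simp
qed

section \<open>From priors to the minimax risk\<close>

text \<open>
  Markov's inequality for the squared error: an estimate on the wrong side of a threshold that is \<open>\<delta>\<close> away
  from the truth costs at least \<open>\<delta>\<^sup>2\<close>.
\<close>

lemma test_error_le_risk:
  fixes \<psi> :: "(nat \<Rightarrow> nat) \<Rightarrow> real"
  assumes risk: "l1_risk S n Q L P \<le> ennreal \<rho>" and \<rho>: "0 \<le> \<rho>" and \<delta>: "0 < \<delta>"
    and \<psi>: "\<And>x. \<psi> x \<in> {0..1}"
    and far: "\<And>x. \<psi> x \<noteq> 0 \<Longrightarrow> \<delta> \<le> \<bar>L x - l1_dist S P Q\<bar>"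
  shows "measure_pmf.expectation (poisson_model S n P) \<psi> \<le> \<rho> / \<delta>\<^sup>2"
proof -
  let ?M = "poisson_model S n P"
  have int: "integrable (measure_pmf ?M) \<psi>" using \<psi> by (intro integrable_pmf_bounded[where B = 1]) auto
  have "ennreal (measure_pmf.expectation ?M (\<lambda>x. \<psi> x * \<delta>\<^sup>2)) = (\<integral>\<^sup>+x. ennreal (\<psi> x * \<delta>\<^sup>2) \<partial>measure_pmf ?M)"
    using int \<psi> by (intro nn_integral_eq_integral[symmetric]) auto
  also have "\<dots> \<le> l1_risk S n Q L P"
    unfolding l1_risk_def
  proof (intro nn_integral_mono ennreal_leI)
    fix x
    show "\<psi> x * \<delta>\<^sup>2 \<le> \<bar>L x - l1_dist S P Q\<bar>\<^sup>2"
    proof (cases "\<psi> x = 0")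
      case False
      have "\<psi> x * \<delta>\<^sup>2 \<le> 1 * \<bar>L x - l1_dist S P Q\<bar>\<^sup>2"
        using \<psi>[of x] far[OF False] \<delta> by (intro mult_mono power_mono) auto
      thus ?thesis by simp
    qed simp
  qed
  also note risk
  finally have "measure_pmf.expectation ?M \<psi> * \<delta>\<^sup>2 \<le> \<rho>" using \<rho> by (simp add: ennreal_le_iff)
  thus ?thesis using \<delta> by (simp add: field_simps)
qed

lemma l1_dist_normalise:
  assumes p: "\<And>i. i \<in> {1..S} \<Longrightarrow> 0 \<le> p i" and s: "0 < (\<Sum>i=1..S. p i)"
  shows "\<bar>l1_dist S (\<lambda>i. p i / (\<Sum>i=1..S. p i)) Q - l1_dist S p Q\<bar> \<le> \<bar>(\<Sum>i=1..S. p i) - 1\<bar>"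
proof -
  let ?s = "\<Sum>i=1..S. p i"
  have "\<bar>l1_dist S (\<lambda>i. p i / ?s) Q - l1_dist S p Q\<bar> \<le> (\<Sum>i=1..S. \<bar>\<bar>p i / ?s - Q i\<bar> - \<bar>p i - Q i\<bar>\<bar>)"
    unfolding l1_dist_def sum_subtractf[symmetric] by (rule sum_abs)
  also have "\<dots> \<le> (\<Sum>i=1..S. p i * \<bar>1 / ?s - 1\<bar>)"
  proof (rule sum_mono)
    fix i assume "i \<in> {1..S}"
    have "\<bar>\<bar>p i / ?s - Q i\<bar> - \<bar>p i - Q i\<bar>\<bar> \<le> \<bar>p i / ?s - p i\<bar>" by linarith
    also have "p i / ?s - p i = p i * (1 / ?s - 1)" by (simp add: algebra_simps)
    finally show "\<bar>\<bar>p i / ?s - Q i\<bar> - \<bar>p i - Q i\<bar>\<bar> \<le> p i * \<bar>1 / ?s - 1\<bar>"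
      using p[OF \<open>i \<in> _\<close>] by (simp add: abs_mult)
  qed
  also have "\<dots> = \<bar>?s * (1 / ?s - 1)\<bar>" using s by (simp add: sum_distrib_right[symmetric] abs_mult)
  also have "?s * (1 / ?s - 1) = 1 - ?s" using s by (simp add: algebra_simps)
  finally show ?thesis by linarith
qed

text \<open>
  A lower bound for the difference of the expected \<open>\<ell>\<^sub>1\<close> distances under the two product priors built
  from \<open>coordinate_priors\<close>.
\<close>

definition prior_gap :: "nat \<Rightarrow> (nat \<Rightarrow> real) \<Rightarrow> nat \<Rightarrow> real \<Rightarrow> real" where
  "prior_gap S Q D \<beta> = (\<Sum>i=1..S. min (Q i) (sqrt (Q i * \<beta>) / real D) / 5120)"

text \<open>
  The value of \<open>\<beta>\<close> makes \<open>8 n \<beta> = D / 16\<close>, the largest width for which the mixtures with rates \<open>8 n p\<^sub>i\<close> are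
  exponentially close. The assumption on the exponential sums the coordinatewise bounds; the
  last assumption bounds the variances of the total mass and of the distance, so that both deviate
  by less than an eighth of the gap with high probability. An estimator of small risk, compared with the
  middle of the gap, would then decide between the two priors.
\<close>

lemma minimax_risk_ge_prior_gap:
  fixes S n D :: nat and Q :: "nat \<Rightarrow> real"
  defines "\<beta> \<equiv> real D / (128 * real n)"
  assumes n: "2 \<le> n" and D: "16 \<le> D" and Q: "Q \<in> prob_vectors S"
    and pos: "0 < prior_gap S Q D \<beta>"
    and tv: "real S * (2 * exp (- real D / 2)) \<le> 1/8"
    and var: "4 * (\<beta> + real S * \<beta>\<^sup>2) \<le> (prior_gap S Q D \<beta> / 8)\<^sup>2 / 16"
  shows "ennreal ((prior_gap S Q D \<beta>)\<^sup>2 / 4096) \<le> l1_minimax_risk S n Q"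
proof (rule ccontr)
  let ?A = "{1..S}"
  define \<delta> where "\<delta> = prior_gap S Q D \<beta>"
  assume "\<not> ennreal ((prior_gap S Q D \<beta>)\<^sup>2 / 4096) \<le> l1_minimax_risk S n Q"
  hence "l1_minimax_risk S n Q < ennreal (\<delta>\<^sup>2 / 4096)" by (simp add: \<delta>_def)
  then obtain L where L: "(SUP P\<in>prob_vectors S. l1_risk S n Q L P) < ennreal (\<delta>\<^sup>2 / 4096)"
    unfolding l1_minimax_risk_def INF_less_iff by blast
  have risk: "l1_risk S n Q L P \<le> ennreal (\<delta>\<^sup>2 / 4096)" if "P \<in> prob_vectors S" for P
    using SUP_upper[OF that, of "l1_risk S n Q L"] L by (meson order.strict_implies_order order.trans)

  have Q0: "0 \<le> Q i" for i using Q by (cases "i \<in> ?A") (auto simp: prob_vectors_def)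
  have Q1: "(\<Sum>i\<in>?A. Q i) = 1" "sum Q {Suc 0..S} = 1" using Q by (simp_all add: prob_vectors_def)
  have \<beta>: "0 < \<beta>" using n D by (simp add: \<beta>_def)
  define c where "c = (\<lambda>i. max (Q i) \<beta>)"
  define w where "w = (\<lambda>i. sqrt (max (Q i) \<beta> * \<beta>))"
  have "\<exists>\<nu>0 \<nu>1 :: real pmf.
    finite (set_pmf \<nu>0) \<and> finite (set_pmf \<nu>1) \<and> set_pmf \<nu>0 \<subseteq> {c i - w i..c i + w i} \<and> set_pmf \<nu>1 \<subseteq> {c i - w i..c i + w i} \<and>
    (\<forall>p. degree p \<le> D \<longrightarrow> measure_pmf.expectation \<nu>0 (poly p) = measure_pmf.expectation \<nu>1 (poly p)) \<and>
    measure_pmf.expectation \<nu>0 (\<lambda>t. t) = Q i \<and>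
    measure_pmf.expectation \<nu>0 (\<lambda>t. \<bar>t - Q i\<bar>) + min (Q i) (sqrt (Q i * \<beta>) / real D) / 5120
       \<le> measure_pmf.expectation \<nu>1 (\<lambda>t. \<bar>t - Q i\<bar>)" for i
    unfolding c_def w_def using coordinate_priors[OF D Q0[of i] \<beta>] by metis
  then obtain \<nu>0 \<nu>1 :: "nat \<Rightarrow> real pmf" where
    fin: "\<And>i. finite (set_pmf (\<nu>0 i))" "\<And>i. finite (set_pmf (\<nu>1 i))"
    and sub: "\<And>i. set_pmf (\<nu>0 i) \<subseteq> {c i - w i..c i + w i}" "\<And>i. set_pmf (\<nu>1 i) \<subseteq> {c i - w i..c i + w i}"
    and mom: "\<And>i p. degree p \<le> D \<Longrightarrow> measure_pmf.expectation (\<nu>0 i) (poly p) = measure_pmf.expectation (\<nu>1 i) (poly p)"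
    and mean0: "\<And>i. measure_pmf.expectation (\<nu>0 i) (\<lambda>t. t) = Q i"
    and gap: "\<And>i. measure_pmf.expectation (\<nu>0 i) (\<lambda>t. \<bar>t - Q i\<bar>) + min (Q i) (sqrt (Q i * \<beta>) / real D) / 5120
       \<le> measure_pmf.expectation (\<nu>1 i) (\<lambda>t. \<bar>t - Q i\<bar>)"
    by metis
  define \<nu> where "\<nu> = (\<lambda>b. if b then \<nu>1 else \<nu>0)"
  have \<nu>: "finite (set_pmf (\<nu> b i))" "set_pmf (\<nu> b i) \<subseteq> {c i - w i..c i + w i}" for b i
    using fin sub by (auto simp: \<nu>_def)
  have int: "integrable (measure_pmf (\<nu> b i)) f" for b i and f :: "real \<Rightarrow> real"
    by (rule integrable_measure_pmf_finite[OF \<nu>(1)])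
  have mean: "measure_pmf.expectation (\<nu> b i) (\<lambda>t. t) = Q i" for b i
  proof -
    have "degree [:0, 1::real:] \<le> D" using D by simp
    moreover have "poly [:0, 1::real:] = (\<lambda>t. t)" by (simp add: fun_eq_iff)
    ultimately show ?thesis using mom[of "[:0, 1:]" i] mean0[of i] by (simp add: \<nu>_def)
  qed
  have w: "0 < w i" "w i \<le> c i" "(w i)\<^sup>2 = c i * \<beta>" for i
  proof -
    have c\<beta>: "\<beta> \<le> c i" by (simp add: c_def)
    show w2: "(w i)\<^sup>2 = c i * \<beta>" using \<beta> by (simp add: w_def c_def)
    show "0 < w i" using \<beta> by (simp add: w_def max_def)
    have "(w i)\<^sup>2 \<le> c i * c i" unfolding w2 using c\<beta> \<beta> by (intro mult_left_mono) auto
    also have "\<dots> = (c i)\<^sup>2" by (simp only: power2_eq_square)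
    finally show "w i \<le> c i" by (rule power2_le_imp_le) (use c\<beta> \<beta> in linarith)
  qed
  have Qw: "Q i \<in> {c i - w i..c i + w i}" for i
  proof (cases "\<beta> \<le> Q i")
    case True thus ?thesis using w[of i] by (auto simp: c_def max_def)
  next
    case False
    hence "w i = \<beta>" "c i = \<beta>" using \<beta> by (auto simp: w_def c_def max_def)
    thus ?thesis using False Q0[of i] by simp
  qed
  have supp0: "0 \<le> t" if "t \<in> set_pmf (\<nu> b i)" for t b i using \<nu>(2)[of b i] that w(2)[of i] by force

  define m where "m = (\<lambda>b i. measure_pmf.expectation (\<nu> b i) (\<lambda>t. \<bar>t - Q i\<bar>))"
  define M where "M = (\<lambda>b. \<Sum>i\<in>?A. m b i)"
  define e where "e = (M True - M False) / 8"
  have "\<delta> \<le> M True - M False"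
    unfolding \<delta>_def prior_gap_def M_def sum_subtractf[symmetric]
    using gap by (intro sum_mono) (simp add: m_def \<nu>_def le_diff_eq add.commute)
  hence e: "\<delta> / 8 \<le> e" by (simp add: e_def)
  have e0: "0 < e" using e pos by (simp add: \<delta>_def)
  have m2: "m b i \<le> 2 * Q i" for b i
  proof -
    have "m b i \<le> measure_pmf.expectation (\<nu> b i) (\<lambda>t. t + Q i)"
      unfolding m_def
    proof (intro integral_mono_AE int AE_pmfI)
      fix t assume "t \<in> set_pmf (\<nu> b i)"
      thus "\<bar>t - Q i\<bar> \<le> t + Q i" using supp0 Q0[of i] by fastforce
    qed
    thus ?thesis using int mean by simp
  qed
  have "M True \<le> (\<Sum>i\<in>?A. 2 * Q i)" unfolding M_def by (intro sum_mono m2)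
  also have "\<dots> = 2" by (simp add: sum_distrib_left[symmetric] Q1)
  finally have "M True \<le> 2" .
  moreover have "0 \<le> M False" unfolding M_def m_def by (intro sum_nonneg integral_nonneg_AE) auto
  ultimately have e_le: "e \<le> 1/4" by (simp add: e_def)

  have var2: "measure_pmf.expectation (\<nu> b i) (\<lambda>t. (t - Q i)\<^sup>2) \<le> 4 * (w i)\<^sup>2" for b i
  proof -
    have "measure_pmf.expectation (\<nu> b i) (\<lambda>t. (t - Q i)\<^sup>2) \<le> measure_pmf.expectation (\<nu> b i) (\<lambda>t. (2 * w i)\<^sup>2)"
    proof (intro integral_mono_AE int AE_pmfI)
      fix t assume "t \<in> set_pmf (\<nu> b i)"
      hence "t \<in> {c i - w i..c i + w i}" using \<nu>(2) by blast
      hence "\<bar>t - Q i\<bar> \<le> \<bar>2 * w i\<bar>" using Qw[of i] w(1)[of i] by auto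
      thus "(t - Q i)\<^sup>2 \<le> (2 * w i)\<^sup>2" by (simp only: abs_le_square_iff)
    qed
    thus ?thesis by (simp add: power_mult_distrib)
  qed
  have "(\<Sum>i\<in>?A. 4 * (w i)\<^sup>2) \<le> (\<Sum>i\<in>?A. 4 * \<beta> * (Q i + \<beta>))"
    unfolding w(3) using \<beta> Q0 by (intro sum_mono) (auto simp: c_def max_def mult.commute mult.left_commute)
  also have "\<dots> = 4 * \<beta> * ((\<Sum>i\<in>?A. Q i) + real S * \<beta>)"
    by (simp add: sum_distrib_left[symmetric] sum.distrib)
  also have "\<dots> = 4 * (\<beta> + real S * \<beta>\<^sup>2)"
    unfolding Q1 by (simp add: power2_eq_square algebra_simps)
  also have "\<dots> \<le> (\<delta> / 8)\<^sup>2 / 16" using var by (simp add: \<delta>_def)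
  also have "\<dots> \<le> e\<^sup>2 / 16" using e pos by (intro divide_right_mono power_mono) (auto simp: \<delta>_def)
  finally have V: "(\<Sum>i\<in>?A. 4 * (w i)\<^sup>2) \<le> e\<^sup>2 / 16" .

  define \<pi> where "\<pi> = (\<lambda>b. Pi_pmf ?A 0 (\<nu> b))"
  have fin\<pi>: "finite (set_pmf (\<pi> b))" for b unfolding \<pi>_def by (intro finite_set_Pi_pmf \<nu>) auto
  have supp\<pi>: "i \<in> ?A \<Longrightarrow> p i \<in> set_pmf (\<nu> b i)" "i \<notin> ?A \<Longrightarrow> p i = 0" if "p \<in> set_pmf (\<pi> b)" for p b i
    using that unfolding \<pi>_def set_Pi_pmf[OF finite_atLeastAtMost] PiE_dflt_def by (auto split: if_splits)
  have chebyshev: "measure_pmf.prob (\<pi> b) {p. e \<le> \<bar>\<Sum>i\<in>?A. f i (p i)\<bar>} \<le> 1/16"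
    if f0: "\<And>i. measure_pmf.expectation (\<nu> b i) (f i) = 0"
      and f2: "\<And>i. measure_pmf.expectation (\<nu> b i) (\<lambda>t. (f i t)\<^sup>2) \<le> 4 * (w i)\<^sup>2" for f :: "nat \<Rightarrow> real \<Rightarrow> real" and b
  proof -
    have "measure_pmf.prob (\<pi> b) {p. e \<le> \<bar>\<Sum>i\<in>?A. f i (p i)\<bar>}
        \<le> measure_pmf.expectation (\<pi> b) (\<lambda>p. (\<Sum>i\<in>?A. f i (p i))\<^sup>2) / e\<^sup>2"
      by (rule prob_abs_ge_le_second_moment[OF fin\<pi> e0])
    also have "measure_pmf.expectation (\<pi> b) (\<lambda>p. (\<Sum>i\<in>?A. f i (p i))\<^sup>2)
        = (\<Sum>i\<in>?A. measure_pmf.expectation (\<nu> b i) (\<lambda>t. (f i t)\<^sup>2))"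
      unfolding \<pi>_def by (rule Pi_pmf_sum_second_moment) (use \<nu>(1) f0 in auto)
    also have "\<dots> \<le> (\<Sum>i\<in>?A. 4 * (w i)\<^sup>2)" by (intro sum_mono f2)
    also note V
    finally show ?thesis using e0 by (simp add: divide_right_mono)
  qed
  \<comment> \<open>the typical sets: total mass and distance within \<open>e\<close> of their means\<close>
  define G where "G = (\<lambda>b. {p. \<bar>\<Sum>i\<in>?A. p i - Q i\<bar> < e \<and> \<bar>\<Sum>i\<in>?A. \<bar>p i - Q i\<bar> - m b i\<bar> < e})"
  have typical: "measure_pmf.prob (\<pi> b) (- G b) \<le> 1/8" for b
  proof -
    have 1: "measure_pmf.prob (\<pi> b) {p. e \<le> \<bar>\<Sum>i\<in>?A. p i - Q i\<bar>} \<le> 1/16"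
      by (rule chebyshev[of b "\<lambda>i t. t - Q i"]) (use int mean var2 in auto)
    have 2: "measure_pmf.prob (\<pi> b) {p. e \<le> \<bar>\<Sum>i\<in>?A. \<bar>p i - Q i\<bar> - m b i\<bar>} \<le> 1/16"
    proof (rule chebyshev[of b "\<lambda>i t. \<bar>t - Q i\<bar> - m b i"])
      show "measure_pmf.expectation (\<nu> b i) (\<lambda>t. \<bar>t - Q i\<bar> - m b i) = 0" for i using int by (simp add: m_def)
      have "measure_pmf.expectation (\<nu> b i) (\<lambda>t. (\<bar>t - Q i\<bar> - m b i)\<^sup>2) \<le> measure_pmf.expectation (\<nu> b i) (\<lambda>t. (t - Q i)\<^sup>2)" for i
        using measure_pmf.variance_eq[OF int int, of b i "\<lambda>t. \<bar>t - Q i\<bar>"] unfolding m_def by simp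
      thus "measure_pmf.expectation (\<nu> b i) (\<lambda>t. (\<bar>t - Q i\<bar> - m b i)\<^sup>2) \<le> 4 * (w i)\<^sup>2" for i
        using var2 order.trans by blast
    qed
    have "- G b = {p. e \<le> \<bar>\<Sum>i\<in>?A. p i - Q i\<bar>} \<union> {p. e \<le> \<bar>\<Sum>i\<in>?A. \<bar>p i - Q i\<bar> - m b i\<bar>}"
      by (auto simp: G_def not_less)
    hence "measure_pmf.prob (\<pi> b) (- G b) \<le> measure_pmf.prob (\<pi> b) {p. e \<le> \<bar>\<Sum>i\<in>?A. p i - Q i\<bar>}
        + measure_pmf.prob (\<pi> b) {p. e \<le> \<bar>\<Sum>i\<in>?A. \<bar>p i - Q i\<bar> - m b i\<bar>}"
      by (simp only: measure_Un_le sets_measure_pmf UNIV_I)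
    thus ?thesis using 1 2 by linarith
  qed

  have good: "l1_dist S (\<lambda>i. p i / (\<Sum>i=1..S. p i)) Q \<in> {M b - 2 * e<..<M b + 2 * e}"
      "(\<lambda>i. p i / (\<Sum>i=1..S. p i)) \<in> prob_vectors S" "3/4 \<le> (\<Sum>i=1..S. p i)"
    if p: "p \<in> set_pmf (\<pi> b)" "p \<in> G b" for p b
  proof -
    let ?s = "\<Sum>i=1..S. p i"
    have s: "\<bar>?s - 1\<bar> < e" using p(2) by (simp add: G_def sum_subtractf Q1)
    thus s34: "3/4 \<le> ?s" using e_le by linarith
    have p0: "0 \<le> p i" if "i \<in> {1..S}" for i using supp0 supp\<pi>(1)[OF p(1) that] by blast
    have "\<bar>l1_dist S p Q - M b\<bar> < e" using p(2) by (simp add: G_def sum_subtractf M_def l1_dist_def)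
    moreover have "\<bar>l1_dist S (\<lambda>i. p i / ?s) Q - l1_dist S p Q\<bar> \<le> \<bar>?s - 1\<bar>"
      by (rule l1_dist_normalise) (use p0 s34 in auto)
    ultimately show "l1_dist S (\<lambda>i. p i / ?s) Q \<in> {M b - 2 * e<..<M b + 2 * e}" using s by auto
    show "(\<lambda>i. p i / ?s) \<in> prob_vectors S"
      unfolding prob_vectors_def using p0 s34 supp\<pi>(2)[OF p(1)]
      by (auto simp: sum_divide_distrib[symmetric])
  qed

  \<comment> \<open>the means differ by \<open>8 e\<close>, and normalising and fluctuation move the distance by less than \<open>2 e\<close>\<close>
  define T where "T = M False + 4 * e"
  define \<psi> where "\<psi> = (\<lambda>x. if T \<le> L x then 1 else 0 :: real)"
  have MT: "M True = M False + 8 * e" by (simp add: e_def field_simps)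
  have small: "\<delta>\<^sup>2 / 4096 / (2 * e)\<^sup>2 \<le> 1/256"
  proof -
    have "(\<delta> / 8)\<^sup>2 \<le> e\<^sup>2" using e pos by (intro power_mono) (auto simp: \<delta>_def)
    thus ?thesis using e0 by (simp add: power_mult_distrib power_divide field_simps)
  qed
  have err: "measure_pmf.expectation (poisson_model S n (\<lambda>i. p i / (\<Sum>i=1..S. p i))) (\<lambda>x. if b then 1 - \<psi> x else \<psi> x) \<le> 1/256"
    if p: "p \<in> set_pmf (\<pi> b)" "p \<in> G b" for p b
  proof -
    have "measure_pmf.expectation (poisson_model S n (\<lambda>i. p i / (\<Sum>i=1..S. p i))) (\<lambda>x. if b then 1 - \<psi> x else \<psi> x)
        \<le> \<delta>\<^sup>2 / 4096 / (2 * e)\<^sup>2"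
    proof (rule test_error_le_risk[OF risk[OF good(2)[OF p]]])
      fix x
      show "(if b then 1 - \<psi> x else \<psi> x) \<in> {0..1}" by (simp add: \<psi>_def)
      assume "(if b then 1 - \<psi> x else \<psi> x) \<noteq> 0"
      thus "2 * e \<le> \<bar>L x - l1_dist S (\<lambda>i. p i / (\<Sum>i=1..S. p i)) Q\<bar>"
        using good(1)[OF p] MT by (cases b) (auto simp: \<psi>_def T_def split: if_splits)
    qed (use e0 in auto)
    thus ?thesis using small by linarith
  qed
  have close: "measure_pmf.expectation (bind_pmf (\<pi> True) (poisson_model S (8 * n))) \<phi>
      - measure_pmf.expectation (bind_pmf (\<pi> False) (poisson_model S (8 * n))) \<phi> \<le> 1/8"
    if \<phi>: "\<And>x. \<phi> x \<in> {0..1}" for \<phi> :: "(nat \<Rightarrow> nat) \<Rightarrow> real"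
  proof -
    have mix: "bind_pmf (\<pi> b) (poisson_model S (8 * n)) =
        Pi_pmf ?A 0 (\<lambda>i. bind_pmf (\<nu> b i) (\<lambda>t. poisson_law (real (8 * n) * t)))" for b
      unfolding \<pi>_def poisson_model_def by (rule Pi_pmf_bind[symmetric]) simp
    have "measure_pmf.expectation (bind_pmf (\<pi> True) (poisson_model S (8 * n))) \<phi>
      - measure_pmf.expectation (bind_pmf (\<pi> False) (poisson_model S (8 * n))) \<phi> \<le> (\<Sum>i\<in>?A. 2 * exp (- real D / 2))"
      unfolding mix
    proof (rule Pi_pmf_test_difference_le)
      fix i and g :: "nat \<Rightarrow> real"
      assume g: "\<And>x. g x \<in> {0..1}"
      have "real (8 * n) * (w i)\<^sup>2 = c i * (real D / 16)"
        unfolding w(3) \<beta>_def using n by simp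
      hence "real (8 * n) * (w i)\<^sup>2 \<le> c i * (real D / 16)" by simp
      moreover have "measure_pmf.expectation (\<nu> False i) (poly p) = measure_pmf.expectation (\<nu> True i) (poly p)"
        if "degree p \<le> D" for p using mom[OF that, of i] by (simp add: \<nu>_def)
      ultimately show "measure_pmf.expectation (bind_pmf (\<nu> True i) (\<lambda>t. poisson_law (real (8 * n) * t))) g
        - measure_pmf.expectation (bind_pmf (\<nu> False i) (\<lambda>t. poisson_law (real (8 * n) * t))) g \<le> 2 * exp (- real D / 2)"
        using n w(1,2)[of i] g
        by (intro poisson_mixtures_close[where c = "c i" and w = "w i"] \<nu>) auto
    qed (use \<phi> in auto)
    also have "\<dots> \<le> 1/8" using tv by simp
    finally show ?thesis .
  qed
  show False
  proof (rule mixed_poisson_test_impossible[of n \<pi> S G \<psi>])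
    show "measure_pmf.expectation (poisson_model S n (\<lambda>i. p i / (\<Sum>i=1..S. p i))) \<psi> \<le> 1/256"
      if "p \<in> set_pmf (\<pi> False)" "p \<in> G False" for p using err[OF that] by simp
    show "measure_pmf.expectation (poisson_model S n (\<lambda>i. p i / (\<Sum>i=1..S. p i))) (\<lambda>x. 1 - \<psi> x) \<le> 1/256"
      if "p \<in> set_pmf (\<pi> True)" "p \<in> G True" for p using err[OF that] by simp
    show "p \<in> G b \<Longrightarrow> 3/4 \<le> (\<Sum>i=1..S. p i)" for p b
      using e_le by (auto simp: G_def sum_subtractf Q1)
    show "p \<in> set_pmf (\<pi> b) \<Longrightarrow> i \<in> {1..S} \<Longrightarrow> 0 \<le> p i" for p b i
      using supp0 supp\<pi>(1) by blast
  qed (use n fin\<pi> typical close in \<open>auto simp: \<psi>_def\<close>)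
qed

section \<open>The rates\<close>

text \<open>
  The quantity whose square is the rate in (i).
\<close>

definition rate_sum :: "nat \<Rightarrow> nat \<Rightarrow> (nat \<Rightarrow> real) \<Rightarrow> real" where
  "rate_sum S n Q = (\<Sum>i=1..S. min (Q i) (sqrt (Q i / (real n * ln (real n)))))"

lemma ln_ge_two_thirds: "2 \<le> n \<Longrightarrow> 2/3 \<le> ln (real n)"
  using ln2_ge_two_thirds ln_le_cancel_iff[of 2 "real n"] by linarith

lemma prior_gap_ge_rate_sum:
  assumes n: "2 \<le> n" and D: "0 < D" "real D \<le> k * ln (real n)" and k: "1 \<le> k" and Q: "\<And>i. i \<in> {1..S} \<Longrightarrow> 0 \<le> Q i"
  shows "rate_sum S n Q / (5120 * sqrt (128 * k)) \<le> prior_gap S Q D (real D / (128 * real n))"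
  unfolding rate_sum_def prior_gap_def sum_divide_distrib
proof (rule sum_mono)
  fix i assume "i \<in> {1..S}"
  hence q: "0 \<le> Q i" by (rule Q)
  let ?L = "ln (real n)" and ?r = "sqrt (128 * k)"
  have L: "0 < ?L" using n by simp
  have r: "1 \<le> ?r" using k by simp
  have "Q i / (128 * k * (real n * ?L)) \<le> Q i / (128 * (real n * real D))"
    using q n D L k by (intro divide_left_mono mult_pos_pos) (auto simp: mult.assoc mult.left_commute)
  hence "sqrt (Q i / (128 * k * (real n * ?L))) \<le> sqrt (Q i / (128 * (real n * real D)))" by (rule real_sqrt_le_mono)
  also have "\<dots> = sqrt (Q i * (real D / (128 * real n)) / (real D)\<^sup>2)"
    using D n by (simp add: power2_eq_square field_simps)
  also have "\<dots> = sqrt (Q i * (real D / (128 * real n))) / real D" by (simp add: real_sqrt_divide real_sqrt_mult)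
  finally have "sqrt (Q i / (real n * ?L)) / ?r \<le> sqrt (Q i * (real D / (128 * real n))) / real D"
    by (simp add: real_sqrt_divide real_sqrt_mult mult_ac)
  moreover have "Q i / ?r \<le> Q i" using q r by (simp add: divide_le_eq mult_le_cancel_left1)
  moreover have "min (Q i) (sqrt (Q i / (real n * ?L))) / ?r = min (Q i / ?r) (sqrt (Q i / (real n * ?L)) / ?r)"
    using r by (auto simp: min_def divide_le_cancel)
  ultimately have "min (Q i) (sqrt (Q i / (real n * ?L))) / ?r
      \<le> min (Q i) (sqrt (Q i * (real D / (128 * real n))) / real D)" by linarith
  thus "min (Q i) (sqrt (Q i / (real n * ?L))) / (5120 * ?r)
      \<le> min (Q i) (sqrt (Q i * (real D / (128 * real n))) / real D) / 5120" by (simp add: mult.commute)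
qed

text \<open>
  The degree is \<open>D = K ln n\<close> with \<open>K\<close> large enough for \<open>exp (- D / 2)\<close> to beat the number of coordinates,
  which is at most \<open>n powr (1 / C)\<close>.
\<close>

lemma minimax_risk_ge_rate_sum:
  fixes C :: real
  assumes C: "0 < C"
  obtains C' a :: real where "0 < C'" "0 < a"
    "\<And>S n Q. 2 \<le> S \<Longrightarrow> 2 \<le> n \<Longrightarrow> C * ln (real S) \<le> ln (real n) \<Longrightarrow> Q \<in> prob_vectors S \<Longrightarrow>
       C' * (sqrt (ln (real n) / real n) + sqrt (real S) * ln (real n) / real n) \<le> rate_sum S n Q \<Longrightarrow>
       ennreal (a * (rate_sum S n Q)\<^sup>2) \<le> l1_minimax_risk S n Q"
proof -
  define K where "K = 2 / C + 24"
  define k where "k = K + 2"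
  have K: "24 \<le> K" using C by (simp add: K_def)
  have k: "1 \<le> k" using K by (simp add: k_def)
  define c1 where "c1 = 1 / (5120 * sqrt (128 * k))"
  have c1: "0 < c1" using k by (simp add: c1_def)
  show ?thesis
  proof (rule that[of "64 * k / c1" "c1\<^sup>2 / 4096"])
    fix S n Q
    assume S: "2 \<le> S" and n: "2 \<le> n" and CS: "C * ln (real S) \<le> ln (real n)" and Q: "Q \<in> prob_vectors S"
      and big: "64 * k / c1 * (sqrt (ln (real n) / real n) + sqrt (real S) * ln (real n) / real n) \<le> rate_sum S n Q"
    let ?L = "ln (real n)" and ?u = "ln (real n) / real n"
    have L: "2/3 \<le> ?L" by (rule ln_ge_two_thirds[OF n])
    have u: "0 < ?u" using L n by simp
    define D where "D = nat \<lceil>K * ?L\<rceil>"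
    have KL: "16 \<le> K * ?L" using mult_mono[OF K L] K by simp
    have D1: "K * ?L \<le> real D" unfolding D_def by (rule real_nat_ceiling_ge)
    have D2: "real D \<le> k * ?L"
    proof -
      have "real D \<le> K * ?L + 1" unfolding D_def using KL by linarith
      also have "\<dots> \<le> k * ?L" using L by (simp add: k_def algebra_simps)
      finally show ?thesis .
    qed
    have D16: "16 \<le> D" using KL D1 by linarith
    define \<beta> where "\<beta> = real D / (128 * real n)"
    have gap: "c1 * rate_sum S n Q \<le> prior_gap S Q D \<beta>"
      using prior_gap_ge_rate_sum[OF n _ D2 k, of S Q] D16 Q unfolding c1_def \<beta>_def
      by (simp add: prob_vectors_def)
    let ?v = "sqrt ?u + sqrt (real S) * ?L / real n"
    have v: "0 < ?v" using u L by (intro add_pos_nonneg) auto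
    have "64 * k * ?v \<le> c1 * rate_sum S n Q" using big c1 by (simp add: field_simps)
    hence gv: "64 * k * ?v \<le> prior_gap S Q D \<beta>" using gap by linarith
    have pos: "0 < prior_gap S Q D \<beta>"
      by (rule less_le_trans[OF _ gv]) (use k v in \<open>intro mult_pos_pos; simp\<close>)

    have tv: "real S * (2 * exp (- real D / 2)) \<le> 1/8"
    proof -
      have "ln (real S) \<le> ?L / C" using CS C by (simp add: field_simps)
      hence "exp (ln (real S)) \<le> exp (?L / C)" by (simp only: exp_le_cancel_iff)
      hence "real S \<le> exp (?L / C)" using S by simp
      moreover have "exp (- real D / 2) \<le> exp (- (K * ?L) / 2)" using D1 by simp
      ultimately have "real S * (2 * exp (- real D / 2)) \<le> exp (?L / C) * (2 * exp (- (K * ?L) / 2))"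
        by (intro mult_mono) auto
      also have "\<dots> = 2 * exp (- 12 * ?L)"
      proof -
        have "?L / C + - (K * ?L) / 2 = - 12 * ?L" using C by (simp add: K_def field_simps)
        thus ?thesis by (simp add: exp_add[symmetric])
      qed
      also have "\<dots> \<le> 2 * exp (- 8)" using L by simp
      also have "\<dots> \<le> 1/8"
        using exp_lower_Taylor_quadratic[of "8::real"] by (simp add: exp_minus field_simps)
      finally show ?thesis .
    qed
    have var: "4 * (\<beta> + real S * \<beta>\<^sup>2) \<le> (prior_gap S Q D \<beta> / 8)\<^sup>2 / 16"
    proof -
      have b0: "0 \<le> \<beta>" by (simp add: \<beta>_def)
      have b1: "\<beta> \<le> k * ?u"
      proof -
        have "\<beta> \<le> real D / real n" unfolding \<beta>_def using n by (intro divide_left_mono) auto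
        also have "\<dots> \<le> k * ?L / real n" using D2 by (intro divide_right_mono) auto
        finally show ?thesis by simp
      qed
      have "\<beta>\<^sup>2 \<le> (k * ?u)\<^sup>2" using b0 b1 by (intro power_mono)
      hence "real S * \<beta>\<^sup>2 \<le> real S * (k * ?u)\<^sup>2" by (intro mult_left_mono) auto
      moreover have "k * ?u \<le> k\<^sup>2 * ?u" using k u by (intro mult_right_mono) (auto simp: power2_eq_square)
      ultimately have "\<beta> + real S * \<beta>\<^sup>2 \<le> k\<^sup>2 * ?u + real S * (k * ?u)\<^sup>2"
        using b1 by linarith
      also have "\<dots> = k\<^sup>2 * (?u + real S * ?u\<^sup>2)"
        by (simp only: power_mult_distrib distrib_left mult.left_commute)
      also have "\<dots> \<le> k\<^sup>2 * ?v\<^sup>2"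
      proof (rule mult_left_mono)
        have "(sqrt ?u)\<^sup>2 = ?u" using u by simp
        moreover have "(sqrt (real S) * ?L / real n)\<^sup>2 = real S * ?u\<^sup>2"
          by (simp add: power_mult_distrib power_divide)
        moreover have "0 \<le> 2 * sqrt ?u * (sqrt (real S) * ?L / real n)" using u L by simp
        ultimately show "?u + real S * ?u\<^sup>2 \<le> ?v\<^sup>2" by (simp add: power2_sum)
      qed simp
      finally have "4 * (\<beta> + real S * \<beta>\<^sup>2) \<le> 4 * (k\<^sup>2 * ?v\<^sup>2)" by (simp add: mult_left_mono)
      also have "\<dots> = (64 * k * ?v / 8)\<^sup>2 / 16" by (simp add: power_mult_distrib power_divide)
      also have "\<dots> \<le> (prior_gap S Q D \<beta> / 8)\<^sup>2 / 16"
        using gv k v by (intro divide_right_mono power_mono) auto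
      finally show ?thesis .
    qed
    have r0: "0 \<le> rate_sum S n Q"
      using Q L n unfolding rate_sum_def by (intro sum_nonneg) (auto simp: prob_vectors_def)
    have "ennreal (c1\<^sup>2 / 4096 * (rate_sum S n Q)\<^sup>2) \<le> ennreal ((prior_gap S Q D \<beta>)\<^sup>2 / 4096)"
    proof (rule ennreal_leI)
      have "(c1 * rate_sum S n Q)\<^sup>2 \<le> (prior_gap S Q D \<beta>)\<^sup>2" using gap c1 r0 by (intro power_mono) auto
      thus "c1\<^sup>2 / 4096 * (rate_sum S n Q)\<^sup>2 \<le> (prior_gap S Q D \<beta>)\<^sup>2 / 4096"
        by (simp add: power_mult_distrib)
    qed
    also have "\<dots> \<le> l1_minimax_risk S n Q"
      using minimax_risk_ge_prior_gap[OF n D16 Q] pos tv var unfolding \<beta>_def by blast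
    finally show "ennreal (c1\<^sup>2 / 4096 * (rate_sum S n Q)\<^sup>2) \<le> l1_minimax_risk S n Q" .
  qed (use k c1 in auto)
qed

text \<open>
  All counts vanish with probability \<open>exp (- n)\<close> whatever \<open>P\<close> is.
\<close>

lemma risk_ge_no_observation:
  assumes P: "P \<in> prob_vectors S"
  shows "ennreal (\<bar>L (\<lambda>_. 0) - l1_dist S P Q\<bar>\<^sup>2 * exp (- real n)) \<le> l1_risk S n Q L P"
proof -
  let ?M = "poisson_model S n P" and ?z = "\<lambda>_::nat. 0::nat"
  have "pmf ?M ?z = (\<Prod>i=1..S. exp (- (real n * P i)))"
    unfolding poisson_model_def using P
    by (subst pmf_Pi) (auto simp: pmf_poisson_law prob_vectors_def intro!: prod.cong)
  also have "\<dots> = exp (\<Sum>i=1..S. - (real n * P i))" by (simp add: exp_sum)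
  also have "(\<Sum>i=1..S. - (real n * P i)) = - real n"
    using P by (simp add: sum_negf sum_distrib_left[symmetric] prob_vectors_def)
  finally have pz: "pmf ?M ?z = exp (- real n)" .
  have "ennreal (\<bar>L ?z - l1_dist S P Q\<bar>\<^sup>2 * exp (- real n)) = ennreal (\<bar>L ?z - l1_dist S P Q\<bar>\<^sup>2) * emeasure (measure_pmf ?M) {?z}"
    by (simp add: emeasure_pmf_single pz ennreal_mult)
  also have "\<dots> = (\<integral>\<^sup>+X. ennreal (\<bar>L ?z - l1_dist S P Q\<bar>\<^sup>2) * indicator {?z} X \<partial>measure_pmf ?M)"
    by (subst nn_integral_cmult_indicator) auto
  also have "\<dots> \<le> l1_risk S n Q L P"
    unfolding l1_risk_def by (intro nn_integral_mono) (auto simp: indicator_def)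
  finally show ?thesis .
qed

text \<open>
  On the event of empty data an estimator gives one value, but the \<open>\<ell>\<^sub>1\<close> distance to a point mass is \<open>0\<close>
  for that point mass and \<open>2\<close> for another one.
\<close>

lemma exp_le_sup_minimax_risk:
  assumes S: "2 \<le> S"
  shows "ennreal (exp (- real n)) \<le> (SUP Q\<in>prob_vectors S. l1_minimax_risk S n Q)"
proof -
  define pt where "pt = (\<lambda>j i::nat. if i = j then 1 else 0 :: real)"
  have pt: "pt j \<in> prob_vectors S" if "j \<in> {1..S}" for j
    using that by (auto simp: prob_vectors_def pt_def)
  have d0: "l1_dist S (pt 1) (pt 1) = 0" by (simp add: l1_dist_def)
  have "l1_dist S (pt 2) (pt 1) = (\<Sum>i=1..S. (if i = 1 then 1 else 0) + (if i = 2 then 1 else 0))"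
    unfolding l1_dist_def by (intro sum.cong) (auto simp: pt_def)
  also have "\<dots> = 2" using S by (simp add: sum.distrib)
  finally have d2: "l1_dist S (pt 2) (pt 1) = 2" .
  have "ennreal (exp (- real n)) \<le> l1_minimax_risk S n (pt 1)"
    unfolding l1_minimax_risk_def
  proof (rule INF_greatest)
    fix L :: "(nat \<Rightarrow> nat) \<Rightarrow> real"
    have "\<exists>j\<in>{1, 2::nat}. 1 \<le> \<bar>L (\<lambda>_. 0) - l1_dist S (pt j) (pt 1)\<bar>"
      using d0 d2 by (cases "L (\<lambda>_. 0) \<ge> 1") auto
    then obtain j where j: "j \<in> {1, 2::nat}" "1 \<le> \<bar>L (\<lambda>_. 0) - l1_dist S (pt j) (pt 1)\<bar>" by blast
    have ptj: "pt j \<in> prob_vectors S" using j(1) S by (intro pt) auto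
    have "1 \<le> \<bar>L (\<lambda>_. 0) - l1_dist S (pt j) (pt 1)\<bar>\<^sup>2" using j(2) by (rule one_le_power)
    hence "ennreal (1 * exp (- real n)) \<le> ennreal (\<bar>L (\<lambda>_. 0) - l1_dist S (pt j) (pt 1)\<bar>\<^sup>2 * exp (- real n))"
      by (intro ennreal_leI mult_right_mono) auto
    also have "\<dots> \<le> l1_risk S n (pt 1) L (pt j)" by (rule risk_ge_no_observation[OF ptj])
    also have "\<dots> \<le> (SUP P\<in>prob_vectors S. l1_risk S n (pt 1) L P)" by (rule SUP_upper[OF ptj])
    finally show "ennreal (exp (- real n)) \<le> (SUP P\<in>prob_vectors S. l1_risk S n (pt 1) L P)" by simp
  qed
  also have "\<dots> \<le> (SUP Q\<in>prob_vectors S. l1_minimax_risk S n Q)"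
    by (rule SUP_upper) (use pt S in auto)
  finally show ?thesis .
qed

definition uniform_vector :: "nat \<Rightarrow> nat \<Rightarrow> real" where
  "uniform_vector S = (\<lambda>i. if i \<in> {1..S} then 1 / real S else 0)"

lemma uniform_vector_in_prob_vectors: "0 < S \<Longrightarrow> uniform_vector S \<in> prob_vectors S"
  by (auto simp: prob_vectors_def uniform_vector_def)

lemma rate_sum_uniform:
  assumes S: "0 < S" and n: "2 \<le> n"
  shows "rate_sum S n (uniform_vector S) = min 1 (sqrt (real S / (real n * ln (real n))))"
proof -
  let ?m = "real n * ln (real n)"
  have "rate_sum S n (uniform_vector S) = real S * min (1 / real S) (sqrt (1 / real S / ?m))"
    unfolding rate_sum_def by (simp add: uniform_vector_def)
  also have "\<dots> = min 1 (real S * sqrt (1 / real S / ?m))"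
    using S by (simp add: min_mult_distrib_left)
  also have "real S * sqrt (1 / real S / ?m) = sqrt ((real S)\<^sup>2) * sqrt (1 / real S / ?m)" by simp
  also have "\<dots> = sqrt ((real S)\<^sup>2 * (1 / real S / ?m))" by (rule real_sqrt_mult[symmetric])
  also have "(real S)\<^sup>2 * (1 / real S / ?m) = real S / ?m" using S by (simp add: power2_eq_square)
  finally show ?thesis .
qed

text \<open>
  For uniform \<open>Q\<close> the rate is \<open>min 1 (sqrt (S / (n ln n)))\<close>, and \<open>n \<ge> c S / ln S\<close> bounds the square root.
  The two terms on the right hand side of the hypothesis of (i) are dominated once \<open>S\<close> is larger than
  a constant times \<open>(ln n)\<^sup>2\<close> and \<open>n\<close> larger than a constant times \<open>(ln n)\<^sup>3\<close>, which holds for all large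
  \<open>S\<close>. For the remaining \<open>S\<close> the upper bound on \<open>ln n\<close> leaves finitely many \<open>n\<close>.
\<close>

lemma sup_minimax_risk_ge:
  fixes c C :: real
  assumes c: "0 < c" and C: "0 < C"
  obtains a :: real where "0 < a"
    "\<And>S n. 2 \<le> S \<Longrightarrow> 2 \<le> n \<Longrightarrow> c * (real S / ln (real S)) \<le> real n \<Longrightarrow> ln (real n) \<le> C * ln (real S) \<Longrightarrow>
       ennreal (a * (real S / (real n * ln (real n)))) \<le> (SUP Q\<in>prob_vectors S. l1_minimax_risk S n Q)"
proof -
  obtain C' a1 :: real where C': "0 < C'" and a1: "0 < a1"
    and part1: "\<And>S n Q. 2 \<le> S \<Longrightarrow> 2 \<le> n \<Longrightarrow> 1/2 * ln (real S) \<le> ln (real n) \<Longrightarrow> Q \<in> prob_vectors S \<Longrightarrow>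
       C' * (sqrt (ln (real n) / real n) + sqrt (real S) * ln (real n) / real n) \<le> rate_sum S n Q \<Longrightarrow>
       ennreal (a1 * (rate_sum S n Q)\<^sup>2) \<le> l1_minimax_risk S n Q"
    using minimax_risk_ge_rate_sum[of "1/2"] by (metis half_gt_zero_iff zero_less_one)
  define b where "b = min 1 (sqrt (c / 2))"
  have b: "0 < b" "b \<le> 1" "b \<le> sqrt (c / 2)" using c by (auto simp: b_def)
  \<comment> \<open>\<open>b\<close> is the constant with \<open>min 1 z \<ge> b z\<close> for \<open>z \<le> sqrt (2 / c)\<close>; \<open>B\<close> lets each of the two error terms take half of \<open>b z\<close>\<close>
  define B where "B = (2 * C' / b)\<^sup>2"
  have B0: "0 < B" using C' b by (simp add: B_def)
  have e1: "eventually (\<lambda>x::real. sqrt x \<le> c * (x / ln x)) at_top" using c by real_asymp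
  have e2: "eventually (\<lambda>x::real. B * (C * ln x)\<^sup>2 \<le> x) at_top" using B0 C by real_asymp
  have "eventually (\<lambda>y::real. B * ln y ^ 3 \<le> y) at_top" using B0 by real_asymp
  then obtain N0 where N0: "\<And>y::real. N0 \<le> y \<Longrightarrow> B * ln y ^ 3 \<le> y" by (auto simp: eventually_at_top_linorder)
  have e3: "eventually (\<lambda>x::real. N0 \<le> sqrt x) at_top" by real_asymp
  from e1 e2 e3 have "eventually (\<lambda>x::real. sqrt x \<le> c * (x / ln x) \<and> B * (C * ln x)\<^sup>2 \<le> x \<and> N0 \<le> sqrt x) at_top"
    by eventually_elim auto
  then obtain X0 where X0: "\<And>x::real. X0 \<le> x \<Longrightarrow> sqrt x \<le> c * (x / ln x) \<and> B * (C * ln x)\<^sup>2 \<le> x \<and> N0 \<le> sqrt x"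
    by (auto simp: eventually_at_top_linorder)
  define S0 where "S0 = max X0 2"
  define n0 where "n0 = exp (C * ln S0)"
  define a where "a = min (a1 * b\<^sup>2) (exp (- n0) / S0)"
  have S0: "2 \<le> S0" "X0 \<le> S0" by (auto simp: S0_def)
  show ?thesis
  proof (rule that[of a])
    show "0 < a" using a1 b S0 by (simp add: a_def)
    fix S n :: nat
    assume S: "2 \<le> S" and n: "2 \<le> n" and n1: "c * (real S / ln (real S)) \<le> real n" and n2: "ln (real n) \<le> C * ln (real S)"
    let ?L = "ln (real n)" and ?z2 = "real S / (real n * ln (real n))"
    have L: "2/3 \<le> ?L" by (rule ln_ge_two_thirds[OF n])
    have z0: "0 < ?z2" using S n L by (intro divide_pos_pos mult_pos_pos) auto
    show "ennreal (a * ?z2) \<le> (SUP Q\<in>prob_vectors S. l1_minimax_risk S n Q)"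
    proof (cases "S0 \<le> real S")
      case False
      have "real n \<le> n0"
      proof -
        have "ln (real S) \<le> ln S0" using False S by (intro ln_mono) auto
        hence "C * ln (real S) \<le> C * ln S0" using C by (intro mult_left_mono) auto
        hence "?L \<le> C * ln S0" using n2 by linarith
        hence "exp ?L \<le> n0" unfolding n0_def by (simp only: exp_le_cancel_iff)
        thus ?thesis using n by simp
      qed
      have "1 \<le> real n * ?L" using mult_mono[of 2 "real n" "2/3" ?L] n L by simp
      hence "?z2 \<le> real S / 1" using S by (intro divide_left_mono) auto
      hence "?z2 \<le> S0" using False by simp
      hence "a * ?z2 \<le> exp (- n0) / S0 * S0" using z0 S0 by (intro mult_mono) (auto simp: a_def)
      also have "\<dots> = exp (- n0)" using S0 by simp
      also have "\<dots> \<le> exp (- real n)" using \<open>real n \<le> n0\<close> by simp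
      finally have "ennreal (a * ?z2) \<le> ennreal (exp (- real n))" by (rule ennreal_leI)
      also note exp_le_sup_minimax_risk[OF S]
      finally show ?thesis .
    next
      case True
      hence x: "sqrt (real S) \<le> c * (real S / ln (real S))" "B * (C * ln (real S))\<^sup>2 \<le> real S" "N0 \<le> sqrt (real S)"
        using X0[of "real S"] S0 by auto
      have nS: "sqrt (real S) \<le> real n" using x n1 by linarith
      have "ln (sqrt (real S)) \<le> ?L" using nS S by (intro ln_mono) auto
      hence half: "1/2 * ln (real S) \<le> ?L" using S by (simp add: ln_sqrt)
      have lnS: "0 < ln (real S)" using S by simp
      have z2c: "?z2 \<le> 2 / c"
      proof -
        have "c * (real S / ln (real S)) * (1/2 * ln (real S)) \<le> real n * ?L"
          using n1 half lnS by (intro mult_mono) auto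
        hence "c * real S / 2 \<le> real n * ?L" using lnS by simp
        thus ?thesis using c n L by (simp add: field_simps)
      qed
      have bz: "b * sqrt ?z2 \<le> rate_sum S n (uniform_vector S)"
      proof -
        have "sqrt ?z2 \<le> sqrt (2 / c)" using z2c by (rule real_sqrt_le_mono)
        hence "b * sqrt ?z2 \<le> sqrt (c / 2) * sqrt (2 / c)" using b z0 c by (intro mult_mono) auto
        also have "\<dots> = 1" using c by (simp add: real_sqrt_mult[symmetric])
        finally have "b * sqrt ?z2 \<le> 1" .
        moreover have "b * sqrt ?z2 \<le> sqrt ?z2" using b z0 by (intro mult_left_le_one_le) auto
        ultimately show ?thesis using S n by (subst rate_sum_uniform) auto
      qed
      have half_of: "C' * X \<le> b * sqrt ?z2 / 2" if "B * X\<^sup>2 \<le> ?z2" for X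
      proof -
        have "(2 * C' / b * X)\<^sup>2 \<le> ?z2" using that by (simp only: B_def power_mult_distrib)
        hence "2 * C' / b * X \<le> sqrt ?z2" by (rule real_le_rsqrt)
        thus ?thesis using b by (simp add: field_simps)
      qed
      have half1: "C' * sqrt (?L / real n) \<le> b * sqrt ?z2 / 2"
      proof (rule half_of)
        have "B * ?L\<^sup>2 \<le> B * (C * ln (real S))\<^sup>2"
          using n2 L B0 by (intro mult_left_mono power_mono) auto
        hence "B * ?L\<^sup>2 \<le> real S" using x by linarith
        hence "B * ?L\<^sup>2 / (real n * ?L) \<le> ?z2" using n L by (intro divide_right_mono) auto
        moreover have "B * ?L\<^sup>2 / (real n * ?L) = B * (?L / real n)" using L by (simp add: power2_eq_square)
        moreover have "(sqrt (?L / real n))\<^sup>2 = ?L / real n" using L by simp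
        ultimately show "B * (sqrt (?L / real n))\<^sup>2 \<le> ?z2" by (simp only:)
      qed
      have half2: "C' * (sqrt (real S) * ?L / real n) \<le> b * sqrt ?z2 / 2"
      proof (rule half_of)
        have "B * ?L ^ 3 \<le> real n" using N0[of "real n"] x nS by linarith
        hence "B * ?L ^ 3 * (real S / ((real n)\<^sup>2 * ?L)) \<le> real n * (real S / ((real n)\<^sup>2 * ?L))"
          using L by (intro mult_right_mono) auto
        moreover have "B * ?L ^ 3 * (real S / ((real n)\<^sup>2 * ?L)) = B * (sqrt (real S) * ?L / real n)\<^sup>2"
          using L n by (simp add: power_mult_distrib power_divide power2_eq_square power3_eq_cube)
        moreover have "real n * (real S / ((real n)\<^sup>2 * ?L)) = ?z2" using n by (simp add: power2_eq_square)
        ultimately show "B * (sqrt (real S) * ?L / real n)\<^sup>2 \<le> ?z2" by (simp only:)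
      qed
      have "C' * (sqrt (?L / real n) + sqrt (real S) * ?L / real n) \<le> rate_sum S n (uniform_vector S)"
        unfolding distrib_left using half1 half2 bz by linarith
      hence r: "ennreal (a1 * (rate_sum S n (uniform_vector S))\<^sup>2) \<le> l1_minimax_risk S n (uniform_vector S)"
        using S by (intro part1[OF S n half uniform_vector_in_prob_vectors]) auto
      have "a * ?z2 \<le> a1 * b\<^sup>2 * ?z2" using z0 by (intro mult_right_mono) (auto simp: a_def)
      also have "\<dots> = a1 * (b * sqrt ?z2)\<^sup>2" using z0 by (simp add: power_mult_distrib)
      also have "\<dots> \<le> a1 * (rate_sum S n (uniform_vector S))\<^sup>2"
        using a1 b bz z0 by (intro mult_left_mono power_mono) auto
      finally have "ennreal (a * ?z2) \<le> \<dots>" by (rule ennreal_leI)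
      also note r
      also have "l1_minimax_risk S n (uniform_vector S) \<le> (SUP Q\<in>prob_vectors S. l1_minimax_risk S n Q)"
        by (rule SUP_upper[OF uniform_vector_in_prob_vectors]) (use S in auto)
      finally show ?thesis .
    qed
  qed
qed

theorem theorem3:
  shows "(\<forall>C::real. C > 0 \<longrightarrow> (\<exists>C'::real. \<exists>a::real. C' > 0 \<and> a > 0 \<and>
           (\<forall>(S::nat) (n::nat) Q.
              S \<ge> 2 \<longrightarrow> n \<ge> 2 \<longrightarrow> ln (real n) \<ge> C * ln (real S) \<longrightarrow> Q \<in> prob_vectors S \<longrightarrow>
              (\<Sum>j=1..S. min (Q j) (sqrt (Q j / (real n * ln (real n)))))
                \<ge> C' * (sqrt (ln (real n) / real n) + sqrt (real S) * ln (real n) / real n) \<longrightarrow>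
              l1_minimax_risk S n Q
                \<ge> ennreal (a * (\<Sum>i=1..S. min (Q i) (sqrt (Q i / (real n * ln (real n)))))\<^sup>2))))
       \<and>
         (\<forall>(c::real) (C::real). c > 0 \<longrightarrow> C > 0 \<longrightarrow> (\<exists>a::real. a > 0 \<and>
           (\<forall>(S::nat) (n::nat).
              S \<ge> 2 \<longrightarrow> n \<ge> 2 \<longrightarrow> real n \<ge> c * (real S / ln (real S)) \<longrightarrow>
              ln (real n) \<le> C * ln (real S) \<longrightarrow>
              (SUP Q\<in>prob_vectors S. l1_minimax_risk S n Q)
                \<ge> ennreal (a * (real S / (real n * ln (real n)))))))"
proof (intro conjI allI impI)
  fix C :: real assume "C > 0"
  from minimax_risk_ge_rate_sum[OF this] obtain C' a where "0 < C'" "0 < a"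
    "\<And>S n Q. 2 \<le> S \<Longrightarrow> 2 \<le> n \<Longrightarrow> C * ln (real S) \<le> ln (real n) \<Longrightarrow> Q \<in> prob_vectors S \<Longrightarrow>
       C' * (sqrt (ln (real n) / real n) + sqrt (real S) * ln (real n) / real n) \<le> rate_sum S n Q \<Longrightarrow>
       ennreal (a * (rate_sum S n Q)\<^sup>2) \<le> l1_minimax_risk S n Q" by blast
  thus "\<exists>C'::real. \<exists>a::real. C' > 0 \<and> a > 0 \<and>
           (\<forall>(S::nat) (n::nat) Q.
              S \<ge> 2 \<longrightarrow> n \<ge> 2 \<longrightarrow> ln (real n) \<ge> C * ln (real S) \<longrightarrow> Q \<in> prob_vectors S \<longrightarrow>
              (\<Sum>j=1..S. min (Q j) (sqrt (Q j / (real n * ln (real n)))))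
                \<ge> C' * (sqrt (ln (real n) / real n) + sqrt (real S) * ln (real n) / real n) \<longrightarrow>
              l1_minimax_risk S n Q
                \<ge> ennreal (a * (\<Sum>i=1..S. min (Q i) (sqrt (Q i / (real n * ln (real n)))))\<^sup>2))"
    unfolding rate_sum_def by blast
next
  fix c C :: real assume "c > 0" "C > 0"
  from sup_minimax_risk_ge[OF this] obtain a where "0 < a"
    "\<And>S n. 2 \<le> S \<Longrightarrow> 2 \<le> n \<Longrightarrow> c * (real S / ln (real S)) \<le> real n \<Longrightarrow> ln (real n) \<le> C * ln (real S) \<Longrightarrow>
       ennreal (a * (real S / (real n * ln (real n)))) \<le> (SUP Q\<in>prob_vectors S. l1_minimax_risk S n Q)" by blast
  thus "\<exists>a::real. a > 0 \<and>
           (\<forall>(S::nat) (n::nat).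
              S \<ge> 2 \<longrightarrow> n \<ge> 2 \<longrightarrow> real n \<ge> c * (real S / ln (real S)) \<longrightarrow>
              ln (real n) \<le> C * ln (real S) \<longrightarrow>
              (SUP Q\<in>prob_vectors S. l1_minimax_risk S n Q)
                \<ge> ennreal (a * (real S / (real n * ln (real n)))))"
    by blast
qed

end
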